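(* Let $n\ge1$, let $(M^{2n+1},\eta,H)$ be a smooth autonomous contact Hamiltonian system, and let $\Phi:M\to M$ be a contact canonoid map for it. Set $X=X_H$, $\mu=\eta\wedge(d\eta)^n$, $\alpha=\Phi^*\eta$, $K=-\alpha(X)$, and work on $V=\{K\neq0\}$. Let $\beta=(H/K)\alpha$ and let $\mathcal P(t)=1+\sum_{j=1}^{n+1}C_jt^j$ be the polynomial in $t$, with coefficients functions on $V$, defined by $$(\eta+t\beta)\wedge(d\eta+t\,d\beta)^n=\mathcal P(t)\,\mu .$$ Let $\mathcal D=\ker(\eta|_V)$, let $N:TV\to TV$ be the invariant endomorphism associated with $\Phi$ (defined in the context), and let $A=N|_{\mathcal D}$. Then there exists a polynomial $Q(t)=1+q_1t+\cdots+q_nt^n$, with coefficients functions on $V$, such that $$\mathcal P(t)=(1+t)\,Q(t),\qquad \det(\mathrm{id}_{\mathcal D}+tA)=Q(t)^2 .$$ The coefficients $(q_1,\dots,q_n)$ of $Q$ and the first $n$ traces $(\operatorname{tr}N,\dots,\operatorname{tr}(N^n))$ determine one another. In particular, $$\operatorname{tr}N=2(C_1-1),\qquad \operatorname{tr}(N^2)=2(C_1-1)^2-4(C_2-C_1+1).$$ All higher traces $\operatorname{tr}(N^k)$, $k>n$, are functions of $q_1,\ldots,q_n$. Thus a single tensor $N$ gives at most $n$ functionally independent trace invariants $\operatorname{tr}(N^k)$, $k\ge1$.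
   Context: A contact Hamiltonian system $(M^{2n+1},\eta,H)$ is a smooth manifold $M$ of dimension $2n+1$ with a contact form $\eta$ (i.e. $\eta\wedge(d\eta)^n$ is nowhere zero) and a smooth function $H$. The Reeb vector field $R$ is defined by $\eta(R)=1$, $\iota_Rd\eta=0$. The contact Hamiltonian vector field $X_H$ is defined by the convention $\eta(X_H)=-H$, $\iota_{X_H}d\eta=dH-R(H)\eta$. A smooth map $\Phi:M\to M$ is a contact canonoid map for $(M,\eta,H)$ if there exists $b\in C^\infty(M)$ with $\mathcal L_{X_H}(\Phi^*\eta)=-b\,\Phi^*\eta$. The endomorphism $N$: on $V=\{K\ne0\}$ put $\sigma=-\alpha/K$. Then $N:TV\to TV$ is the unique smooth bundle endomorphism such that $\eta(NY)=0$ and $d\eta(NY,Z)=-H\,d\sigma(Y,Z)$ for every vector field $Y$ on $V$ and every section $Z$ of $\mathcal D$ (it exists and is unique because $d\eta|_{\mathcal D}$ is nondegenerate). In particular $N$ takes values in $\mathcal D$, so it restricts to $A:\mathcal D\to\mathcal D$. "Determine one another" and "are functions of" mean: each tuple (respectively each higher trace) is obtained pointwise from the other by a universal function depending only on $n$ (and $k$). "At most $n$ functionally independent trace invariants" means that at each point of $V$ the differentials $d\operatorname{tr}(N^k)$, $k\ge1$, span a space of dimension at most $n$. *)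

theory Defs
  imports "HOL-Analysis.Analysis" "HOL-Combinatorics.Permutations"
    "Jordan_Normal_Form.Determinant"
begin

section \<open>Smooth maps between Euclidean spaces\<close>

fun Ck_on :: "nat \<Rightarrow> 'a::real_normed_vector set \<Rightarrow> ('a \<Rightarrow> 'b::real_normed_vector) \<Rightarrow> bool" where
  "Ck_on 0 S f \<longleftrightarrow> continuous_on S f"
| "Ck_on (Suc k) S f \<longleftrightarrow>
     (\<forall>x\<in>S. f differentiable (at x)) \<and> (\<forall>v. Ck_on k S (\<lambda>x. frechet_derivative f (at x) v))"

text \<open>Only used for open \<open>S\<close>.\<close>

definition smooth_on :: "'a::real_normed_vector set \<Rightarrow> ('a \<Rightarrow> 'b::real_normed_vector) \<Rightarrow> bool" where
  "smooth_on S f \<longleftrightarrow> (\<forall>k. Ck_on k S f)"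

section \<open>Smooth manifolds\<close>

text \<open>
  The manifold is a whole type \<open>'m\<close> (Hausdorff and second countable), with an atlas of
  charts \<open>(U, \<phi>)\<close> into a Euclidean space \<open>'e\<close>.  The inverse of a chart is
  \<open>inv_into U \<phi>\<close>, which is meaningful on \<open>\<phi> ` U\<close> only.
\<close>

type_synonym ('m, 'e) chart = "'m set \<times> ('m \<Rightarrow> 'e)"

definition chart_inv :: "('m, 'e) chart \<Rightarrow> 'e \<Rightarrow> 'm" where
  "chart_inv c = inv_into (fst c) (snd c)"

definition smooth_atlas ::
  "('m::{second_countable_topology, t2_space}, 'e::euclidean_space) chart set \<Rightarrow> bool" where
  "smooth_atlas \<A> \<longleftrightarrow>
     (\<Union>c\<in>\<A>. fst c) = UNIV \<and>
     (\<forall>c\<in>\<A>. open (fst c) \<and> open (snd c ` fst c) \<and>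
        homeomorphism (fst c) (snd c ` fst c) (snd c) (chart_inv c)) \<and>
     (\<forall>c\<in>\<A>. \<forall>c'\<in>\<A>. smooth_on (snd c ` (fst c \<inter> fst c')) (snd c' \<circ> chart_inv c))"

text \<open>
  A preferred chart is chosen at every point \<open>p\<close>, and the tangent space at \<open>p\<close> is identified
  with \<open>'e\<close> by the differential of that chart.  Tensor fields are therefore functions of the point
  and of vectors in \<open>'e\<close>; the preferred chart varies with the point in an uncontrolled way,
  so smoothness and differentiation of tensor fields go through their representatives in a fixed
  chart.  \<open>coord_change c c' p\<close> converts components at \<open>p\<close> with respect to \<open>c\<close> into
  components with respect to \<open>c'\<close>.
\<close>

definition chart_at :: "('m, 'e) chart set \<Rightarrow> 'm \<Rightarrow> ('m, 'e) chart" where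
  "chart_at \<A> p = (SOME c. c \<in> \<A> \<and> p \<in> fst c)"

definition coord_change ::
  "('m, 'e::euclidean_space) chart \<Rightarrow> ('m, 'e) chart \<Rightarrow> 'm \<Rightarrow> 'e \<Rightarrow> 'e" where
  "coord_change c c' p = frechet_derivative (snd c' \<circ> chart_inv c) (at (snd c p))"

definition smooth_fun ::
  "('m, 'e::euclidean_space) chart set \<Rightarrow> ('m \<Rightarrow> real) \<Rightarrow> bool" where
  "smooth_fun \<A> f \<longleftrightarrow> (\<forall>c\<in>\<A>. smooth_on (snd c ` fst c) (f \<circ> chart_inv c))"

definition smooth_map ::
  "('m::topological_space, 'e::euclidean_space) chart set \<Rightarrow> ('m \<Rightarrow> 'm) \<Rightarrow> bool" where
  "smooth_map \<A> \<Phi> \<longleftrightarrow> continuous_on UNIV \<Phi> \<and>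
     (\<forall>c\<in>\<A>. \<forall>c'\<in>\<A>.
        smooth_on (snd c ` (fst c \<inter> \<Phi> -` fst c')) (snd c' \<circ> \<Phi> \<circ> chart_inv c))"

definition differential ::
  "('m, 'e::euclidean_space) chart set \<Rightarrow> ('m \<Rightarrow> real) \<Rightarrow> 'm \<Rightarrow> 'e \<Rightarrow> real" where
  "differential \<A> f p =
     frechet_derivative (f \<circ> chart_inv (chart_at \<A> p)) (at (snd (chart_at \<A> p) p))"

definition tangent_map ::
  "('m, 'e::euclidean_space) chart set \<Rightarrow> ('m \<Rightarrow> 'm) \<Rightarrow> 'm \<Rightarrow> 'e \<Rightarrow> 'e" where
  "tangent_map \<A> \<Phi> p =
     frechet_derivative (snd (chart_at \<A> (\<Phi> p)) \<circ> \<Phi> \<circ> chart_inv (chart_at \<A> p))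
       (at (snd (chart_at \<A> p) p))"

definition vector_rep ::
  "('m, 'e::euclidean_space) chart set \<Rightarrow> ('m, 'e) chart \<Rightarrow> ('m \<Rightarrow> 'e) \<Rightarrow> 'e \<Rightarrow> 'e" where
  "vector_rep \<A> c X x =
     (let p = chart_inv c x in coord_change (chart_at \<A> p) c p (X p))"

definition form_rep ::
  "('m, 'e::euclidean_space) chart set \<Rightarrow> ('m, 'e) chart \<Rightarrow> ('m \<Rightarrow> 'e \<Rightarrow> real) \<Rightarrow> 'e \<Rightarrow> 'e \<Rightarrow> real"
  where
  "form_rep \<A> c \<omega> x v =
     (let p = chart_inv c x in \<omega> p (coord_change c (chart_at \<A> p) p v))"

definition endo_rep ::
  "('m, 'e::euclidean_space) chart set \<Rightarrow> ('m, 'e) chart \<Rightarrow> ('m \<Rightarrow> 'e \<Rightarrow> 'e) \<Rightarrow> 'e \<Rightarrow> 'e \<Rightarrow> 'e"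
  where
  "endo_rep \<A> c N x v =
     (let p = chart_inv c x
      in coord_change (chart_at \<A> p) c p (N p (coord_change c (chart_at \<A> p) p v)))"

definition smooth_vector_field ::
  "('m, 'e::euclidean_space) chart set \<Rightarrow> ('m \<Rightarrow> 'e) \<Rightarrow> bool" where
  "smooth_vector_field \<A> X \<longleftrightarrow> (\<forall>c\<in>\<A>. smooth_on (snd c ` fst c) (vector_rep \<A> c X))"

definition smooth_one_form ::
  "('m, 'e::euclidean_space) chart set \<Rightarrow> ('m \<Rightarrow> 'e \<Rightarrow> real) \<Rightarrow> bool" where
  "smooth_one_form \<A> \<omega> \<longleftrightarrow> (\<forall>p. linear (\<omega> p)) \<and>
     (\<forall>c\<in>\<A>. \<forall>v. smooth_on (snd c ` fst c) (\<lambda>x. form_rep \<A> c \<omega> x v))"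

definition smooth_endomorphism_on ::
  "('m, 'e::euclidean_space) chart set \<Rightarrow> 'm set \<Rightarrow> ('m \<Rightarrow> 'e \<Rightarrow> 'e) \<Rightarrow> bool" where
  "smooth_endomorphism_on \<A> V N \<longleftrightarrow> (\<forall>p\<in>V. linear (N p)) \<and>
     (\<forall>c\<in>\<A>. \<forall>v. smooth_on (snd c ` (fst c \<inter> V)) (\<lambda>x. endo_rep \<A> c N x v))"

definition pullback ::
  "('m, 'e::euclidean_space) chart set \<Rightarrow> ('m \<Rightarrow> 'm) \<Rightarrow> ('m \<Rightarrow> 'e \<Rightarrow> real) \<Rightarrow> 'm \<Rightarrow> 'e \<Rightarrow> real" where
  "pullback \<A> \<Phi> \<omega> p v = \<omega> (\<Phi> p) (tangent_map \<A> \<Phi> p v)"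

text \<open>
  Normalisation: \<open>d\<omega>(Y, Z) = Y(\<omega>(Z)) - Z(\<omega>(Y)) - \<omega>([Y, Z])\<close>, evaluated on the
  constant fields of a chart, whose bracket vanishes.
\<close>

definition ext_deriv ::
  "('m, 'e::euclidean_space) chart set \<Rightarrow> ('m \<Rightarrow> 'e \<Rightarrow> real) \<Rightarrow> 'm \<Rightarrow> 'e \<Rightarrow> 'e \<Rightarrow> real" where
  "ext_deriv \<A> \<omega> p u v =
     (let c = chart_at \<A> p; x = snd c p
      in frechet_derivative (\<lambda>y. form_rep \<A> c \<omega> y v) (at x) u
       - frechet_derivative (\<lambda>y. form_rep \<A> c \<omega> y u) (at x) v)"

text \<open>
  \<open>(L\<^sub>X \<omega>)(Y) = X(\<omega>(Y)) - \<omega>([X, Y])\<close> for the constant field \<open>Y = v\<close> of a chart,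
  where \<open>[X, v] = - DX(v)\<close>.
\<close>

definition lie_derivative ::
  "('m, 'e::euclidean_space) chart set \<Rightarrow> ('m \<Rightarrow> 'e) \<Rightarrow> ('m \<Rightarrow> 'e \<Rightarrow> real) \<Rightarrow> 'm \<Rightarrow> 'e \<Rightarrow> real" where
  "lie_derivative \<A> X \<omega> p v =
     (let c = chart_at \<A> p; x = snd c p
      in frechet_derivative (\<lambda>y. form_rep \<A> c \<omega> y v) (at x) (vector_rep \<A> c X x)
       + form_rep \<A> c \<omega> x (frechet_derivative (vector_rep \<A> c X) (at x) v))"

section \<open>Exterior algebra at a point\<close>

text \<open>
  A \<open>k\<close>-form at a point takes a sequence of vectors and looks at its first \<open>k\<close> members.
  The normalisation of the wedge product is the one with
  \<open>(\<omega> \<and> \<tau>)(u, v) = \<omega>(u) \<tau>(v) - \<omega>(v) \<tau>(u)\<close> for 1-forms.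
\<close>

type_synonym 'e form = "(nat \<Rightarrow> 'e) \<Rightarrow> real"

definition form1 :: "('e \<Rightarrow> real) \<Rightarrow> 'e form" where
  "form1 \<omega> v = \<omega> (v 0)"

definition form2 :: "('e \<Rightarrow> 'e \<Rightarrow> real) \<Rightarrow> 'e form" where
  "form2 \<omega> v = \<omega> (v 0) (v 1)"

definition wedge :: "nat \<Rightarrow> nat \<Rightarrow> 'e form \<Rightarrow> 'e form \<Rightarrow> 'e form" where
  "wedge k l \<omega> \<tau> v =
     (\<Sum>\<pi> | \<pi> permutes {..<k + l}.
        of_int (sign \<pi>) * \<omega> (\<lambda>i. v (\<pi> i)) * \<tau> (\<lambda>i. v (\<pi> (k + i)))) / (fact k * fact l)"

fun wedge_power2 :: "'e form \<Rightarrow> nat \<Rightarrow> 'e form" where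
  "wedge_power2 \<omega> 0 = (\<lambda>v. 1)"
| "wedge_power2 \<omega> (Suc m) = wedge 2 (2 * m) \<omega> (wedge_power2 \<omega> m)"

text \<open>\<open>wedge_top n \<eta> \<omega>\<close> is \<open>\<eta> \<and> \<omega>\<^sup>n\<close> for a 1-form \<open>\<eta>\<close> and a 2-form \<open>\<omega>\<close>.\<close>

definition wedge_top :: "nat \<Rightarrow> ('e \<Rightarrow> real) \<Rightarrow> ('e \<Rightarrow> 'e \<Rightarrow> real) \<Rightarrow> 'e form" where
  "wedge_top n \<eta> \<omega> = wedge 1 (2 * n) (form1 \<eta>) (wedge_power2 (form2 \<omega>) n)"

section \<open>Determinant and trace of an endomorphism of a subspace\<close>

text \<open>
  \<open>f\<close> is meant to be linear on the subspace \<open>S\<close> and to map \<open>S\<close> into itself; determinant and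
  trace then do not depend on the chosen basis.
\<close>

definition basis_list :: "'e::euclidean_space set \<Rightarrow> 'e list" where
  "basis_list S = (SOME bs. distinct bs \<and> independent (set bs) \<and> span (set bs) = S)"

definition matrix_on :: "'e::euclidean_space set \<Rightarrow> ('e \<Rightarrow> 'e) \<Rightarrow> real mat" where
  "matrix_on S f =
     (let bs = basis_list S
      in mat (length bs) (length bs) (\<lambda>(i, j). representation (set bs) (f (bs ! j)) (bs ! i)))"

definition det_on :: "'e::euclidean_space set \<Rightarrow> ('e \<Rightarrow> 'e) \<Rightarrow> real" where
  "det_on S f = Determinant.det (matrix_on S f)"

definition trace_on :: "'e::euclidean_space set \<Rightarrow> ('e \<Rightarrow> 'e) \<Rightarrow> real" where
  "trace_on S f = (\<Sum>i<dim_row (matrix_on S f). matrix_on S f $$ (i, i))"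

section \<open>Contact Hamiltonian systems\<close>

definition contact_form ::
  "('m, 'e::euclidean_space) chart set \<Rightarrow> nat \<Rightarrow> ('m \<Rightarrow> 'e \<Rightarrow> real) \<Rightarrow> bool" where
  "contact_form \<A> n \<eta> \<longleftrightarrow> smooth_one_form \<A> \<eta> \<and>
     (\<forall>p. \<exists>v. wedge_top n (\<eta> p) (ext_deriv \<A> \<eta> p) v \<noteq> 0)"

definition contact_hamiltonian_system ::
  "('m::{second_countable_topology, t2_space}, 'e::euclidean_space) chart set \<Rightarrow>
   nat \<Rightarrow> ('m \<Rightarrow> 'e \<Rightarrow> real) \<Rightarrow> ('m \<Rightarrow> real) \<Rightarrow> bool" where
  "contact_hamiltonian_system \<A> n \<eta> H \<longleftrightarrow>
     smooth_atlas \<A> \<and> DIM('e) = 2 * n + 1 \<and> contact_form \<A> n \<eta> \<and> smooth_fun \<A> H"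

definition reeb_field ::
  "('m, 'e::euclidean_space) chart set \<Rightarrow> ('m \<Rightarrow> 'e \<Rightarrow> real) \<Rightarrow> ('m \<Rightarrow> 'e) \<Rightarrow> bool" where
  "reeb_field \<A> \<eta> R \<longleftrightarrow> smooth_vector_field \<A> R \<and>
     (\<forall>p. \<eta> p (R p) = 1 \<and> (\<forall>w. ext_deriv \<A> \<eta> p (R p) w = 0))"

definition contact_hamiltonian_field ::
  "('m, 'e::euclidean_space) chart set \<Rightarrow> ('m \<Rightarrow> 'e \<Rightarrow> real) \<Rightarrow> ('m \<Rightarrow> real) \<Rightarrow> ('m \<Rightarrow> 'e) \<Rightarrow>
   ('m \<Rightarrow> 'e) \<Rightarrow> bool" where
  "contact_hamiltonian_field \<A> \<eta> H R X \<longleftrightarrow> smooth_vector_field \<A> X \<and>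
     (\<forall>p. \<eta> p (X p) = - H p \<and>
        (\<forall>w. ext_deriv \<A> \<eta> p (X p) w = differential \<A> H p w - differential \<A> H p (R p) * \<eta> p w))"

definition contact_canonoid ::
  "('m::topological_space, 'e::euclidean_space) chart set \<Rightarrow> ('m \<Rightarrow> 'e \<Rightarrow> real) \<Rightarrow> ('m \<Rightarrow> 'e) \<Rightarrow>
   ('m \<Rightarrow> 'm) \<Rightarrow> bool" where
  "contact_canonoid \<A> \<eta> X \<Phi> \<longleftrightarrow> smooth_map \<A> \<Phi> \<and>
     (\<exists>b. smooth_fun \<A> b \<and>
        (\<forall>p v. lie_derivative \<A> X (pullback \<A> \<Phi> \<eta>) p v = - b p * pullback \<A> \<Phi> \<eta> p v))"

text \<open>
  The identities for vector fields \<open>Y\<close> and sections \<open>Z\<close> of \<open>ker \<eta>\<close> are tensorial,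
  hence stated for vectors at each point of \<open>V\<close>.
\<close>

definition invariant_endomorphism ::
  "('m, 'e::euclidean_space) chart set \<Rightarrow> 'm set \<Rightarrow> ('m \<Rightarrow> 'e \<Rightarrow> real) \<Rightarrow> ('m \<Rightarrow> real) \<Rightarrow>
   ('m \<Rightarrow> 'e \<Rightarrow> real) \<Rightarrow> ('m \<Rightarrow> 'e \<Rightarrow> 'e) \<Rightarrow> bool" where
  "invariant_endomorphism \<A> V \<eta> H \<sigma> N \<longleftrightarrow> smooth_endomorphism_on \<A> V N \<and>
     (\<forall>p\<in>V. \<forall>y. \<eta> p (N p y) = 0 \<and>
        (\<forall>z. \<eta> p z = 0 \<longrightarrow> ext_deriv \<A> \<eta> p (N p y) z = - H p * ext_deriv \<A> \<sigma> p y z))"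

section \<open>The universal functions\<close>

text \<open>
  Newton's identities \<open>k e\<^sub>k = \<Sum>\<^sub>i (-1)\<^sup>i\<^sup>-\<^sup>1 e\<^sub>k\<^sub>-\<^sub>i p\<^sub>i\<close> (\<open>1 \<le> i \<le> k\<close>), with \<open>e\<^sub>j\<close> the coefficients
  of the polynomial and \<open>p\<^sub>i\<close> half the \<open>i\<close>-th trace: the determinant is the square of the
  polynomial.  A list holds the entries with indices \<open>1, \<dots>, n\<close>; \<open>e\<^sub>0 = 1\<close> and \<open>e\<^sub>j = 0\<close> for
  \<open>j > n\<close>.  Neither function mentions the manifold.
\<close>

definition coeff_of_list :: "real list \<Rightarrow> nat \<Rightarrow> real" where
  "coeff_of_list qs j = (if j = 0 then 1 else if j \<le> length qs then qs ! (j - 1) else 0)"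

fun trace_from_coeffs :: "real list \<Rightarrow> nat \<Rightarrow> real" where
  "trace_from_coeffs qs k =
     (-1) ^ (k + 1) * (2 * real k * coeff_of_list qs k
       - (\<Sum>i = 1..<k. (-1) ^ (i + 1) * coeff_of_list qs (k - i) * trace_from_coeffs qs i))"

fun coeff_from_traces :: "real list \<Rightarrow> nat \<Rightarrow> real" where
  "coeff_from_traces ts k =
     (if k = 0 then 1
      else (\<Sum>i = 1..k. (-1) ^ (i + 1) * coeff_from_traces ts (k - i) * ts ! (i - 1)) / (2 * real k))"

declare trace_from_coeffs.simps [simp del] coeff_from_traces.simps [simp del]

end

theory Submission
  imports Defs "Jordan_Normal_Form.Schur_Decomposition"
begin

unbundle no vec_syntax
hide_const (open) VectorSpace.subspace

text \<open>
  Put \<open>\<sigma> = - \<alpha> / K\<close>, so that \<open>\<sigma>(X) = 1\<close>, \<open>\<beta> = - H \<sigma>\<close> and, since \<open>\<Phi>\<close> is canonoid, \<open>\<iota>\<^sub>X d\<sigma> = 0\<close>.  At a point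
  of \<open>V\<close> and for \<open>t \<noteq> - 1\<close> the map \<open>u \<mapsto> u - t / (1 + t) \<sigma>(u) X\<close>, of determinant \<open>1 / (1 + t)\<close>, pulls
  \<open>\<eta> + t \<beta>\<close> back to \<open>\<eta>\<close> and \<open>d\<eta> + t d\<beta>\<close> to \<open>d\<eta> - t H d\<sigma>\<close> modulo \<open>\<eta>\<close>; this needs no case
  distinction on \<open>H = 0\<close>.  Hence \<open>\<P>(t)\<close> is \<open>1 + t\<close> times the quotient of the Pfaffians of
  \<open>d\<eta> - t H d\<sigma> = d\<eta>((id + t A)\<cdot>, \<cdot>)\<close> and \<open>d\<eta>\<close> on \<open>\<D>\<close>, and \<open>\<P>(t)\<^sup>2 = (1 + t)\<^sup>2 det(id + t A)\<close>.
  As both sides are polynomials, \<open>\<P>(- 1) = 0\<close>, and \<open>Q = \<P> / (1 + t)\<close> has square \<open>det(id + t A)\<close>.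
  The logarithmic derivative of \<open>Q\<^sup>2\<close> gives Newton's identities between the coefficients of \<open>Q\<close>
  and the half traces of \<open>N\<close>.
\<close>

section \<open>Alternating forms\<close>

text \<open>The number s = t / (1 + t) is forced. Since \<eta>(X) = - H and \<sigma>(X) = 1, one has
  (\<eta> + t \<beta>)(u - s \<sigma>(u) X) = \<eta>(u) + H \<sigma>(u) (s (1 + t) - t), and only
  this s removes the last term when H is nonzero. It stays harmless where H = 0, where X itself lies
  in the contact hyperplane. Pfaffians are never introduced. The square of a top power is compared
  with a Gram determinant, both being normalised by a symplectic basis. The sign lost by squaring
  causes no ambiguity: Q is the quotient of \<P> by 1 + t, not a chosen root of the determinant. At
  a point everything is linear algebra. Analysis enters through the exterior derivatives, the
  invariance of \<sigma> along X, and the differentiability of the traces. Because the preferred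
  chart may jump from point to point, these facts are proved for representatives in one fixed chart
  and read at the point where that chart is the preferred one.\<close>

definition alternating_form :: "nat \<Rightarrow> ('e::real_vector) form \<Rightarrow> bool" where
  "alternating_form m f \<longleftrightarrow>
     (\<forall>v w. (\<forall>i<m. v i = w i) \<longrightarrow> f v = f w) \<and>
     (\<forall>v. \<forall>i<m. linear (\<lambda>x. f (v(i := x)))) \<and>
     (\<forall>v \<pi>. \<pi> permutes {..<m} \<longrightarrow> f (v \<circ> \<pi>) = of_int (sign \<pi>) * f v)"

lemma alternating_form_cong:
  "alternating_form m f \<Longrightarrow> (\<And>i. i < m \<Longrightarrow> v i = w i) \<Longrightarrow> f v = f w"
  by (auto simp: alternating_form_def)

lemma alternating_form_linear:
  "alternating_form m f \<Longrightarrow> i < m \<Longrightarrow> linear (\<lambda>x. f (v(i := x)))"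
  by (auto simp: alternating_form_def)

lemma alternating_form_permute:
  "alternating_form m f \<Longrightarrow> \<pi> permutes {..<m} \<Longrightarrow> f (\<lambda>i. v (\<pi> i)) = of_int (sign \<pi>) * f v"
  by (auto simp: alternating_form_def o_def)

lemma alternating_form_repeat:
  assumes f: "alternating_form m f" and ij: "i < m" "j < m" "i \<noteq> j" and v: "v i = v j"
  shows "f v = 0"
proof -
  have p: "Transposition.transpose i j permutes {..<m}"
    using ij by (intro permutes_swap_id) auto
  have "(\<lambda>k. v (Transposition.transpose i j k)) = v"
    using v by (auto simp: Transposition.transpose_def)
  then have "f v = - f v"
    using alternating_form_permute[OF f p, of v] ij by (simp add: sign_swap_id)
  then show ?thesis by simp
qed

text \<open>Antisymmetry comes from the sum over all permutations: composing with \<rho> only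
  reindexes it. Linearity in a slot holds term by term, as each permutation hands a given vector to
  exactly one factor.\<close>

lemma wedge_alternating:
  fixes \<omega> \<tau> :: "('e::real_vector) form"
  assumes cong1: "\<And>v w. (\<And>i. i < k \<Longrightarrow> v i = w i) \<Longrightarrow> \<omega> v = \<omega> w"
    and lin1: "\<And>v i. i < k \<Longrightarrow> linear (\<lambda>x. \<omega> (v(i := x)))"
    and cong2: "\<And>v w. (\<And>i. i < l \<Longrightarrow> v i = w i) \<Longrightarrow> \<tau> v = \<tau> w"
    and lin2: "\<And>v i. i < l \<Longrightarrow> linear (\<lambda>x. \<tau> (v(i := x)))"
  shows "alternating_form (k + l) (wedge k l \<omega> \<tau>)"
  unfolding alternating_form_def
proof (intro conjI allI impI)
  fix v w :: "nat \<Rightarrow> 'e"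
  assume vw: "\<forall>i<k + l. v i = w i"
  have "\<omega> (\<lambda>i. v (\<pi> i)) = \<omega> (\<lambda>i. w (\<pi> i)) \<and> \<tau> (\<lambda>i. v (\<pi> (k + i))) = \<tau> (\<lambda>i. w (\<pi> (k + i)))"
    if "\<pi> permutes {..<k + l}" for \<pi>
  proof -
    have "\<pi> i < k + l" if "i < k + l" for i
      using permutes_in_image[OF \<open>\<pi> permutes {..<k + l}\<close>, of i] that by auto
    then show ?thesis
      using vw by (intro conjI cong1 cong2) auto
  qed
  then show "wedge k l \<omega> \<tau> v = wedge k l \<omega> \<tau> w"
    unfolding wedge_def by (intro arg_cong2[where f = "(/)"] sum.cong refl) auto
next
  fix v :: "nat \<Rightarrow> 'e" and j
  assume j: "j < k + l"
  have "linear (\<lambda>x. \<omega> (\<lambda>i. (v(j := x)) (\<pi> i)) * \<tau> (\<lambda>i. (v(j := x)) (\<pi> (k + i))))"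
    if p: "\<pi> permutes {..<k + l}" for \<pi>
  proof -
    \<comment> \<open>The position at which \<open>v j\<close> is consumed: by the first factor if
      \<open>a < k\<close>, otherwise by the second one at its slot \<open>a - k\<close>.\<close>
    define a where "a = inv_into UNIV \<pi> j"
    have pa: "\<pi> i = j \<longleftrightarrow> i = a" for i
      using p unfolding a_def by (metis permutes_inverses(1) permutes_inv_eq)
    have a: "a < k + l"
      using permutes_in_image[OF permutes_inv[OF p], of j] j by (auto simp: a_def)
    show ?thesis
    proof (cases "a < k")
      case True
      have 1: "(\<lambda>i. (v(j := x)) (\<pi> i)) = (\<lambda>i. v (\<pi> i))(a := x)" for x
        using pa by (auto simp: fun_eq_iff)
      have 2: "(\<lambda>i. (v(j := x)) (\<pi> (k + i))) = (\<lambda>i. v (\<pi> (k + i)))" for x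
        using pa True by (auto simp: fun_eq_iff)
      have "linear (\<lambda>x. \<omega> ((\<lambda>i. v (\<pi> i))(a := x)))"
        by (rule lin1) fact
      then show ?thesis
        unfolding 1 2 by (auto simp: linear_iff algebra_simps)
    next
      case False
      then obtain c where c: "a = k + c" "c < l"
        using a by (metis add_less_cancel_left le_Suc_ex not_le)
      have 1: "\<omega> (\<lambda>i. (v(j := x)) (\<pi> i)) = \<omega> (\<lambda>i. v (\<pi> i))" for x
        using pa False by (intro cong1) auto
      have 2: "(\<lambda>i. (v(j := x)) (\<pi> (k + i))) = (\<lambda>i. v (\<pi> (k + i)))(c := x)" for x
        using pa c by (auto simp: fun_eq_iff)
      have "linear (\<lambda>x. \<tau> ((\<lambda>i. v (\<pi> (k + i)))(c := x)))"
        by (rule lin2) fact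
      then show ?thesis
        unfolding 1 2 by (auto simp: linear_iff algebra_simps)
    qed
  qed
  then have "linear (\<lambda>x. \<Sum>\<pi> | \<pi> permutes {..<k + l}. of_int (sign \<pi>) *
      (\<omega> (\<lambda>i. (v(j := x)) (\<pi> i)) * \<tau> (\<lambda>i. (v(j := x)) (\<pi> (k + i)))))"
    by (intro linear_compose_sum ballI) (auto simp: linear_iff algebra_simps)
  then show "linear (\<lambda>x. wedge k l \<omega> \<tau> (v(j := x)))"
    unfolding wedge_def mult.assoc
    by (auto simp: linear_iff add_divide_distrib)
next
  fix v :: "nat \<Rightarrow> 'e" and \<rho>
  assume r: "\<rho> permutes {..<k + l}"
  let ?t = "\<lambda>v \<pi>. of_int (sign \<pi>) * \<omega> (\<lambda>i. v (\<pi> i)) * \<tau> (\<lambda>i. v (\<pi> (k + i)))"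
  let ?P = "{\<pi>. \<pi> permutes {..<k + l}}"
  have "(\<Sum>\<pi>\<in>?P. ?t v \<pi>) = (\<Sum>\<pi>\<in>?P. ?t v (\<rho> \<circ> \<pi>))"
    by (rule setum_permutations_compose_left[OF r])
  also have "\<dots> = (\<Sum>\<pi>\<in>?P. of_int (sign \<rho>) * ?t (v \<circ> \<rho>) \<pi>)"
  proof (intro sum.cong refl)
    fix \<pi> assume "\<pi> \<in> ?P"
    then have "sign (\<rho> \<circ> \<pi>) = sign \<rho> * sign \<pi>"
      using r by (intro sign_compose) (auto intro: permutation_permutes[THEN iffD2])
    then show "?t v (\<rho> \<circ> \<pi>) = of_int (sign \<rho>) * ?t (v \<circ> \<rho>) \<pi>"
      by simp
  qed
  also have "\<dots> = of_int (sign \<rho>) * (\<Sum>\<pi>\<in>?P. ?t (v \<circ> \<rho>) \<pi>)"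
    by (rule sum_distrib_left[symmetric])
  finally have "(\<Sum>\<pi>\<in>?P. ?t v \<pi>) = of_int (sign \<rho>) * (\<Sum>\<pi>\<in>?P. ?t (v \<circ> \<rho>) \<pi>)" .
  moreover have "real_of_int (sign \<rho>) * real_of_int (sign \<rho>) = 1"
    by (simp flip: of_int_mult add: sign_idempotent)
  ultimately have "of_int (sign \<rho>) * (\<Sum>\<pi>\<in>?P. ?t v \<pi>) = (\<Sum>\<pi>\<in>?P. ?t (v \<circ> \<rho>) \<pi>)"
    by (simp only: mult.assoc[symmetric] mult_1_left)
  then show "wedge k l \<omega> \<tau> (v \<circ> \<rho>) = of_int (sign \<rho>) * wedge k l \<omega> \<tau> v"
    unfolding wedge_def by simp
qed

text \<open>Only the injective index maps survive in the multilinear expansion of the left side.\<close>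

lemma alternating_form_det:
  fixes f :: "('e::real_vector) form" and b :: "nat \<Rightarrow> 'e"
  assumes f: "alternating_form m f"
  shows "f (\<lambda>i. \<Sum>j<m. M i j *\<^sub>R b j) = Determinant.det (mat m m (\<lambda>(i, j). M i j)) * f b"
proof -
  let ?G = "\<lambda>s. PiE {..<s} (\<lambda>_. {..<m})"
  \<comment> \<open>Only the first \<open>s\<close> slots are expanded, an element of
    \<open>?G s\<close> choosing one basis index for each. The tail \<open>w\<close> is kept
    arbitrary because the induction step first stores the vector of slot \<open>s\<close> in
    it.\<close>
  have expand: "f (\<lambda>i. if i < s then \<Sum>j<m. M i j *\<^sub>R b j else w i)
      = (\<Sum>g\<in>?G s. (\<Prod>i<s. M i (g i)) * f (\<lambda>i. if i < s then b (g i) else w i))"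
    if "s \<le> m" for s w
    using that
  proof (induction s arbitrary: w)
    case 0
    then show ?case by simp
  next
    case (Suc s)
    let ?u = "\<lambda>i. \<Sum>j<m. M i j *\<^sub>R b j"
    have "f (\<lambda>i. if i < Suc s then ?u i else w i)
        = f (\<lambda>i. if i < s then ?u i else (w(s := ?u s)) i)"
      by (rule arg_cong[where f = f]) (auto simp: fun_eq_iff less_Suc_eq)
    also have "\<dots> = (\<Sum>g\<in>?G s. (\<Prod>i<s. M i (g i)) *
        f (\<lambda>i. if i < s then b (g i) else (w(s := ?u s)) i))"
      using Suc by simp
    also have "\<dots> = (\<Sum>g\<in>?G s. (\<Prod>i<s. M i (g i)) *
        (\<Sum>j<m. M s j * f (\<lambda>i. if i < s then b (g i) else (w(s := b j)) i)))"
    proof (intro sum.cong refl arg_cong2[where f = "(*)"])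
      fix g
      have eq: "(\<lambda>i. if i < s then b (g i) else (w(s := x)) i)
          = (\<lambda>i. if i < s then b (g i) else w i)(s := x)" for x
        by (auto simp: fun_eq_iff)
      have l: "linear (\<lambda>x. f ((\<lambda>i. if i < s then b (g i) else w i)(s := x)))"
        using Suc by (intro alternating_form_linear[OF f]) auto
      show "f (\<lambda>i. if i < s then b (g i) else (w(s := ?u s)) i)
          = (\<Sum>j<m. M s j * f (\<lambda>i. if i < s then b (g i) else (w(s := b j)) i))"
        unfolding eq by (simp add: linear_sum[OF l] linear_cmul[OF l])
    qed
    also have "\<dots> = (\<Sum>(g, j)\<in>?G s \<times> {..<m}. (\<Prod>i<s. M i (g i)) * M s j *
        f (\<lambda>i. if i < s then b (g i) else (w(s := b j)) i))"
      by (simp add: sum_distrib_left sum.cartesian_product mult.assoc)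
    also have "\<dots> = (\<Sum>g\<in>?G (Suc s). (\<Prod>i<Suc s. M i (g i)) *
        f (\<lambda>i. if i < Suc s then b (g i) else w i))"
    proof (rule sum.reindex_bij_witness[where
          i = "\<lambda>g. (restrict g {..<s}, g s)" and j = "\<lambda>(g, j). g(s := j)"], goal_cases)
      case (1 gj)
      then show ?case
        by (auto simp: restrict_def PiE_def extensional_def fun_eq_iff split: prod.splits)
    next
      case (2 gj)
      then show ?case
        by (auto simp: PiE_def extensional_def Pi_def less_Suc_eq split: prod.splits)
    next
      case (3 g)
      then show ?case
        by (auto simp: PiE_def extensional_def fun_eq_iff less_Suc_eq)
    next
      case (4 g)
      then show ?case
        by (auto simp: PiE_def Pi_def)
    next
      case (5 gj)
      have "f (\<lambda>i. if i < Suc s then b ((g(s := j)) i) else w i)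
          = f (\<lambda>i. if i < s then b (g i) else (w(s := b j)) i)" for g j
        by (rule arg_cong[where f = f]) (auto simp: fun_eq_iff less_Suc_eq)
      then show ?case
        by (auto split: prod.splits)
    qed
    finally show ?case .
  qed
  have "f (\<lambda>i. \<Sum>j<m. M i j *\<^sub>R b j) = f (\<lambda>i. if i < m then \<Sum>j<m. M i j *\<^sub>R b j else b i)"
    by (rule alternating_form_cong[OF f]) simp
  also have "\<dots> = (\<Sum>g\<in>?G m. (\<Prod>i<m. M i (g i)) * f (\<lambda>i. if i < m then b (g i) else b i))"
    by (rule expand) simp
  also have "\<dots> = (\<Sum>\<pi> | \<pi> permutes {..<m}. (\<Prod>i<m. M i (\<pi> i)) * f (\<lambda>i. b (\<pi> i)))"
  proof -
    let ?h = "\<lambda>g. (\<Prod>i<m. M i (g i)) * f (\<lambda>i. if i < m then b (g i) else b i)"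
    let ?I = "{g \<in> ?G m. inj_on g {..<m}}"
    have fin: "finite (?G m)"
      by (intro finite_PiE) auto
    have "(\<Sum>g\<in>?G m. ?h g) = (\<Sum>g\<in>?I. ?h g)"
    proof (rule sum.mono_neutral_right[OF fin])
      show "\<forall>g\<in>?G m - ?I. ?h g = 0"
      proof
        fix g assume "g \<in> ?G m - ?I"
        then obtain i j where "i < m" "j < m" "i \<noteq> j" "g i = g j"
          by (auto simp: inj_on_def)
        then have "f (\<lambda>i. if i < m then b (g i) else b i) = 0"
          by (intro alternating_form_repeat[OF f, of i j]) auto
        then show "?h g = 0" by simp
      qed
    qed auto
    also have "\<dots> = (\<Sum>\<pi> | \<pi> permutes {..<m}. (\<Prod>i<m. M i (\<pi> i)) * f (\<lambda>i. b (\<pi> i)))"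
    proof (rule sum.reindex_bij_witness[where
          i = "\<lambda>\<pi>. restrict \<pi> {..<m}" and j = "\<lambda>g i. if i < m then g i else i"], goal_cases)
      case (1 g)
      then show ?case
        by (auto simp: restrict_def PiE_def extensional_def fun_eq_iff)
    next
      case (2 g)
      have "g ` {..<m} = {..<m}"
        using 2 by (intro endo_inj_surj) (auto simp: PiE_def Pi_def)
      then have "bij_betw g {..<m} {..<m}"
        using 2 by (simp add: bij_betw_def)
      then have "bij_betw (\<lambda>i. if i < m then g i else i) {..<m} {..<m}"
        by (rule bij_betw_cong[THEN iffD1, rotated]) auto
      then have "(\<lambda>i. if i < m then g i else i) permutes {..<m}"
        by (rule bij_imp_permutes) auto
      then show ?case by simp
    next
      case (3 \<pi>)
      then show ?case
        by (auto simp: restrict_def fun_eq_iff permutes_def)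
    next
      case (4 \<pi>)
      have "\<pi> i < m" if "i < m" for i
        using permutes_in_image[of \<pi> "{..<m}" i] 4 that by auto
      moreover have "inj_on \<pi> {..<m}"
        using 4 by (auto intro: permutes_inj_on)
      ultimately show ?case
        by (auto simp: inj_on_def)
    next
      case (5 g)
      show ?case
        by (intro arg_cong2[where f = "(*)"] prod.cong refl alternating_form_cong[OF f]) auto
    qed
    finally show ?thesis .
  qed
  also have "\<dots> = (\<Sum>\<pi> | \<pi> permutes {..<m}. of_int (sign \<pi>) * (\<Prod>i<m. M i (\<pi> i))) * f b"
    by (simp add: alternating_form_permute[OF f] sum_distrib_left mult_ac)
  also have "(\<Sum>\<pi> | \<pi> permutes {..<m}. of_int (sign \<pi>) * (\<Prod>i<m. M i (\<pi> i)))
      = Determinant.det (mat m m (\<lambda>(i, j). M i j))"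
  proof (subst det_def'[where n = m], simp, rule sum.cong)
    show "{\<pi>. \<pi> permutes {..<m}} = {p. p permutes {0..<m}}"
      by (simp add: atLeast0LessThan)
    fix \<pi> assume "\<pi> \<in> {p. p permutes {0..<m}}"
    then have "\<pi> i < m" if "i < m" for i
      using permutes_in_image[of \<pi> "{0..<m}" i] that by auto
    then show "of_int (sign \<pi>) * (\<Prod>i<m. M i (\<pi> i))
        = signof \<pi> * (\<Prod>i = 0..<m. mat m m (\<lambda>(i, j). M i j) $$ (i, \<pi> i))"
      by (auto simp: atLeast0LessThan intro!: prod.cong)
  qed
  finally show ?thesis .
qed

lemma permutes_lessThan: "\<pi> permutes {..<m} \<Longrightarrow> i < m \<Longrightarrow> \<pi> i < (m :: nat)"
  using permutes_in_image[of \<pi> "{..<m}" i] by auto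

section \<open>Powers of a 2-form and the top form\<close>

lemma wedge_power2_alternating:
  fixes \<omega> :: "'e::real_vector \<Rightarrow> 'e \<Rightarrow> real"
  assumes "\<And>u. linear (\<omega> u)" "\<And>w. linear (\<lambda>u. \<omega> u w)"
  shows "alternating_form (2 * n) (wedge_power2 (form2 \<omega>) n)"
proof (induction n)
  case 0
  then show ?case by (simp add: alternating_form_def)
next
  case (Suc n)
  have "alternating_form (2 + 2 * n) (wedge 2 (2 * n) (form2 \<omega>) (wedge_power2 (form2 \<omega>) n))"
  proof (rule wedge_alternating)
    show "form2 \<omega> v = form2 \<omega> w" if "\<And>i. i < 2 \<Longrightarrow> v i = w i" for v w
      using that by (simp add: form2_def)
    show "linear (\<lambda>x. form2 \<omega> (v(i := x)))" if "i < 2" for v i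
      using that assms by (auto simp: form2_def numeral_2_eq_2 less_Suc_eq)
  qed (use alternating_form_cong[OF Suc] alternating_form_linear[OF Suc] in blast)+
  then show ?case by simp
qed

lemma wedge_top_alternating:
  fixes \<eta> :: "'e::real_vector \<Rightarrow> real"
  assumes "linear \<eta>" "\<And>u. linear (\<omega> u)" "\<And>w. linear (\<lambda>u. \<omega> u w)"
  shows "alternating_form (2 * n + 1) (wedge_top n \<eta> \<omega>)"
proof -
  note alt = wedge_power2_alternating[OF assms(2,3), of n]
  have "alternating_form (1 + 2 * n) (wedge_top n \<eta> \<omega>)"
    unfolding wedge_top_def
  proof (rule wedge_alternating)
    show "form1 \<eta> v = form1 \<eta> w" if "\<And>i. i < 1 \<Longrightarrow> v i = w i" for v w
      using that by (simp add: form1_def)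
    show "linear (\<lambda>x. form1 \<eta> (v(i := x)))" if "i < 1" for v i
      using that assms(1) by (simp add: form1_def)
  qed (use alternating_form_cong[OF alt] alternating_form_linear[OF alt] in blast)+
  then show ?thesis by simp
qed

text \<open>The power is built from the pairings of the vectors alone, so forms on two different
  types can be compared. This serves for the pull-back of the pencil, and for replacing a symplectic
  basis by its indices with \<open>symplectic_unit\<close> as form.\<close>

lemma wedge_power2_cong:
  assumes "\<And>i j. i < 2 * n \<Longrightarrow> j < 2 * n \<Longrightarrow> \<omega> (v i) (v j) = \<omega>' (v' i) (v' j)"
  shows "wedge_power2 (form2 \<omega>) n v = wedge_power2 (form2 \<omega>') n v'"
  using assms
proof (induction n arbitrary: v v')
  case (Suc n)
  have "form2 \<omega> (\<lambda>i. v (\<pi> i)) = form2 \<omega>' (\<lambda>i. v' (\<pi> i)) \<and>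
      wedge_power2 (form2 \<omega>) n (\<lambda>i. v (\<pi> (2 + i))) = wedge_power2 (form2 \<omega>') n (\<lambda>i. v' (\<pi> (2 + i)))"
    if "\<pi> permutes {..<2 + 2 * n}" for \<pi>
  proof
    show "form2 \<omega> (\<lambda>i. v (\<pi> i)) = form2 \<omega>' (\<lambda>i. v' (\<pi> i))"
      using permutes_lessThan[OF that] Suc.prems by (simp add: form2_def)
    show "wedge_power2 (form2 \<omega>) n (\<lambda>i. v (\<pi> (2 + i))) = wedge_power2 (form2 \<omega>') n (\<lambda>i. v' (\<pi> (2 + i)))"
      by (rule Suc.IH) (use permutes_lessThan[OF that] Suc.prems in simp)
  qed
  then show ?case
    unfolding wedge_power2.simps wedge_def
    by (intro arg_cong2[where f = "(/)"] sum.cong refl) auto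
qed simp

text \<open>In each term of the wedge product the vector \<open>v k\<close> goes either to the
  2-form factor, which is then 0, or to the lower power, which is 0 by induction.\<close>

lemma wedge_power2_null:
  assumes "k < 2 * n" "\<And>j. j < 2 * n \<Longrightarrow> \<omega> (v k) (v j) = 0 \<and> \<omega> (v j) (v k) = 0"
  shows "wedge_power2 (form2 \<omega>) n v = 0"
  using assms
proof (induction n arbitrary: v k)
  case (Suc n)
  have "form2 \<omega> (\<lambda>i. v (\<pi> i)) * wedge_power2 (form2 \<omega>) n (\<lambda>i. v (\<pi> (2 + i))) = 0"
    if p: "\<pi> permutes {..<2 + 2 * n}" for \<pi>
  proof -
    define a where "a = inv_into UNIV \<pi> k"
    have a: "a < 2 + 2 * n" "\<pi> a = k"
      using permutes_lessThan[OF permutes_inv[OF p], of k] permutes_inverses(1)[OF p, of k] Suc.prems(1)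
      by (simp_all add: a_def)
    consider "a = 0" | "a = 1" | "a \<ge> 2" by linarith
    then show ?thesis
    proof cases
      case 3
      then obtain c where c: "a = 2 + c" by (metis le_Suc_ex)
      have "wedge_power2 (form2 \<omega>) n (\<lambda>i. v (\<pi> (2 + i))) = 0"
        by (rule Suc.IH[of c]) (use a c permutes_lessThan[OF p] Suc.prems in auto)
      then show ?thesis by simp
    qed (use a permutes_lessThan[OF p] Suc.prems in \<open>auto simp: form2_def\<close>)
  qed
  then have "(\<Sum>\<pi> | \<pi> permutes {..<2 + 2 * n}. of_int (sign \<pi>) * (form2 \<omega> (\<lambda>i. v (\<pi> i)) *
      wedge_power2 (form2 \<omega>) n (\<lambda>i. v (\<pi> (2 + i))))) = 0"
    by (intro sum.neutral) auto
  then show ?case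
    unfolding wedge_power2.simps wedge_def mult.assoc by simp
qed simp

text \<open>The stabiliser of 0 is the symmetric group of the other indices, shifted by one. This
  splits off the slot of the 1-form in \<open>wedge_top\<close>.\<close>

lemma permutes_fixing_zero:
  assumes p: "\<pi> permutes {..<Suc m}" and zero: "\<pi> 0 = 0"
  shows "(\<lambda>i. \<pi> (Suc i) - 1) permutes {..<m}"
    and "map_permutation {..<m} Suc (\<lambda>i. \<pi> (Suc i) - 1) = \<pi>"
proof -
  have inj: "\<pi> a = \<pi> b \<Longrightarrow> a = b" for a b
    using permutes_inj[OF p] by (auto dest: injD)
  have pos: "\<pi> (Suc i) > 0" for i
    using inj[of "Suc i" 0] zero by auto
  have outside: "\<pi> x = x" if "x \<ge> Suc m" for x
    using p that by (auto simp: permutes_def)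
  show "(\<lambda>i. \<pi> (Suc i) - 1) permutes {..<m}"
  proof (rule bij_imp_permutes)
    have "inj_on (\<lambda>i. \<pi> (Suc i) - 1) {..<m}"
    proof (rule inj_onI)
      fix i j assume "\<pi> (Suc i) - 1 = \<pi> (Suc j) - 1"
      then have "\<pi> (Suc i) = \<pi> (Suc j)"
        using pos[of i] pos[of j] by linarith
      then show "i = j"
        using inj by auto
    qed
    moreover have "(\<lambda>i. \<pi> (Suc i) - 1) ` {..<m} \<subseteq> {..<m}"
    proof clarify
      fix i assume "i < m"
      then have "\<pi> (Suc i) < Suc m"
        by (intro permutes_lessThan[OF p]) simp
      then show "\<pi> (Suc i) - 1 < m"
        using pos[of i] by linarith
    qed
    ultimately show "bij_betw (\<lambda>i. \<pi> (Suc i) - 1) {..<m} {..<m}"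
      by (simp add: bij_betw_def endo_inj_surj)
  qed (simp add: outside)
  show "map_permutation {..<m} Suc (\<lambda>i. \<pi> (Suc i) - 1) = \<pi>"
  proof
    fix x
    consider "x = 0" | i where "x = Suc i" "i < m" | "x \<ge> Suc m"
      by (metis not_less old.nat.exhaust Suc_le_mono)
    then show "map_permutation {..<m} Suc (\<lambda>i. \<pi> (Suc i) - 1) x = \<pi> x"
    proof cases
      case 2
      then show ?thesis
        using pos by (simp add: map_permutation_def restrict_id_def inv_into_f_f)
    qed (auto simp: map_permutation_def restrict_id_def zero outside)
  qed
qed

text \<open>Terms in which \<eta> receives a vector other than \<open>v 0\<close> vanish. The others
  are all equal, the sign of the permutation cancelling against that of the alternating power, and
  their number (2n)! cancels the factorial in \<open>wedge\<close>.\<close>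

lemma wedge_top_adapted:
  fixes \<eta> :: "'e::real_vector \<Rightarrow> real"
  assumes lin: "\<And>u. linear (\<omega> u)" "\<And>w. linear (\<lambda>u. \<omega> u w)"
    and ker: "\<And>i. i < 2 * n \<Longrightarrow> \<eta> (v (Suc i)) = 0"
  shows "wedge_top n \<eta> \<omega> v = \<eta> (v 0) * wedge_power2 (form2 \<omega>) n (\<lambda>i. v (Suc i))"
proof -
  let ?W = "wedge_power2 (form2 \<omega>) n"
  let ?t = "\<lambda>\<pi>. of_int (sign \<pi>) * \<eta> (v (\<pi> 0)) * ?W (\<lambda>i. v (\<pi> (Suc i)))"
  let ?P = "{\<pi>. \<pi> permutes {..<1 + 2 * n}}"
  let ?Q = "{\<pi>. \<pi> permutes {..<2 * n}}"
  have "(\<Sum>\<pi>\<in>?P. ?t \<pi>) = (\<Sum>\<pi>\<in>{\<pi>\<in>?P. \<pi> 0 = 0}. ?t \<pi>)"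
  proof (rule sum.mono_neutral_right)
    show "finite ?P" by (simp add: finite_permutations)
    show "\<forall>\<pi>\<in>?P - {\<pi>\<in>?P. \<pi> 0 = 0}. ?t \<pi> = 0"
    proof
      fix \<pi> assume p: "\<pi> \<in> ?P - {\<pi>\<in>?P. \<pi> 0 = 0}"
      then obtain j where "\<pi> 0 = Suc j" by (auto simp: gr0_conv_Suc)
      then show "?t \<pi> = 0"
        using ker[of j] permutes_lessThan[of \<pi> "1 + 2 * n" 0] p by auto
    qed
  qed auto
  also have "\<dots> = (\<Sum>\<pi>\<in>?Q. \<eta> (v 0) * ?W (\<lambda>i. v (Suc i)))"
  proof (rule sum.reindex_bij_witness[where
        i = "map_permutation {..<2 * n} Suc" and j = "\<lambda>\<pi> i. \<pi> (Suc i) - 1"], goal_cases)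
    case (1 \<pi>)
    then show ?case
      using permutes_fixing_zero(2)[of \<pi> "2 * n"] by simp
  next
    case (2 \<pi>)
    then show ?case
      using permutes_fixing_zero(1)[of \<pi> "2 * n"] by simp
  next
    case (3 \<pi>)
    show ?case
    proof
      fix x
      show "map_permutation {..<2 * n} Suc \<pi> (Suc x) - 1 = \<pi> x"
        using 3 by (cases "x < 2 * n")
          (auto simp: map_permutation_def restrict_id_def inv_into_f_f permutes_def)
    qed
  next
    case (4 \<pi>)
    have "map_permutation {..<2 * n} Suc \<pi> permutes Suc ` {..<2 * n}"
      using 4 by (intro map_permutation_permutes) (auto simp: bij_betw_def)
    then have "map_permutation {..<2 * n} Suc \<pi> permutes {..<1 + 2 * n}"
      by (rule permutes_subset) auto
    then show ?case
      by (auto simp: map_permutation_def restrict_id_def)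
  next
    case (5 \<pi>)
    let ?q = "\<lambda>i. \<pi> (Suc i) - 1"
    have q: "?q permutes {..<2 * n}" and eq: "map_permutation {..<2 * n} Suc ?q = \<pi>"
      using permutes_fixing_zero[of \<pi> "2 * n"] 5 by auto
    have sgn: "sign \<pi> = sign ?q"
      using sign_map_permutation[of Suc "{..<2 * n}" ?q] q eq by simp
    have "\<pi> (Suc i) > 0" for i
      using 5 permutes_inj[of \<pi>] injD[of \<pi> "Suc i" 0] by auto
    then have "(\<lambda>i. v (\<pi> (Suc i))) = (\<lambda>i. v (Suc (?q i)))"
      by simp
    then have "?W (\<lambda>i. v (\<pi> (Suc i))) = of_int (sign ?q) * ?W (\<lambda>i. v (Suc i))"
      using alternating_form_permute[OF wedge_power2_alternating[OF lin] q, of "\<lambda>i. v (Suc i)"]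
      by simp
    moreover have "real_of_int (sign ?q) * real_of_int (sign ?q) = 1"
      by (simp flip: of_int_mult)
    ultimately show ?case
      using 5 unfolding sgn by simp
  qed
  also have "\<dots> = fact (2 * n) * (\<eta> (v 0) * ?W (\<lambda>i. v (Suc i)))"
    by (simp add: card_permutations)
  finally show ?thesis
    unfolding wedge_top_def wedge_def by (simp add: form1_def)
qed

section \<open>Frames and symplectic bases\<close>

text \<open>A basis indexed by an initial segment of the naturals can be fed directly to a form,
  which takes a sequence of vectors.\<close>

definition frame :: "nat \<Rightarrow> (nat \<Rightarrow> 'e::euclidean_space) \<Rightarrow> 'e set \<Rightarrow> bool" where
  "frame m b S \<longleftrightarrow>
     inj_on b {..<m} \<and> independent (b ` {..<m}) \<and> span (b ` {..<m}) = S"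

lemma frame_mem: "frame m b S \<Longrightarrow> i < m \<Longrightarrow> b i \<in> S"
  by (auto simp: frame_def intro: span_base)

lemma span_image_expand:
  fixes b :: "nat \<Rightarrow> 'e::real_vector"
  assumes "u \<in> span (b ` {..<m})"
  shows "\<exists>c. u = (\<Sum>j<m. c j *\<^sub>R b j)"
  using assms
proof (induction rule: span_induct_alt)
  case base
  show ?case by (rule exI[of _ "\<lambda>_. 0"]) simp
next
  case (step a x y)
  then obtain c k where c: "y = (\<Sum>j<m. c j *\<^sub>R b j)" and k: "k < m" "x = b k" by auto
  have "a *\<^sub>R x = (\<Sum>j<m. (if j = k then a else 0) *\<^sub>R b j)"
    using k by (simp add: if_distrib[of "\<lambda>t. t *\<^sub>R _"] sum.delta cong: if_cong)
  then have "a *\<^sub>R x + y = (\<Sum>j<m. ((if j = k then a else 0) + c j) *\<^sub>R b j)"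
    by (simp add: c sum.distrib scaleR_add_left)
  then show ?case
    by (rule exI[of _ "\<lambda>j. (if j = k then a else 0) + c j"])
qed

lemma frame_expand: "frame m b S \<Longrightarrow> u \<in> S \<Longrightarrow> \<exists>c. u = (\<Sum>j<m. c j *\<^sub>R b j)"
  using span_image_expand by (auto simp: frame_def)

lemma frame_unique:
  assumes b: "frame m b S" and zero: "(\<Sum>j<m. c j *\<^sub>R b j) = 0" and i: "i < m"
  shows "c i = 0"
proof -
  have inj: "inj_on b {..<m}" and ind: "independent (b ` {..<m})"
    using b by (auto simp: frame_def)
  have "(\<Sum>x\<in>b ` {..<m}. c (inv_into {..<m} b x) *\<^sub>R x) = (\<Sum>j<m. c j *\<^sub>R b j)"
    using inj by (simp add: sum.reindex inv_into_f_f)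
  then have "c (inv_into {..<m} b (b i)) = 0"
    using independentD[OF ind, of "b ` {..<m}" "\<lambda>x. c (inv_into {..<m} b x)" "b i"] zero i by auto
  then show ?thesis
    using inj i by (simp add: inv_into_f_f)
qed

lemma frame_dim: "frame m b S \<Longrightarrow> dim S = m"
  unfolding frame_def by (metis card_image card_lessThan dim_eq_card_independent dim_span)

text \<open>The values of a symplectic form on a standard basis in the order e1, f1, e2, f2 and so
  on: index 2i is paired with 2i + 1. In this order a basis grows by a pair without
  renumbering.\<close>

definition symplectic_unit :: "nat \<Rightarrow> nat \<Rightarrow> real" where
  "symplectic_unit i j =
     (if even i \<and> j = Suc i then 1 else if odd i \<and> i = Suc j then - 1 else 0)"

definition alternating_bilinear :: "('e::real_vector \<Rightarrow> 'e \<Rightarrow> real) \<Rightarrow> bool" where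
  "alternating_bilinear \<omega> \<longleftrightarrow> (\<forall>u. linear (\<omega> u)) \<and> (\<forall>u w. \<omega> u w = - \<omega> w u)"

lemma alternating_bilinearD:
  assumes "alternating_bilinear \<omega>"
  shows "linear (\<omega> u)" "linear (\<lambda>u. \<omega> u w)" "\<omega> u w = - \<omega> w u" "\<omega> u u = 0"
proof -
  have lin: "linear (\<omega> u)" and sym: "\<omega> u w = - \<omega> w u" for u w
    using assms unfolding alternating_bilinear_def by blast+
  then show "linear (\<omega> u)" "\<omega> u w = - \<omega> w u" by blast+
  have "(\<lambda>u. \<omega> u w) = (\<lambda>u. - \<omega> w u)"
    by (rule ext) (rule sym)
  then show "linear (\<lambda>u. \<omega> u w)"
    using linear_compose_neg[OF lin[of w]] by simp
  show "\<omega> u u = 0"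
    using sym[of u u] by linarith
qed

text \<open>Symplectic Gram-Schmidt: a pair with pairing 1 is split off, and nondegeneracy passes to
  its orthogonal complement \<open>S'\<close>, whose dimension is smaller.\<close>

lemma symplectic_basis_exists:
  fixes S :: "'e::euclidean_space set"
  assumes "subspace S" and alt: "alternating_bilinear \<omega>"
    and "\<And>v. v \<in> S \<Longrightarrow> (\<And>w. w \<in> S \<Longrightarrow> \<omega> v w = 0) \<Longrightarrow> v = 0"
  shows "\<exists>m s. (\<forall>i<2 * m. s i \<in> S) \<and>
    (\<forall>i<2 * m. \<forall>j<2 * m. \<omega> (s i) (s j) = symplectic_unit i j) \<and> S \<subseteq> span (s ` {..<2 * m})"
  using assms(1,3)
proof (induction "dim S" arbitrary: S rule: less_induct)
  case less
  note l1 = alternating_bilinearD(1)[OF alt] and l2 = alternating_bilinearD(2)[OF alt]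
    and sym = alternating_bilinearD(3)[OF alt] and null = alternating_bilinearD(4)[OF alt]
  note lin = linear_add[OF l1] linear_add[OF l2] linear_diff[OF l1] linear_diff[OF l2]
    linear_cmul[OF l1] linear_cmul[OF l2]
  show ?case
  proof (cases "S \<subseteq> {0}")
    case True
    then show ?thesis by (intro exI[of _ 0]) auto
  next
    case False
    then obtain v where v: "v \<in> S" "v \<noteq> 0" by auto
    then obtain w' where w': "w' \<in> S" "\<omega> v w' \<noteq> 0" using less.prems(2) by blast
    define w where "w = (1 / \<omega> v w') *\<^sub>R w'"
    have w: "w \<in> S" "\<omega> v w = 1" "\<omega> w v = - 1"
      using w' less.prems(1) sym[of w v] by (auto simp: w_def subspace_scale lin)
    define S' where "S' = {x \<in> S. \<omega> v x = 0 \<and> \<omega> w x = 0}"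
    have sub: "subspace S'"
      using less.prems(1) unfolding S'_def
      by (auto simp: real_vector.subspace_def lin linear_0[OF l1])
    have "v \<notin> S'" using w by (auto simp: S'_def)
    then have "S' \<subset> S" using v by (auto simp: S'_def)
    then have d: "dim S' < dim S"
      using sub less.prems(1) by (intro dim_psubset) (simp add: span_eq_iff[THEN iffD2])
    \<comment> \<open>The projection onto \<open>S'\<close> along the plane of \<open>v\<close> and
      \<open>w\<close>. A vector of \<open>S'\<close> pairs with \<open>z\<close> as it does with
      \<open>pr z\<close>, whence nondegeneracy on \<open>S'\<close>.\<close>
    define pr where "pr z = z - \<omega> z w *\<^sub>R v + \<omega> z v *\<^sub>R w" for z
    have pr: "pr z \<in> S'" if "z \<in> S" for z
      using that v w less.prems(1) sym[of z v] sym[of z w]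
      by (auto simp: S'_def pr_def lin null intro!: subspace_add subspace_diff subspace_scale)
    have "x = 0" if x: "x \<in> S'" "\<And>y. y \<in> S' \<Longrightarrow> \<omega> x y = 0" for x
    proof (rule less.prems(2))
      show "x \<in> S" using x by (simp add: S'_def)
      fix z assume "z \<in> S"
      then have "\<omega> x (pr z) = 0" using pr x by blast
      moreover have "\<omega> x v = 0" "\<omega> x w = 0"
        using x(1) sym[of x v] sym[of x w] by (auto simp: S'_def)
      ultimately show "\<omega> x z = 0" by (simp add: pr_def lin)
    qed
    then obtain m s where s: "\<And>i. i < 2 * m \<Longrightarrow> s i \<in> S'"
      "\<And>i j. i < 2 * m \<Longrightarrow> j < 2 * m \<Longrightarrow> \<omega> (s i) (s j) = symplectic_unit i j"
      "S' \<subseteq> span (s ` {..<2 * m})"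
      using less.hyps[OF d sub] by blast
    define t where "t = s(2 * m := v, Suc (2 * m) := w)"
    have t: "t (2 * m) = v" "t (Suc (2 * m)) = w" "\<And>i. i < 2 * m \<Longrightarrow> t i = s i"
      by (auto simp: t_def)
    have bound: "i < 2 * Suc m \<longleftrightarrow> i < 2 * m \<or> i = 2 * m \<or> i = Suc (2 * m)" for i
      by auto
    have orth: "\<omega> v (s i) = 0" "\<omega> w (s i) = 0" "\<omega> (s i) v = 0" "\<omega> (s i) w = 0" if "i < 2 * m" for i
      using s(1)[OF that] sym[of "s i" v] sym[of "s i" w] by (auto simp: S'_def)
    have "t i \<in> S" if "i < 2 * Suc m" for i
      using that v w s(1) unfolding bound by (auto simp: t S'_def)
    moreover have "\<omega> (t i) (t j) = symplectic_unit i j" if "i < 2 * Suc m" "j < 2 * Suc m" for i j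
      using that unfolding bound
      by (elim disjE) (auto simp: t s(2) orth null w symplectic_unit_def, presburger+)
    moreover have "S \<subseteq> span (t ` {..<2 * Suc m})"
    proof
      fix z assume "z \<in> S"
      have "s ` {..<2 * m} = t ` {..<2 * m}" using t(3) by auto
      also have "\<dots> \<subseteq> t ` {..<2 * Suc m}" by auto
      finally have "pr z \<in> span (t ` {..<2 * Suc m})"
        using pr[OF \<open>z \<in> S\<close>] s(3) span_mono by blast
      moreover have "v \<in> span (t ` {..<2 * Suc m})" "w \<in> span (t ` {..<2 * Suc m})"
        using t(1,2) by (metis image_eqI lessThan_iff span_base bound)+
      moreover have "z = pr z + \<omega> z w *\<^sub>R v - \<omega> z v *\<^sub>R w" by (simp add: pr_def)
      ultimately show "z \<in> span (t ` {..<2 * Suc m})"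
        by (metis span_add span_diff span_scale)
    qed
    ultimately show ?thesis by blast
  qed
qed

text \<open>Injectivity and independence are read off from the pairings, and the dimension then
  fixes the number of pairs.\<close>

lemma symplectic_frame_exists:
  fixes S :: "'e::euclidean_space set"
  assumes "subspace S" and alt: "alternating_bilinear \<omega>" and dim: "dim S = 2 * n"
    and "\<And>v. v \<in> S \<Longrightarrow> (\<And>w. w \<in> S \<Longrightarrow> \<omega> v w = 0) \<Longrightarrow> v = 0"
  shows "\<exists>s. frame (2 * n) s S \<and> (\<forall>i<2 * n. \<forall>j<2 * n. \<omega> (s i) (s j) = symplectic_unit i j)"
proof -
  obtain m s where s: "\<And>i. i < 2 * m \<Longrightarrow> s i \<in> S"
    "\<And>i j. i < 2 * m \<Longrightarrow> j < 2 * m \<Longrightarrow> \<omega> (s i) (s j) = symplectic_unit i j"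
    "S \<subseteq> span (s ` {..<2 * m})"
    using symplectic_basis_exists[OF assms(1,2,4)] by blast
  \<comment> \<open>The partner of index \<open>i\<close>: pairing with \<open>s (k i)\<close>
    extracts, up to sign, the coefficient of \<open>s i\<close>.\<close>
  define k where "k i = (if even i then Suc i else i - 1)" for i :: nat
  have k: "k i < 2 * m" if "i < 2 * m" for i
    using that by (cases "even i") (auto simp: k_def elim!: evenE)
  have unit: "symplectic_unit (k i) j = (if j = i then (if even i then - 1 else 1) else 0)" for i j
    by (cases "even i") (auto simp: k_def symplectic_unit_def elim!: oddE)
  have inj: "inj_on s {..<2 * m}"
  proof (rule inj_onI)
    fix i j assume ij: "i \<in> {..<2 * m}" "j \<in> {..<2 * m}" "s i = s j"
    then have "symplectic_unit (k i) i = symplectic_unit (k i) j"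
      using s(2)[OF k[of i], of i] s(2)[OF k[of i], of j] by simp
    then show "i = j" by (auto simp: unit split: if_splits)
  qed
  have ind: "independent (s ` {..<2 * m})"
  proof (rule independent_if_scalars_zero)
    fix f x assume f: "(\<Sum>x\<in>s ` {..<2 * m}. f x *\<^sub>R x) = 0" and "x \<in> s ` {..<2 * m}"
    then obtain i where i: "x = s i" "i < 2 * m" by auto
    have "0 = \<omega> (s (k i)) (\<Sum>j<2 * m. f (s j) *\<^sub>R s j)"
      using f inj by (simp add: sum.reindex linear_0[OF alternating_bilinearD(1)[OF alt]])
    also have "\<dots> = (\<Sum>j<2 * m. f (s j) * symplectic_unit (k i) j)"
      using s(2)[OF k[OF i(2)]] by (simp add: linear_sum[OF alternating_bilinearD(1)[OF alt]]
          linear_cmul[OF alternating_bilinearD(1)[OF alt]])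
    also have "\<dots> = (\<Sum>j<2 * m. if j = i then f (s i) * (if even i then - 1 else 1) else 0)"
      by (rule sum.cong) (auto simp: unit)
    also have "\<dots> = f (s i) * (if even i then - 1 else 1)"
      using i by simp
    finally show "f x = 0" using i by (auto split: if_splits)
  qed simp
  have "span (s ` {..<2 * m}) = S"
    using s(1,3) assms(1) by (intro antisym span_minimal) auto
  then have fr: "frame (2 * m) s S"
    using inj ind by (simp add: frame_def)
  then have "m = n" using frame_dim[OF fr] dim by simp
  then show ?thesis using fr s(2) by blast
qed

section \<open>The Pfaffian ratio\<close>

definition gram :: "nat \<Rightarrow> ('e \<Rightarrow> 'e \<Rightarrow> real) \<Rightarrow> (nat \<Rightarrow> 'e) \<Rightarrow> real mat" where
  "gram m \<omega> b = mat m m (\<lambda>(i, j). \<omega> (b i) (b j))"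

lemma gram_carrier [simp]: "gram m \<omega> b \<in> carrier_mat m m"
  by (simp add: gram_def)

lemma gram_change_frame:
  assumes l1: "\<And>u. linear (\<omega> u)" and l2: "\<And>w. linear (\<lambda>u. \<omega> u w)"
    and b: "\<And>i. i < m \<Longrightarrow> b i = (\<Sum>j<m. M i j *\<^sub>R s j)"
    and c: "\<And>i. i < m \<Longrightarrow> c i = (\<Sum>j<m. M' i j *\<^sub>R s j)"
  shows "mat m m (\<lambda>(i, j). \<omega> (b i) (c j)) =
    mat m m (\<lambda>(i, j). M i j) * gram m \<omega> s * transpose_mat (mat m m (\<lambda>(i, j). M' i j))"
proof -
  have "\<omega> (b i) (c j) = (\<Sum>l = 0..<m. (\<Sum>k = 0..<m. M i k * \<omega> (s k) (s l)) * M' j l)"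
    if "i < m" "j < m" for i j
    using that
    by (simp add: b c linear_sum[OF l1] linear_sum[OF l2] linear_cmul[OF l1] linear_cmul[OF l2]
        atLeast0LessThan mult.commute)
  then show ?thesis
    by (intro eq_matI) (auto simp: gram_def scalar_prod_def)
qed

lemma det_congruence:
  fixes A B :: "'a::idom mat"
  assumes A: "A \<in> carrier_mat m m" and B: "B \<in> carrier_mat m m"
  shows "Determinant.det (A * B * transpose_mat A) = (Determinant.det A)\<^sup>2 * Determinant.det B"
proof -
  have "A * B \<in> carrier_mat m m" "transpose_mat A \<in> carrier_mat m m"
    using A B by auto
  then show ?thesis
    using Determinant.det_mult[of "A * B" m "transpose_mat A"] Determinant.det_mult[OF A B]
      Determinant.det_transpose[OF A]
    by (simp add: power2_eq_square mult_ac)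
qed

text \<open>Passing from a symplectic basis by a matrix \<open>M\<close> multiplies the power by det
  M and the Gram determinant by its square. What remains are the values of
  \<open>symplectic_unit\<close> on the indices, which depend on \<open>n\<close> only.\<close>

lemma wedge_power2_square_nondegenerate:
  fixes b :: "nat \<Rightarrow> 'e::euclidean_space"
  assumes b: "frame (2 * n) b S" and alt: "alternating_bilinear \<omega>"
    and nondeg: "\<And>v. v \<in> S \<Longrightarrow> (\<And>w. w \<in> S \<Longrightarrow> \<omega> v w = 0) \<Longrightarrow> v = 0"
  shows "(wedge_power2 (form2 \<omega>) n b)\<^sup>2 * Determinant.det (gram (2 * n) symplectic_unit id) =
    (wedge_power2 (form2 symplectic_unit) n id)\<^sup>2 * Determinant.det (gram (2 * n) \<omega> b)"
    and "Determinant.det (gram (2 * n) \<omega> b) \<noteq> 0"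
    and "Determinant.det (gram (2 * n) symplectic_unit id) \<noteq> 0"
proof -
  note l1 = alternating_bilinearD(1)[OF alt] and l2 = alternating_bilinearD(2)[OF alt]
  have "subspace S" using b by (auto simp: frame_def)
  then obtain s where s: "frame (2 * n) s S"
    and unit: "\<And>i j. i < 2 * n \<Longrightarrow> j < 2 * n \<Longrightarrow> \<omega> (s i) (s j) = symplectic_unit i j"
    using symplectic_frame_exists[OF _ alt frame_dim[OF b] nondeg] by blast
  have "\<forall>i. \<exists>c. i < 2 * n \<longrightarrow> b i = (\<Sum>j<2 * n. c j *\<^sub>R s j)"
    using frame_expand[OF s] frame_mem[OF b] by blast
  then obtain M where M: "\<And>i. i < 2 * n \<Longrightarrow> b i = (\<Sum>j<2 * n. M i j *\<^sub>R s j)"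
    by metis
  let ?M = "mat (2 * n) (2 * n) (\<lambda>(i, j). M i j)"
  note alt' = wedge_power2_alternating[OF l1 l2, of n]
  have "wedge_power2 (form2 \<omega>) n b = Determinant.det ?M * wedge_power2 (form2 \<omega>) n s"
    using alternating_form_cong[OF alt', of b "\<lambda>i. \<Sum>j<2 * n. M i j *\<^sub>R s j"] M
      alternating_form_det[OF alt', of M s] by simp
  also have "wedge_power2 (form2 \<omega>) n s = wedge_power2 (form2 symplectic_unit) n id"
    by (rule wedge_power2_cong) (simp add: unit)
  finally have W: "wedge_power2 (form2 \<omega>) n b
    = Determinant.det ?M * wedge_power2 (form2 symplectic_unit) n id" .
  have "gram (2 * n) \<omega> s = gram (2 * n) symplectic_unit id"
    by (auto simp: gram_def unit intro!: eq_matI)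
  then have "gram (2 * n) \<omega> b = ?M * gram (2 * n) symplectic_unit id * transpose_mat ?M"
    unfolding gram_def[of "2 * n" \<omega> b] using gram_change_frame[where \<omega> = \<omega>, OF l1 l2 M M] by simp
  then have detg: "Determinant.det (gram (2 * n) \<omega> b)
    = (Determinant.det ?M)\<^sup>2 * Determinant.det (gram (2 * n) symplectic_unit id)"
    using det_congruence[of ?M "2 * n" "gram (2 * n) symplectic_unit id"] by simp
  from W detg show "(wedge_power2 (form2 \<omega>) n b)\<^sup>2 * Determinant.det (gram (2 * n) symplectic_unit id) =
    (wedge_power2 (form2 symplectic_unit) n id)\<^sup>2 * Determinant.det (gram (2 * n) \<omega> b)"
    by (simp add: power_mult_distrib)
  show nz: "Determinant.det (gram (2 * n) \<omega> b) \<noteq> 0"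
  proof
    assume "Determinant.det (gram (2 * n) \<omega> b) = 0"
    then obtain x where x: "x \<in> carrier_vec (2 * n)" "x \<noteq> 0\<^sub>v (2 * n)"
      "gram (2 * n) \<omega> b *\<^sub>v x = 0\<^sub>v (2 * n)"
      using det_0_iff_vec_prod_zero[OF gram_carrier] by blast
    \<comment> \<open>A kernel vector of the Gram matrix holds the coordinates of a vector in the
      radical, which must be 0.\<close>
    define u where "u = (\<Sum>j<2 * n. (x $ j) *\<^sub>R b j)"
    have bu: "\<omega> (b i) u = 0" if i: "i < 2 * n" for i
    proof -
      have "(gram (2 * n) \<omega> b *\<^sub>v x) $ i = 0" using x i by simp
      then have "(\<Sum>j<2 * n. \<omega> (b i) (b j) * (x $ j)) = 0"
        using i x(1) by (simp add: gram_def scalar_prod_def atLeast0LessThan)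
      then show ?thesis
        by (simp add: u_def linear_sum[OF l1] linear_cmul[OF l1] mult.commute)
    qed
    have "u = 0"
    proof (rule nondeg)
      show "u \<in> S"
        unfolding u_def using b frame_mem[OF b] \<open>subspace S\<close>
        by (intro subspace_sum subspace_scale) auto
      fix w assume "w \<in> S"
      then obtain c where "w = (\<Sum>j<2 * n. c j *\<^sub>R b j)" using frame_expand[OF b] by blast
      then have "\<omega> w u = 0"
        by (simp add: linear_sum[OF l2] linear_cmul[OF l2] bu)
      then show "\<omega> u w = 0"
        using alternating_bilinearD(3)[OF alt, of u w] by simp
    qed
    then have "x $ j = 0" if "j < 2 * n" for j
      using frame_unique[OF b, of "\<lambda>j. x $ j" j] that by (simp add: u_def)
    then have "x = 0\<^sub>v (2 * n)" using x(1) by (intro eq_vecI) auto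
    with x(2) show False by simp
  qed
  then show "Determinant.det (gram (2 * n) symplectic_unit id) \<noteq> 0"
    using detg by auto
qed

text \<open>Exchange argument: some basis vector \<open>b k\<close> has a nonzero coefficient in
  \<open>u\<close>. With \<open>u\<close> in its place the power is 0, but by multilinearity it is
  also that coefficient times the original power, as repeated vectors contribute nothing.\<close>

lemma wedge_power2_degenerate:
  fixes b :: "nat \<Rightarrow> 'e::euclidean_space"
  assumes b: "frame (2 * n) b S" and alt: "alternating_bilinear \<omega>"
    and u: "u \<in> S" "u \<noteq> 0" "\<And>w. w \<in> S \<Longrightarrow> \<omega> u w = 0"
  shows "wedge_power2 (form2 \<omega>) n b = 0" and "Determinant.det (gram (2 * n) \<omega> b) = 0"
proof -
  note l1 = alternating_bilinearD(1)[OF alt] and l2 = alternating_bilinearD(2)[OF alt]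
  note alt' = wedge_power2_alternating[OF l1 l2, of n]
  obtain c where c: "u = (\<Sum>j<2 * n. c j *\<^sub>R b j)" using frame_expand[OF b u(1)] by blast
  then obtain k where k: "k < 2 * n" "c k \<noteq> 0"
    using u(2) by (metis (no_types, lifting) lessThan_iff scale_zero_left sum.neutral)
  have bu: "\<omega> u (b j) = 0" "\<omega> (b j) u = 0" if "j < 2 * n" for j
    using u(3)[OF frame_mem[OF b that]] alternating_bilinearD(3)[OF alt, of "b j" u] by auto
  have lin: "linear (\<lambda>x. wedge_power2 (form2 \<omega>) n (b(k := x)))"
    by (rule alternating_form_linear[OF alt' k(1)])
  have "0 = wedge_power2 (form2 \<omega>) n (b(k := u))"
    using k(1) by (intro wedge_power2_null[symmetric, of k])
      (auto simp: bu alternating_bilinearD(4)[OF alt])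
  also have "\<dots> = (\<Sum>j<2 * n. c j * wedge_power2 (form2 \<omega>) n (b(k := b j)))"
    unfolding c by (simp add: linear_sum[OF lin] linear_cmul[OF lin])
  also have "\<dots> = (\<Sum>j<2 * n. if j = k then c k * wedge_power2 (form2 \<omega>) n b else 0)"
  proof (intro sum.cong refl)
    fix j assume "j \<in> {..<2 * n}"
    then have "j \<noteq> k \<Longrightarrow> wedge_power2 (form2 \<omega>) n (b(k := b j)) = 0"
      using k(1) by (intro alternating_form_repeat[OF alt', of j k]) auto
    then show "c j * wedge_power2 (form2 \<omega>) n (b(k := b j))
      = (if j = k then c k * wedge_power2 (form2 \<omega>) n b else 0)" by simp
  qed
  also have "\<dots> = c k * wedge_power2 (form2 \<omega>) n b" using k(1) by simp
  finally show "wedge_power2 (form2 \<omega>) n b = 0" using k(2) by simp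
  have "gram (2 * n) \<omega> b *\<^sub>v vec (2 * n) c = 0\<^sub>v (2 * n)"
  proof (intro eq_vecI)
    fix i assume "i < dim_vec (0\<^sub>v (2 * n) :: real Matrix.vec)"
    then have i: "i < 2 * n" by simp
    have "(\<Sum>j<2 * n. \<omega> (b i) (b j) * c j) = \<omega> (b i) u"
      unfolding c by (simp add: linear_sum[OF l1] linear_cmul[OF l1] mult.commute)
    then show "(gram (2 * n) \<omega> b *\<^sub>v vec (2 * n) c) $ i = 0\<^sub>v (2 * n) $ i"
      using i bu by (simp add: gram_def scalar_prod_def atLeast0LessThan)
  qed (simp add: gram_def)
  moreover have "vec (2 * n) c \<noteq> 0\<^sub>v (2 * n)"
    using k by (metis index_vec index_zero_vec(1))
  ultimately show "Determinant.det (gram (2 * n) \<omega> b) = 0"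
    using det_0_iff_vec_prod_zero[OF gram_carrier] vec_carrier by blast
qed

text \<open>\<open>Pf\<^sup>2 = det\<close>; stated as a ratio it needs no value of the power on a symplectic basis.\<close>

lemma wedge_power2_square_ratio:
  fixes b :: "nat \<Rightarrow> 'e::euclidean_space"
  assumes b: "frame (2 * n) b S"
    and alt: "alternating_bilinear \<omega>" and alt': "alternating_bilinear \<omega>'"
  shows "(wedge_power2 (form2 \<omega>) n b)\<^sup>2 * Determinant.det (gram (2 * n) \<omega>' b)
    = (wedge_power2 (form2 \<omega>') n b)\<^sup>2 * Determinant.det (gram (2 * n) \<omega> b)"
\<comment> \<open>If one of the forms has a radical, its power and its Gram determinant vanish
  together and both sides are 0. Otherwise both forms are compared with the same symplectic
  constants.\<close>
proof (cases "\<exists>u\<in>S. u \<noteq> 0 \<and> ((\<forall>w\<in>S. \<omega> u w = 0) \<or> (\<forall>w\<in>S. \<omega>' u w = 0))")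
  case True
  then show ?thesis
    using wedge_power2_degenerate[OF b alt] wedge_power2_degenerate[OF b alt'] by auto
next
  case False
  let ?J = "gram (2 * n) symplectic_unit id"
  let ?w = "wedge_power2 (form2 symplectic_unit) n id"
  have 1: "(wedge_power2 (form2 \<omega>) n b)\<^sup>2 * Determinant.det ?J = ?w\<^sup>2 * Determinant.det (gram (2 * n) \<omega> b)"
    and nz: "Determinant.det ?J \<noteq> 0"
    by (rule wedge_power2_square_nondegenerate(1,3)[OF b alt]; use False in blast)+
  have 2: "(wedge_power2 (form2 \<omega>') n b)\<^sup>2 * Determinant.det ?J = ?w\<^sup>2 * Determinant.det (gram (2 * n) \<omega>' b)"
    by (rule wedge_power2_square_nondegenerate(1)[OF b alt']; use False in blast)
  have "(wedge_power2 (form2 \<omega>) n b)\<^sup>2 * Determinant.det (gram (2 * n) \<omega>' b) * Determinant.det ?J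
    = (wedge_power2 (form2 \<omega>') n b)\<^sup>2 * Determinant.det (gram (2 * n) \<omega> b) * Determinant.det ?J"
  proof -
    have "x * g' * d = x' * g * d" if "x * d = w * g" "x' * d = w * g'" for x x' g g' d w :: real
      using that by (metis mult.assoc mult.commute)
    then show ?thesis using 1 2 by blast
  qed
  then show ?thesis using nz by simp
qed

text \<open>A vector off a hyperplane completes a basis of it. The new vector takes index 0, the
  slot of the 1-form. Used for X with ker \<sigma> and for R with ker \<eta>.\<close>

lemma frame_extend:
  assumes b: "frame m b {u. \<sigma> u = 0}" and lin: "linear \<sigma>" and X: "\<sigma> X \<noteq> (0::real)"
  shows "frame (Suc m) (case_nat X b) UNIV"
proof -
  have ker: "\<sigma> (b i) = 0" if "i < m" for i
    using frame_mem[OF b that] by simp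
  have inj: "inj_on b {..<m}" and ind: "independent (b ` {..<m})"
    and span: "span (b ` {..<m}) = {u. \<sigma> u = 0}"
    using b by (auto simp: frame_def)
  have img: "case_nat X b ` {..<Suc m} = insert X (b ` {..<m})"
    by (auto simp: lessThan_Suc_eq_insert_0 image_image)
  have "inj_on (case_nat X b) {..<Suc m}"
    using inj ker X by (auto simp: inj_on_def split: nat.splits)
  moreover have "independent (insert X (b ` {..<m}))"
    using ind span X by (intro independent_insertI) auto
  moreover have "u \<in> span (insert X (b ` {..<m}))" for u
  proof -
    have "u - (\<sigma> u / \<sigma> X) *\<^sub>R X \<in> span (b ` {..<m})"
      unfolding span using X by (simp add: linear_diff[OF lin] linear_cmul[OF lin])
    then show ?thesis
      using span_breakdown_eq by blast
  qed
  ultimately show ?thesis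
    unfolding frame_def img by auto
qed

section \<open>Matrices of endomorphisms of a subspace\<close>

lemma basis_list:
  assumes "subspace S"
  shows "distinct (basis_list S)" "independent (set (basis_list S))" "span (set (basis_list S)) = S"
proof -
  obtain B where B: "B \<subseteq> S" "independent B" "S \<subseteq> span B" "card B = dim S"
    by (rule basis_exists)
  then have "span B = S" using assms span_minimal[of B S] by auto
  moreover obtain bs where "set bs = B" "distinct bs"
    using finite_distinct_list[OF independent_imp_finite[OF B(2)]] by blast
  ultimately have "\<exists>bs. distinct bs \<and> independent (set bs) \<and> span (set bs) = S"
    using B(2) by blast
  from someI_ex[OF this]
  show "distinct (basis_list S)" "independent (set (basis_list S))" "span (set (basis_list S)) = S"
    unfolding basis_list_def by blast+
qed

lemma frame_basis_list:
  assumes "subspace S"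
  shows "frame (length (basis_list S)) ((!) (basis_list S)) S"
proof -
  have "(!) (basis_list S) ` {..<length (basis_list S)} = set (basis_list S)"
    by (auto simp: set_conv_nth)
  then show ?thesis
    using basis_list[OF assms] by (auto simp: frame_def inj_on_nth)
qed

lemma length_basis_list: "subspace S \<Longrightarrow> length (basis_list S) = dim S"
  by (rule frame_dim[OF frame_basis_list, symmetric])

lemma matrix_on_carrier:
  "subspace S \<Longrightarrow> matrix_on S f \<in> carrier_mat (dim S) (dim S)"
  by (simp add: matrix_on_def length_basis_list Let_def)

lemma representation_expand:
  assumes "subspace S" "x \<in> S"
  shows "x = (\<Sum>i<dim S. representation (set (basis_list S)) x (basis_list S ! i) *\<^sub>R basis_list S ! i)"
proof -
  let ?bs = "basis_list S"
  note bs = basis_list[OF assms(1)]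
  have "x = (\<Sum>b\<in>set ?bs. representation (set ?bs) x b *\<^sub>R b)"
    using bs assms(2) by (subst sum_representation_eq) auto
  also have "\<dots> = (\<Sum>i<length ?bs. representation (set ?bs) x (?bs ! i) *\<^sub>R ?bs ! i)"
    by (intro sum.reindex_bij_betw[symmetric] bij_betw_nth) (use bs in auto)
  finally show ?thesis
    by (simp add: length_basis_list[OF assms(1)])
qed

lemma matrix_on_expand:
  assumes "subspace S" "f ` S \<subseteq> S" "j < dim S"
  shows "f (basis_list S ! j) = (\<Sum>i<dim S. (matrix_on S f $$ (i, j)) *\<^sub>R basis_list S ! i)"
proof -
  have "basis_list S ! j \<in> S"
    using frame_mem[OF frame_basis_list[OF assms(1)]] assms(3)
    by (simp add: length_basis_list[OF assms(1)])
  then show ?thesis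
    using assms representation_expand[OF assms(1), of "f (basis_list S ! j)"]
    by (simp add: matrix_on_def length_basis_list Let_def image_subset_iff)
qed

text \<open>Images of basis vectors are the columns of \<open>matrix_on\<close>, so applying
  \<open>f\<close> in the first argument multiplies the Gram matrix by the transpose from the
  left.\<close>

lemma det_gram_compose:
  assumes S: "subspace S" and f: "f ` S \<subseteq> S" and lin: "\<And>w. linear (\<lambda>u. \<omega> u w)"
  shows "Determinant.det (gram (dim S) (\<lambda>u w. \<omega> (f u) w) ((!) (basis_list S)))
    = det_on S f * Determinant.det (gram (dim S) \<omega> ((!) (basis_list S)))"
proof -
  let ?b = "(!) (basis_list S)" and ?m = "dim S"
  have M: "matrix_on S f \<in> carrier_mat ?m ?m"
    by (rule matrix_on_carrier[OF S])
  have "gram ?m (\<lambda>u w. \<omega> (f u) w) ?b = transpose_mat (matrix_on S f) * gram ?m \<omega> ?b"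
  proof (intro eq_matI)
    fix i j
    assume "i < dim_row (transpose_mat (matrix_on S f) * gram ?m \<omega> ?b)"
      and "j < dim_col (transpose_mat (matrix_on S f) * gram ?m \<omega> ?b)"
    then have ij: "i < ?m" "j < ?m"
      using M by (auto simp: gram_def)
    then show "gram ?m (\<lambda>u w. \<omega> (f u) w) ?b $$ (i, j)
        = (transpose_mat (matrix_on S f) * gram ?m \<omega> ?b) $$ (i, j)"
      using M matrix_on_expand[OF S f ij(1)]
      by (auto simp: gram_def scalar_prod_def atLeast0LessThan linear_sum[OF lin] linear_cmul[OF lin]
          intro!: sum.cong)
  qed (use M in \<open>auto simp: gram_def\<close>)
  then show ?thesis
    using Determinant.det_mult[of "transpose_mat (matrix_on S f)" ?m "gram ?m \<omega> ?b"] M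
      Determinant.det_transpose[OF M]
    by (simp add: det_on_def)
qed

section \<open>The contact form along a canonoid pencil\<close>

text \<open>\<open>d\<close> is the determinant of the coordinates of \<open>v\<close> in the frame
  \<open>c\<close>, the same for all \<open>f\<close> and \<open>L\<close>. Hence the effect of
  \<open>L\<close> on \<open>f\<close> can be tested on \<open>c\<close> alone.\<close>

lemma alternating_form_frame:
  fixes c :: "nat \<Rightarrow> 'e::euclidean_space"
  assumes c: "frame m c UNIV"
  shows "\<exists>d. \<forall>f (L :: 'e \<Rightarrow> 'e). alternating_form m f \<longrightarrow> linear L \<longrightarrow> f (\<lambda>i. L (v i)) = d * f (\<lambda>i. L (c i))"
proof -
  have "\<forall>i. \<exists>x. v i = (\<Sum>j<m. x j *\<^sub>R c j)"
    using frame_expand[OF c] by blast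
  then obtain M where M: "\<And>i. v i = (\<Sum>j<m. M i j *\<^sub>R c j)"
    by metis
  show ?thesis
  proof (intro exI allI impI)
    fix f :: "'e form" and L :: "'e \<Rightarrow> 'e"
    assume f: "alternating_form m f" and L: "linear L"
    show "f (\<lambda>i. L (v i)) = Determinant.det (mat m m (\<lambda>(i, j). M i j)) * f (\<lambda>i. L (c i))"
      unfolding M linear_sum[OF L] linear_cmul[OF L] o_def
      by (rule alternating_form_det[OF f])
  qed
qed

text \<open>The map fixes ker \<sigma> and multiplies X by 1 - s, so its determinant is 1 - s. This
  is visible at once on a frame made of X and a basis of ker \<sigma>.\<close>

lemma alternating_form_rank_one:
  fixes f :: "('e::euclidean_space) form"
  assumes f: "alternating_form DIM('e) f" and \<sigma>: "linear \<sigma>" and X: "\<sigma> X = 1"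
  shows "f (\<lambda>i. v i - (s * \<sigma> (v i)) *\<^sub>R X) = (1 - s) * f v"
proof -
  have sub: "subspace {u. \<sigma> u = 0}"
    by (rule linear_subspace_kernel[OF \<sigma>])
  define c where "c = case_nat X ((!) (basis_list {u. \<sigma> u = 0}))"
  define m where "m = dim {u. \<sigma> u = 0}"
  have fr: "frame (Suc m) c UNIV"
    unfolding c_def m_def using frame_extend[OF frame_basis_list[OF sub] \<sigma>, of X] X
    by (simp add: length_basis_list[OF sub])
  then have m: "DIM('e) = Suc m"
    using frame_dim[OF fr] by simp
  let ?L = "\<lambda>u. u - (s * \<sigma> u) *\<^sub>R X"
  have L: "linear ?L"
    using \<sigma> by (auto simp: linear_iff algebra_simps)
  have c: "c 0 = X" "\<And>i. 0 < i \<Longrightarrow> i < Suc m \<Longrightarrow> \<sigma> (c i) = 0"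
    using frame_mem[OF frame_basis_list[OF sub]]
    by (auto simp: c_def m_def length_basis_list[OF sub] gr0_conv_Suc)
  have "f (\<lambda>i. ?L (c i)) = f (c(0 := (1 - s) *\<^sub>R X))"
    using c X by (intro alternating_form_cong[OF f]) (auto simp: m scaleR_left_diff_distrib)
  also have "\<dots> = (1 - s) * f (c(0 := X))"
    using linear_cmul[OF alternating_form_linear[OF f, of 0 c]] by simp
  also have "c(0 := X) = c"
    using c by auto
  finally have "f (\<lambda>i. ?L (c i)) = (1 - s) * f c" .
  moreover obtain d where d: "\<forall>f (L :: 'e \<Rightarrow> 'e). alternating_form (Suc m) f \<longrightarrow> linear L \<longrightarrow>
      f (\<lambda>i. L (v i)) = d * f (\<lambda>i. L (c i))"
    using alternating_form_frame[OF fr, of v] by (elim exE)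
  ultimately show ?thesis
    using d[rule_format, OF f[unfolded m] L] d[rule_format, OF f[unfolded m] linear_ident] by simp
qed

text \<open>
  The map \<open>u \<mapsto> u - s \<sigma>(u) X\<close> with \<open>s = t / (1 + t)\<close> has determinant \<open>1 / (1 + t)\<close> and pulls the pencil
  \<open>(\<eta> + t \<beta>, d\<eta> + t d\<beta>)\<close> back to \<open>(\<eta>, d\<eta> - t H d\<sigma>)\<close>, up to a multiple of \<open>\<eta>\<close> in the 2-form.
\<close>

lemma wedge_top_pencil:
  fixes \<eta> \<sigma> h \<beta> :: "'e::euclidean_space \<Rightarrow> real"
  assumes dim: "DIM('e) = 2 * n + 1"
    and lin: "linear \<eta>" "linear \<sigma>" "linear h"
    and alt: "alternating_bilinear \<omega>" "alternating_bilinear \<tau>"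
    and X: "\<eta> X = - H" "\<sigma> X = 1" "\<And>w. \<tau> X w = 0" "\<And>w. \<omega> X w = h w - r * \<eta> w"
    and \<beta>: "\<And>u. \<beta> u = - (H * \<sigma> u)"
    and d\<beta>: "\<And>u w. d\<beta> u w = - (h u * \<sigma> w - h w * \<sigma> u) - H * \<tau> u w"
    and t: "t \<noteq> - 1"
    and v: "\<And>i. i < 2 * n \<Longrightarrow> \<eta> (v (Suc i)) = 0"
  shows "wedge_top n (\<lambda>u. \<eta> u + t * \<beta> u) (\<lambda>u w. \<omega> u w + t * d\<beta> u w) v
    = (1 + t) * (\<eta> (v 0) * wedge_power2 (form2 (\<lambda>u w. \<omega> u w - t * H * \<tau> u w)) n (\<lambda>i. v (Suc i)))"
proof -
  define s where "s = t / (1 + t)"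
  have s: "1 - s = 1 / (1 + t)" "s * (1 + t) = t"
    using t by (auto simp: s_def field_simps)
  let ?e = "\<lambda>u. \<eta> u + t * \<beta> u" and ?o = "\<lambda>u w. \<omega> u w + t * d\<beta> u w"
  let ?L = "\<lambda>u. u - (s * \<sigma> u) *\<^sub>R X"
  note la = linear_add[OF lin(1)] linear_add[OF lin(2)] linear_add[OF lin(3)]
    linear_cmul[OF lin(1)] linear_cmul[OF lin(2)] linear_cmul[OF lin(3)]
    linear_add[OF alternating_bilinearD(1)[OF alt(1)]] linear_add[OF alternating_bilinearD(1)[OF alt(2)]]
    linear_add[OF alternating_bilinearD(2)[OF alt(1)]] linear_add[OF alternating_bilinearD(2)[OF alt(2)]]
    linear_cmul[OF alternating_bilinearD(1)[OF alt(1)]] linear_cmul[OF alternating_bilinearD(1)[OF alt(2)]]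
    linear_cmul[OF alternating_bilinearD(2)[OF alt(1)]] linear_cmul[OF alternating_bilinearD(2)[OF alt(2)]]
  have l\<eta>: "linear ?e"
    by (rule linearI) (simp_all add: \<beta> la algebra_simps)
  have l1: "linear (?o u)" for u
    by (rule linearI) (simp_all add: d\<beta> la algebra_simps)
  have l2: "linear (\<lambda>u. ?o u w)" for w
    by (rule linearI) (simp_all add: d\<beta> la algebra_simps)
  have skew: "?o u w = - ?o w u" for u w
    unfolding d\<beta> using alternating_bilinearD(3)[OF alt(1), of u w] alternating_bilinearD(3)[OF alt(2), of u w]
    by (simp add: algebra_simps)
  have eL: "?e (?L u) = \<eta> u" for u
  proof -
    have "?e (?L u) = \<eta> u - t * H * \<sigma> u + s * (1 + t) * H * \<sigma> u"
      by (simp add: \<beta> linear_diff[OF lin(1)] linear_diff[OF lin(2)] la X algebra_simps)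
    then show ?thesis by (simp add: s)
  qed
  \<comment> \<open>The relation defining X, evaluated on X itself: its left side is 0 by
    antisymmetry, so dH(X) = R(H) \<eta>(X).\<close>
  have hX: "h X = - r * H"
    using X(4)[of X] X(1) alternating_bilinearD(4)[OF alt(1), of X] by simp
  have oX: "?o X w = (1 + t) * h w + t * r * H * \<sigma> w" if "\<eta> w = 0" for w
    using that by (simp add: d\<beta> X hX algebra_simps)
  have oXX: "?o X X = 0"
    using skew[of X X] by linarith
  have oL: "?o (?L u) (?L w) = \<omega> u w - t * H * \<tau> u w" if "\<eta> u = 0" "\<eta> w = 0" for u w
  proof -
    have "?o (?L u) (?L w) = ?o u w - s * \<sigma> w * ?o u X - s * \<sigma> u * ?o X w + s * \<sigma> u * (s * \<sigma> w) * ?o X X"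
      unfolding linear_diff[OF l1] linear_diff[OF l2] linear_cmul[OF l1] linear_cmul[OF l2]
      by (simp add: algebra_simps)
    also have "?o u X = - ((1 + t) * h u + t * r * H * \<sigma> u)"
      using skew[of u X] oX[OF that(1)] by linarith
    also have "?o X w = (1 + t) * h w + t * r * H * \<sigma> w"
      by (rule oX[OF that(2)])
    \<comment> \<open>The terms with \<open>r\<close> are symmetric in \<open>u\<close> and
      \<open>w\<close> and cancel. Since s (1 + t) = t, what is left then offsets the part dH \<and>
      \<sigma> of t d\<beta>.\<close>
    also have "?o u w - s * \<sigma> w * (- ((1 + t) * h u + t * r * H * \<sigma> u))
        - s * \<sigma> u * ((1 + t) * h w + t * r * H * \<sigma> w) + s * \<sigma> u * (s * \<sigma> w) * ?o X X
      = ?o u w + s * (1 + t) * (h u * \<sigma> w - h w * \<sigma> u)"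
      unfolding oXX by (simp add: algebra_simps)
    also have "\<dots> = \<omega> u w - t * H * \<tau> u w"
      unfolding s d\<beta> by (simp add: algebra_simps)
    finally show ?thesis .
  qed
  have "alternating_form DIM('e) (wedge_top n ?e ?o)"
    unfolding dim by (rule wedge_top_alternating[OF l\<eta> l1 l2])
  \<comment> \<open>The factor 1 + t of \<P> arises here, as the inverse of the determinant 1 -
    s.\<close>
  from alternating_form_rank_one[OF this lin(2) X(2), of v s]
  have "wedge_top n ?e ?o v = (1 + t) * wedge_top n ?e ?o (\<lambda>i. ?L (v i))"
    using t by (simp add: s(1))
  also have "wedge_top n ?e ?o (\<lambda>i. ?L (v i)) = ?e (?L (v 0)) * wedge_power2 (form2 ?o) n (\<lambda>i. ?L (v (Suc i)))"
    by (rule wedge_top_adapted[OF l1 l2]) (simp only: eL v)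
  also have "wedge_power2 (form2 ?o) n (\<lambda>i. ?L (v (Suc i)))
      = wedge_power2 (form2 (\<lambda>u w. \<omega> u w - t * H * \<tau> u w)) n (\<lambda>i. v (Suc i))"
    by (rule wedge_power2_cong) (simp only: oL v)
  finally show ?thesis
    unfolding eL .
qed

text \<open>All top forms are evaluated on one frame, \<open>R\<close> followed by a basis of ker
  \<eta>, where they become powers of 2-forms on ker \<eta>. After squaring, Gram determinants take
  over, and their quotient is the determinant of id + t N on ker \<eta>.\<close>

lemma pencil_square:
  fixes \<eta> \<sigma> h \<beta> :: "'e::euclidean_space \<Rightarrow> real"
  assumes dim: "DIM('e) = 2 * n + 1"
    and lin: "linear \<eta>" "linear \<sigma>" "linear h" "linear N"
    and alt: "alternating_bilinear \<omega>" "alternating_bilinear \<tau>"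
    and X: "\<eta> X = - H" "\<sigma> X = 1" "\<And>w. \<tau> X w = 0" "\<And>w. \<omega> X w = h w - r * \<eta> w"
    and \<beta>: "\<And>u. \<beta> u = - (H * \<sigma> u)"
    and d\<beta>: "\<And>u w. d\<beta> u w = - (h u * \<sigma> w - h w * \<sigma> u) - H * \<tau> u w"
    and contact: "wedge_top n \<eta> \<omega> v0 \<noteq> 0"
    and R: "\<eta> R = 1"
    and N: "\<And>y. \<eta> (N y) = 0" "\<And>y z. \<eta> z = 0 \<Longrightarrow> \<omega> (N y) z = - H * \<tau> y z"
    and P: "\<And>v. wedge_top n (\<lambda>u. \<eta> u + t * \<beta> u) (\<lambda>u w. \<omega> u w + t * d\<beta> u w) v = P * wedge_top n \<eta> \<omega> v"
    and t: "t \<noteq> - 1"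
  shows "P\<^sup>2 = (1 + t)\<^sup>2 * det_on {v. \<eta> v = 0} (\<lambda>v. v + t *\<^sub>R N v)"
proof -
  let ?D = "{v. \<eta> v = 0}"
  let ?b = "(!) (basis_list ?D)"
  let ?\<omega>' = "\<lambda>u w. \<omega> u w - t * H * \<tau> u w"
  let ?f = "\<lambda>v. v + t *\<^sub>R N v"
  define c where "c = case_nat R ?b"
  have sub: "subspace ?D" by (rule linear_subspace_kernel[OF lin(1)])
  have frc: "frame (Suc (dim ?D)) c UNIV"
    unfolding c_def using frame_extend[OF frame_basis_list[OF sub] lin(1), of R] R
    by (simp add: length_basis_list[OF sub])
  then have dimD: "dim ?D = 2 * n"
    using frame_dim[OF frc] dim by simp
  have fr: "frame (2 * n) ?b ?D"
    using frame_basis_list[OF sub] by (simp add: length_basis_list[OF sub] dimD)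
  have c: "c 0 = R" "\<And>i. c (Suc i) = ?b i" by (simp_all add: c_def)
  have ker: "\<eta> (c (Suc i)) = 0" if "i < 2 * n" for i
    using frame_mem[OF fr that] by (simp add: c)
  note l1 = alternating_bilinearD(1)[OF alt(1)] and l2 = alternating_bilinearD(2)[OF alt(1)]
  let ?W = "\<lambda>\<omega>. wedge_power2 (form2 \<omega>) n ?b"
  have W: "wedge_top n \<eta> \<omega> c = ?W \<omega>"
    using wedge_top_adapted[where \<omega> = \<omega> and \<eta> = \<eta> and v = c and n = n, OF l1 l2 ker] R by (simp add: c)
  have "alternating_form (2 * n + 1) (wedge_top n \<eta> \<omega>)"
    by (rule wedge_top_alternating[OF lin(1) l1 l2])
  \<comment> \<open>The contact condition only provides some sequence \<open>v0\<close>. The value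
    there is a multiple of the value on \<open>c\<close>, which is therefore nonzero.\<close>
  moreover obtain d where d: "\<forall>f (L :: 'e \<Rightarrow> 'e). alternating_form (Suc (2 * n)) f \<longrightarrow> linear L \<longrightarrow>
      f (\<lambda>i. L (v0 i)) = d * f (\<lambda>i. L (c i))"
    using alternating_form_frame[OF frc, of v0] unfolding dimD by (elim exE)
  ultimately have "wedge_top n \<eta> \<omega> v0 = d * wedge_top n \<eta> \<omega> c"
    using d[rule_format, OF _ linear_ident] by simp
  then have W0: "?W \<omega> \<noteq> 0"
    using contact W by auto
  have "P * ?W \<omega> = (1 + t) * ?W ?\<omega>'"
    using wedge_top_pencil[where v = c, OF dim lin(1-3) alt X \<beta> d\<beta> t ker] R P[of c] W
    by (simp add: c)
  then have sq: "P\<^sup>2 * (?W \<omega>)\<^sup>2 = (1 + t)\<^sup>2 * (?W ?\<omega>')\<^sup>2"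
    by (simp only: power_mult_distrib[symmetric])
  have nondeg: "u = 0" if "u \<in> ?D" "\<And>w. w \<in> ?D \<Longrightarrow> \<omega> u w = 0" for u
    using wedge_power2_degenerate(1)[OF fr alt(1) that(1) _ that(2)] W0 by blast
  have g0: "Determinant.det (gram (2 * n) \<omega> ?b) \<noteq> 0"
    by (rule wedge_power2_square_nondegenerate(2)[OF fr alt(1) nondeg])
  have alt': "alternating_bilinear ?\<omega>'"
    unfolding alternating_bilinear_def
  proof (intro conjI allI)
    show "linear (?\<omega>' u)" for u
      using alternating_bilinearD(1)[OF alt(1), of u] alternating_bilinearD(1)[OF alt(2), of u]
      by (auto simp: linear_iff algebra_simps)
    show "?\<omega>' u w = - ?\<omega>' w u" for u w
      using alternating_bilinearD(3)[OF alt(1), of u w] alternating_bilinearD(3)[OF alt(2), of u w]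
      by simp
  qed
  have "gram (2 * n) ?\<omega>' ?b = gram (2 * n) (\<lambda>u w. \<omega> (?f u) w) ?b"
    unfolding gram_def
  proof (intro cong_mat refl)
    fix i j assume ij: "i < 2 * n" "j < 2 * n"
    have "\<omega> (?f (?b i)) (?b j) = \<omega> (?b i) (?b j) + t * \<omega> (N (?b i)) (?b j)"
      by (simp add: linear_add[OF l2] linear_cmul[OF l2])
    also have "\<omega> (N (?b i)) (?b j) = - H * \<tau> (?b i) (?b j)"
      using N(2) frame_mem[OF fr ij(2)] by simp
    finally show "(case (i, j) of (i, j) \<Rightarrow> ?\<omega>' (?b i) (?b j)) = (case (i, j) of (i, j) \<Rightarrow> \<omega> (?f (?b i)) (?b j))"
      by (simp add: algebra_simps)
  qed
  moreover have "?f ` ?D \<subseteq> ?D"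
    using N(1) by (auto simp: linear_add[OF lin(1)] linear_cmul[OF lin(1)])
  ultimately have g': "Determinant.det (gram (2 * n) ?\<omega>' ?b)
      = det_on ?D ?f * Determinant.det (gram (2 * n) \<omega> ?b)"
    using det_gram_compose[OF sub, of ?f \<omega>] l2 dimD by simp
  have "(?W ?\<omega>')\<^sup>2 * Determinant.det (gram (2 * n) \<omega> ?b) = (?W \<omega>)\<^sup>2 * Determinant.det (gram (2 * n) ?\<omega>' ?b)"
    by (rule wedge_power2_square_ratio[OF fr alt' alt(1)])
  then have "(?W ?\<omega>')\<^sup>2 = (?W \<omega>)\<^sup>2 * det_on ?D ?f"
    using g0 unfolding g' by simp
  then have "P\<^sup>2 * (?W \<omega>)\<^sup>2 = (1 + t)\<^sup>2 * det_on ?D ?f * (?W \<omega>)\<^sup>2"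
    using sq by simp
  then show ?thesis
    using W0 by simp
qed

section \<open>Traces\<close>

definition mat_trace :: "'a::comm_ring_1 mat \<Rightarrow> 'a" where
  "mat_trace A = (\<Sum>i<dim_row A. A $$ (i, i))"

text \<open>This is tr(AB) = tr(BA): both sides equal the double sum of \<phi>_i(f c_j)
  \<psi>_j(b_i). Linearity is asked of \<phi>_i after \<open>f\<close> because coordinates such as
  \<open>representation\<close> are additive on the span only. The lemma covers both restriction to
  a subspace and change of chart.\<close>

lemma trace_frames:
  fixes b :: "'i \<Rightarrow> 'e::real_vector" and c :: "'j \<Rightarrow> 'e"
  assumes b: "\<And>x. x \<in> S \<Longrightarrow> x = (\<Sum>i\<in>I. \<phi> i x *\<^sub>R b i)"
    and c: "\<And>x. x = (\<Sum>j\<in>J. \<psi> j x *\<^sub>R c j)"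
    and \<phi>: "\<And>i. linear (\<lambda>x. \<phi> i (f x))" and \<psi>: "\<And>j. linear (\<psi> j)"
    and f: "range f \<subseteq> S"
  shows "(\<Sum>j\<in>J. \<psi> j (f (c j))) = (\<Sum>i\<in>I. \<phi> i (f (b i)))"
proof -
  have "\<psi> j (f (c j)) = (\<Sum>i\<in>I. \<phi> i (f (c j)) * \<psi> j (b i))" for j
  proof -
    have "f (c j) = (\<Sum>i\<in>I. \<phi> i (f (c j)) *\<^sub>R b i)"
      using f by (intro b) auto
    then show ?thesis
      using linear_sum[OF \<psi>, of j "\<lambda>i. \<phi> i (f (c j)) *\<^sub>R b i" I] by (simp add: linear_cmul[OF \<psi>])
  qed
  then have "(\<Sum>j\<in>J. \<psi> j (f (c j))) = (\<Sum>i\<in>I. \<Sum>j\<in>J. \<phi> i (f (c j)) * \<psi> j (b i))"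
    by (simp add: sum.swap[of _ J I])
  also have "\<dots> = (\<Sum>i\<in>I. \<phi> i (f (b i)))"
  proof (rule sum.cong[OF refl])
    fix i
    have "\<phi> i (f (b i)) = \<phi> i (f (\<Sum>j\<in>J. \<psi> j (b i) *\<^sub>R c j))"
      using c[of "b i"] by simp
    then show "(\<Sum>j\<in>J. \<phi> i (f (c j)) * \<psi> j (b i)) = \<phi> i (f (b i))"
      by (simp add: linear_sum[OF \<phi>] linear_cmul[OF \<phi>] mult.commute)
  qed
  finally show ?thesis .
qed

lemma representation_linear_on:
  assumes "subspace S" "linear f" "range f \<subseteq> S"
  shows "linear (\<lambda>x. representation (set (basis_list S)) (f x) b)"
proof -
  note bs = basis_list[OF assms(1)]
  have "f x \<in> span (set (basis_list S))" for x
    using assms(3) bs(3) by auto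
  then show ?thesis
    using bs(2) by (intro linearI)
      (simp_all add: linear_add[OF assms(2)] linear_cmul[OF assms(2)] representation_add representation_scale)
qed

lemma trace_on_sum:
  assumes "subspace S"
  shows "trace_on S f = (\<Sum>i<dim S. representation (set (basis_list S)) (f (basis_list S ! i)) (basis_list S ! i))"
  by (simp add: trace_on_def matrix_on_def Let_def length_basis_list[OF assms])

text \<open>The right side does not mention \<open>S\<close>, so the trace is the same over every
  subspace containing the range. Applied to powers of N, this identifies the traces over the tangent
  space with those of A.\<close>

lemma trace_on_subspace:
  assumes S: "subspace S" and f: "linear f" "range f \<subseteq> S"
  shows "trace_on S f = (\<Sum>b\<in>Basis. inner (f b) b)"
  unfolding trace_on_sum[OF S]
  by (rule trace_frames[where \<psi> = "\<lambda>b x. inner x b" and c = "\<lambda>b. b", symmetric])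
    (use representation_expand[OF S] representation_linear_on[OF S f] f(2)
      in \<open>auto simp: euclidean_representation intro!: bounded_linear.linear bounded_linear_inner_left\<close>)

lemma mat_trace_matrix_on: "mat_trace (matrix_on S f) = trace_on S f"
  by (simp add: mat_trace_def trace_on_def)

lemma matrix_on_compose:
  assumes S: "subspace S" and f: "linear f" "f ` S \<subseteq> S" and g: "g ` S \<subseteq> S"
  shows "matrix_on S (f \<circ> g) = matrix_on S f * matrix_on S g"
proof (rule eq_matI)
  let ?bs = "basis_list S"
  note bs = basis_list[OF S]
  note dims = matrix_on_carrier[OF S, of f] matrix_on_carrier[OF S, of g] matrix_on_carrier[OF S, of "f \<circ> g"]
  fix i j
  assume "i < dim_row (matrix_on S f * matrix_on S g)" "j < dim_col (matrix_on S f * matrix_on S g)"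
  then have ij: "i < dim S" "j < dim S" using dims by auto
  have mem: "?bs ! k \<in> S" if "k < dim S" for k
    using frame_mem[OF frame_basis_list[OF S]] that by (simp add: length_basis_list[OF S])
  have rep: "representation (set ?bs) (f (?bs ! k)) (?bs ! i) = matrix_on S f $$ (i, k)" if "k < dim S" for k
    using that ij by (simp add: matrix_on_def length_basis_list[OF S] Let_def)
  have "matrix_on S (f \<circ> g) $$ (i, j) = representation (set ?bs) (f (g (?bs ! j))) (?bs ! i)"
    using ij by (simp add: matrix_on_def length_basis_list[OF S] Let_def)
  also have "f (g (?bs ! j)) = (\<Sum>k<dim S. (matrix_on S g $$ (k, j)) *\<^sub>R f (?bs ! k))"
    using matrix_on_expand[OF S g ij(2)] by (simp add: linear_sum[OF f(1)] linear_cmul[OF f(1)])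
  also have "representation (set ?bs) \<dots> (?bs ! i)
      = (\<Sum>k<dim S. representation (set ?bs) ((matrix_on S g $$ (k, j)) *\<^sub>R f (?bs ! k)) (?bs ! i))"
    using bs mem f(2) S by (subst representation_sum) (auto intro!: subspace_scale)
  also have "\<dots> = (\<Sum>k<dim S. matrix_on S f $$ (i, k) * matrix_on S g $$ (k, j))"
    using bs mem f(2) by (intro sum.cong refl) (auto simp: representation_scale rep image_subset_iff)
  also have "\<dots> = (matrix_on S f * matrix_on S g) $$ (i, j)"
    using dims ij by (auto simp: scalar_prod_def atLeast0LessThan)
  finally show "matrix_on S (f \<circ> g) $$ (i, j) = (matrix_on S f * matrix_on S g) $$ (i, j)" .
qed (use matrix_on_carrier[OF S, of f] matrix_on_carrier[OF S, of g] matrix_on_carrier[OF S, of "f \<circ> g"] in auto)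

lemma representation_basis_list:
  assumes S: "subspace S" and ij: "i < dim S" "j < dim S"
  shows "representation (set (basis_list S)) (basis_list S ! j) (basis_list S ! i) = (if i = j then 1 else 0)"
  using basis_list[OF S] ij
  by (auto simp: representation_basis length_basis_list[OF S] nth_eq_iff_index_eq)

lemma matrix_on_power:
  assumes S: "subspace S" and f: "linear f" "f ` S \<subseteq> S"
  shows "matrix_on S (f ^^ k) = matrix_on S f ^\<^sub>m k"
proof (induction k)
  case 0
  have "matrix_on S id = 1\<^sub>m (dim S)"
    by (rule eq_matI)
      (auto simp: matrix_on_def Let_def length_basis_list[OF S] representation_basis_list[OF S])
  then show ?case
    using matrix_on_carrier[OF S, of f] by (simp add: id_def)
next
  case (Suc k)
  have "(f ^^ k) ` S \<subseteq> S"
    using f(2) by (induction k) auto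
  moreover have "linear (f ^^ k)"
    using f(1) by (induction k) (auto simp: linear_compose[unfolded o_def] o_def linear_ident id_def)
  ultimately have "matrix_on S (f ^^ k \<circ> f) = matrix_on S (f ^^ k) * matrix_on S f"
    using matrix_on_compose[OF S _ _ f(2)] by blast
  then show ?case
    using Suc by (simp add: funpow_swap1 o_def fun_eq_iff funpow_Suc_right del: funpow.simps)
qed

lemma matrix_on_shift:
  assumes S: "subspace S" and f: "f ` S \<subseteq> S"
  shows "matrix_on S (\<lambda>v. v + t *\<^sub>R f v) = 1\<^sub>m (dim S) + t \<cdot>\<^sub>m matrix_on S f"
proof (rule eq_matI)
  let ?bs = "basis_list S"
  note bs = basis_list[OF S]
  fix i j
  assume "i < dim_row (1\<^sub>m (dim S) + t \<cdot>\<^sub>m matrix_on S f)" "j < dim_col (1\<^sub>m (dim S) + t \<cdot>\<^sub>m matrix_on S f)"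
  then have ij: "i < dim S" "j < dim S" using matrix_on_carrier[OF S, of f] by auto
  have "?bs ! j \<in> S"
    using frame_mem[OF frame_basis_list[OF S]] ij by (simp add: length_basis_list[OF S])
  then have "representation (set ?bs) (?bs ! j + t *\<^sub>R f (?bs ! j)) (?bs ! i)
    = (if i = j then 1 else 0) + t * representation (set ?bs) (f (?bs ! j)) (?bs ! i)"
    using bs f S representation_basis_list[OF S ij]
    by (simp add: representation_add representation_scale subspace_scale image_subset_iff)
  then show "matrix_on S (\<lambda>v. v + t *\<^sub>R f v) $$ (i, j) = (1\<^sub>m (dim S) + t \<cdot>\<^sub>m matrix_on S f) $$ (i, j)"
    using ij matrix_on_carrier[OF S, of f]
    by (simp add: matrix_on_def Let_def length_basis_list[OF S])
qed (use matrix_on_carrier[OF S, of f] matrix_on_carrier[OF S, of "\<lambda>v. v + t *\<^sub>R f v"] in auto)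

section \<open>Newton's identities for a determinant that is a square\<close>

lemma upper_triangular_mult:
  assumes A: "A \<in> carrier_mat m m" "upper_triangular A" and B: "B \<in> carrier_mat m m" "upper_triangular B"
  shows "upper_triangular (A * B)" "i < m \<Longrightarrow> (A * B) $$ (i, i) = A $$ (i, i) * B $$ (i, i)"
proof -
  have entry: "(A * B) $$ (i, j) = (\<Sum>k<m. if i \<le> k \<and> k \<le> j then A $$ (i, k) * B $$ (k, j) else 0)"
    if "i < m" "j < m" for i j
  proof -
    have "(A * B) $$ (i, j) = (\<Sum>k<m. A $$ (i, k) * B $$ (k, j))"
      using that A B by (auto simp: scalar_prod_def atLeast0LessThan)
    also have "\<dots> = (\<Sum>k<m. if i \<le> k \<and> k \<le> j then A $$ (i, k) * B $$ (k, j) else 0)"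
      using that A B by (intro sum.cong refl) (auto simp: not_le upper_triangularD)
    finally show ?thesis .
  qed
  show "upper_triangular (A * B)"
    unfolding upper_triangular_def
  proof (intro allI impI)
    fix i j assume ij: "i < dim_row (A * B)" "j < i"
    then show "(A * B) $$ (i, j) = 0"
      using A by (subst entry) (auto intro!: sum.neutral)
  qed
  show "(A * B) $$ (i, i) = A $$ (i, i) * B $$ (i, i)" if "i < m"
  proof -
    have "(A * B) $$ (i, i) = (\<Sum>k<m. if k = i then A $$ (i, i) * B $$ (i, i) else 0)"
      unfolding entry[OF that that] by (intro sum.cong refl) auto
    then show ?thesis using that by simp
  qed
qed

lemma upper_triangular_pow:
  fixes A :: "'a::comm_ring_1 mat"
  assumes A: "A \<in> carrier_mat m m" "upper_triangular A"
  shows "upper_triangular (A ^\<^sub>m k) \<and> (\<forall>i<m. (A ^\<^sub>m k) $$ (i, i) = A $$ (i, i) ^ k)"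
proof (induction k)
  case 0
  then show ?case using A by auto
next
  case (Suc k)
  have "A ^\<^sub>m k \<in> carrier_mat m m" using A by auto
  with Suc show ?case
    using upper_triangular_mult[of "A ^\<^sub>m k" m A] A by auto
qed

lemma mat_trace_mult_commute:
  assumes "A \<in> carrier_mat m m" "B \<in> carrier_mat m m"
  shows "mat_trace (A * B) = mat_trace (B * A)"
proof -
  have "mat_trace (A * B) = (\<Sum>i<m. \<Sum>k<m. A $$ (i, k) * B $$ (k, i))"
    using assms by (auto simp: mat_trace_def scalar_prod_def atLeast0LessThan)
  also have "\<dots> = (\<Sum>k<m. \<Sum>i<m. A $$ (i, k) * B $$ (k, i))"
    by (rule sum.swap)
  also have "\<dots> = mat_trace (B * A)"
    using assms by (auto simp: mat_trace_def scalar_prod_def atLeast0LessThan mult.commute)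
  finally show ?thesis .
qed

text \<open>Schur triangularisation: the list is the diagonal of the triangular form, that is, the
  eigenvalues with multiplicity. One list governs the traces of all powers and the determinant at
  once, which is what Newton's identities relate.\<close>

lemma complex_eigenvalue_list:
  fixes A :: "complex mat"
  assumes A: "A \<in> carrier_mat m m"
  shows "\<exists>ls. (\<forall>k. mat_trace (A ^\<^sub>m k) = (\<Sum>l\<leftarrow>ls. l ^ k)) \<and>
    (\<forall>t. Determinant.det (1\<^sub>m m + t \<cdot>\<^sub>m A) = poly (\<Prod>l\<leftarrow>ls. [:1, l:]) t)"
proof -
  obtain es where "char_poly A = (\<Prod>a\<leftarrow>es. [:- a, 1:])"
    using char_poly_factorized[OF A] by blast
  then obtain B where B: "B \<in> carrier_mat m m" "upper_triangular B" "similar_mat A B"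
    using schur_decomposition_exists[OF A] by blast
  then obtain P Q where wit: "similar_mat_wit A B P Q"
    by (auto simp: similar_mat_def)
  note w = similar_mat_witD2[OF A wit]
  define ls where "ls = map (\<lambda>i. B $$ (i, i)) [0..<m]"
  have "mat_trace (A ^\<^sub>m k) = (\<Sum>l\<leftarrow>ls. l ^ k)" for k
  proof -
    have Bk: "B ^\<^sub>m k \<in> carrier_mat m m" using B by auto
    have "mat_trace (A ^\<^sub>m k) = mat_trace (P * B ^\<^sub>m k * Q)"
      using similar_mat_wit_pow_id[OF wit] by simp
    also have "\<dots> = mat_trace (Q * (P * B ^\<^sub>m k))"
      using w Bk by (intro mat_trace_mult_commute) auto
    also have "Q * (P * B ^\<^sub>m k) = B ^\<^sub>m k"
      using assoc_mult_mat[OF w(7,6) Bk] w(2) left_mult_one_mat[OF Bk] by simp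
    also have "mat_trace (B ^\<^sub>m k) = (\<Sum>i<m. B $$ (i, i) ^ k)"
      using B(1) upper_triangular_pow[OF B(1,2), of k] by (simp add: mat_trace_def)
    finally show ?thesis
      by (simp add: ls_def interv_sum_list_conv_sum_set_nat atLeast0LessThan o_def)
  qed
  moreover have "Determinant.det (1\<^sub>m m + t \<cdot>\<^sub>m A) = poly (\<Prod>l\<leftarrow>ls. [:1, l:]) t" for t
  proof -
    have "1\<^sub>m m + t \<cdot>\<^sub>m A = P * (1\<^sub>m m + t \<cdot>\<^sub>m B) * Q"
    proof -
      have tB: "t \<cdot>\<^sub>m B \<in> carrier_mat m m" and PB: "P * B \<in> carrier_mat m m"
        using w by auto
      have "P * (1\<^sub>m m + t \<cdot>\<^sub>m B) = P + t \<cdot>\<^sub>m (P * B)"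
        using mult_add_distrib_mat[OF w(6) one_carrier_mat tB] right_mult_one_mat[OF w(6)]
          mult_smult_distrib[OF w(6,5)] by simp
      then have "P * (1\<^sub>m m + t \<cdot>\<^sub>m B) * Q = P * Q + t \<cdot>\<^sub>m (P * B * Q)"
        using add_mult_distrib_mat[OF w(6) smult_carrier_mat[OF PB] w(7)]
          mult_smult_assoc_mat[OF PB w(7)] by simp
      then show ?thesis
        using w(1,3) by simp
    qed
    then have "similar_mat (1\<^sub>m m + t \<cdot>\<^sub>m A) (1\<^sub>m m + t \<cdot>\<^sub>m B)"
      using w unfolding similar_mat_def similar_mat_wit_def by (intro exI[of _ P] exI[of _ Q]) (auto simp: Let_def)
    then have "Determinant.det (1\<^sub>m m + t \<cdot>\<^sub>m A) = Determinant.det (1\<^sub>m m + t \<cdot>\<^sub>m B)"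
      by (rule det_similar)
    also have "\<dots> = (\<Prod>i<m. 1 + t * B $$ (i, i))"
    proof -
      have "upper_triangular (1\<^sub>m m + t \<cdot>\<^sub>m B)"
        using B by (auto simp: upper_triangular_def)
      then have "Determinant.det (1\<^sub>m m + t \<cdot>\<^sub>m B) = prod_list (diag_mat (1\<^sub>m m + t \<cdot>\<^sub>m B))"
        using B by (intro det_upper_triangular[where n = m]) auto
      then show ?thesis
        using B by (simp add: prod_list_diag_prod atLeast0LessThan)
    qed
    also have "\<dots> = poly (\<Prod>l\<leftarrow>ls. [:1, l:]) t"
      by (simp add: ls_def poly_prod o_def atLeast0LessThan
          prod.distinct_set_conv_list[symmetric])
    finally show ?thesis .
  qed
  ultimately show ?thesis by blast
qed

text \<open>Logarithmic derivative: each factor 1 + l t contributes l / (1 + l t), here expanded as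
  the geometric series \<open>?G\<close>. As \<open>?G\<close> is pinned down by its product with 1
  + l t, no division of series occurs.\<close>

lemma fps_deriv_linear_factors:
  fixes ls :: "'a::{comm_ring_1} list"
  defines "E \<equiv> fps_of_poly (\<Prod>l\<leftarrow>ls. [:1, l:])"
  shows "fps_deriv E = E * Abs_fps (\<lambda>k. (- 1) ^ k * (\<Sum>l\<leftarrow>ls. l ^ Suc k))"
  unfolding E_def
proof (induction ls)
  case Nil
  then show ?case by (simp add: fps_eq_iff)
next
  case (Cons l ls)
  let ?E = "fps_of_poly (\<Prod>l\<leftarrow>ls. [:1, l:])"
  let ?S = "\<lambda>ls. Abs_fps (\<lambda>k. (- 1) ^ k * (\<Sum>l\<leftarrow>ls. l ^ Suc k))"
  let ?G = "Abs_fps (\<lambda>k. (- 1) ^ k * l ^ Suc k)"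
  have f: "fps_of_poly [:1, l:] = 1 + fps_const l * fps_X"
    by (simp add: fps_of_poly_pCons)
  have G: "(1 + fps_const l * fps_X) * ?G = fps_const l"
  proof (rule fps_ext)
    fix k
    show "fps_nth ((1 + fps_const l * fps_X) * ?G) k = fps_nth (fps_const l) k"
      by (cases k) (simp_all add: distrib_right mult.assoc)
  qed
  have S: "?S (l # ls) = ?G + ?S ls"
    by (simp add: fps_eq_iff algebra_simps)
  have "fps_deriv (fps_of_poly (\<Prod>l\<leftarrow>l # ls. [:1, l:])) = fps_const l * ?E + (1 + fps_const l * fps_X) * (?E * ?S ls)"
  proof -
    have "fps_of_poly (\<Prod>l\<leftarrow>l # ls. [:1, l:]) = (1 + fps_const l * fps_X) * ?E"
      by (simp only: list.map prod_list.Cons fps_of_poly_mult f)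
    moreover have "fps_deriv (1 + fps_const l * fps_X) = fps_const l"
      by simp
    ultimately show ?thesis
      by (simp only: fps_deriv_mult Cons add.commute)
  qed
  also have "\<dots> = (1 + fps_const l * fps_X) * ?E * (?G + ?S ls)"
  proof -
    have "c * e + a * (e * s) = a * e * (g + s)" if "a * g = c" for a c e g s :: "'a fps"
      by (simp add: that[symmetric] algebra_simps)
    then show ?thesis using G .
  qed
  finally show ?case
    unfolding S by (simp only: list.map prod_list.Cons fps_of_poly_mult f)
qed

lemma poly_eq_on_reals:
  assumes "finite F" "\<And>t. t \<notin> F \<Longrightarrow> poly p (complex_of_real t) = poly q (complex_of_real t)"
  shows "p = q"
proof (rule ccontr)
  assume "p \<noteq> q"
  then have "finite {x. poly (p - q) x = 0}" by (intro poly_roots_finite) simp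
  moreover have "complex_of_real ` (- F) \<subseteq> {x. poly (p - q) x = 0}" using assms(2) by auto
  ultimately have "finite (complex_of_real ` (- F))" by (rule rev_finite_subset)
  then have "finite (- F)" by (rule finite_imageD) (auto simp: inj_on_def)
  then show False using assms(1) infinite_UNIV_char_0[where 'a = real]
    by (metis Compl_partition finite_Un)
qed

lemma real_eigenvalue_list:
  fixes M :: "real mat"
  assumes M: "M \<in> carrier_mat m m"
  shows "\<exists>ls. (\<forall>k. complex_of_real (mat_trace (M ^\<^sub>m k)) = (\<Sum>l\<leftarrow>ls. l ^ k)) \<and>
    (\<forall>t. complex_of_real (Determinant.det (1\<^sub>m m + t \<cdot>\<^sub>m M)) = poly (\<Prod>l\<leftarrow>ls. [:1, l:]) (of_real t))"
proof -
  let ?A = "map_mat complex_of_real M"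
  have A: "?A \<in> carrier_mat m m" using M by simp
  have "mat_trace (?A ^\<^sub>m k) = complex_of_real (mat_trace (M ^\<^sub>m k))" for k
  proof -
    have "?A ^\<^sub>m k = map_mat complex_of_real (M ^\<^sub>m k)"
      by (rule of_real_hom.mat_hom_pow[OF M, symmetric])
    then show ?thesis
      using M pow_carrier_mat[OF M, of k] by (auto simp: mat_trace_def)
  qed
  moreover have "Determinant.det (1\<^sub>m m + of_real t \<cdot>\<^sub>m ?A) = complex_of_real (Determinant.det (1\<^sub>m m + t \<cdot>\<^sub>m M))" for t
  proof -
    have "1\<^sub>m m + of_real t \<cdot>\<^sub>m ?A = map_mat complex_of_real (1\<^sub>m m + t \<cdot>\<^sub>m M)"
      using M by (intro eq_matI) auto
    then show ?thesis by (simp add: of_real_hom.hom_det)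
  qed
  ultimately show ?thesis
    using complex_eigenvalue_list[OF A] by metis
qed

text \<open>The comparison takes place over the complex numbers, where the determinant is a product
  of linear factors and so a polynomial. Once the identity of polynomials holds, it can be evaluated
  at - 1, and the double factor 1 + t cancels.\<close>

lemma square_root_polynomial:
  fixes M :: "real mat" and P :: "real poly"
  assumes M: "M \<in> carrier_mat m m"
    and P: "\<And>t. t \<noteq> - 1 \<Longrightarrow> (poly P t)\<^sup>2 = (1 + t)\<^sup>2 * Determinant.det (1\<^sub>m m + t \<cdot>\<^sub>m M)"
  shows "\<exists>Q. P = [:1, 1:] * Q \<and> (\<forall>t. Determinant.det (1\<^sub>m m + t \<cdot>\<^sub>m M) = (poly Q t)\<^sup>2)"
proof -
  obtain ls where ls: "\<And>t. complex_of_real (Determinant.det (1\<^sub>m m + t \<cdot>\<^sub>m M)) = poly (\<Prod>l\<leftarrow>ls. [:1, l:]) (of_real t)"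
    using real_eigenvalue_list[OF M] by blast
  let ?E = "\<Prod>l\<leftarrow>ls. [:1, l:]"
  let ?c = "map_poly complex_of_real"
  have c: "poly (?c p) (of_real t) = of_real (poly p t)" for p t
    by (simp add: of_real_hom.poly_map_poly)
  have eq: "(?c P)\<^sup>2 = [:1, 1:]\<^sup>2 * ?E"
  proof (rule poly_eq_on_reals[of "{- 1}"])
    fix t :: real assume "t \<notin> {- 1}"
    then have "complex_of_real ((poly P t)\<^sup>2) = of_real ((1 + t)\<^sup>2 * Determinant.det (1\<^sub>m m + t \<cdot>\<^sub>m M))"
      using P by simp
    then show "poly ((?c P)\<^sup>2) (of_real t) = poly ([:1, 1:]\<^sup>2 * ?E) (of_real t)"
      by (simp add: c ls poly_power)
  qed simp
  have "poly ((?c P)\<^sup>2) (of_real (- 1)) = 0"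
    unfolding eq by (simp add: poly_power)
  then have "poly P (- 1) = 0"
    by (simp add: poly_power c del: of_real_minus)
  then obtain Q where Q: "P = [:1, 1:] * Q"
    by (auto simp: poly_eq_0_iff_dvd)
  have "?c P = [:1, 1:] * ?c Q"
    by (rule poly_eq_on_reals[of "{}"]) (simp_all only: c Q poly_mult of_real_mult, simp_all)
  with eq have "[:1, 1:]\<^sup>2 * (?c Q)\<^sup>2 = [:1, 1:]\<^sup>2 * ?E"
    by (simp only: power_mult_distrib)
  then have "(?c Q)\<^sup>2 = ?E" by simp
  then have "complex_of_real (Determinant.det (1\<^sub>m m + t \<cdot>\<^sub>m M)) = of_real ((poly Q t)\<^sup>2)" for t
    unfolding ls by (metis c of_real_power poly_power)
  then show ?thesis
    using Q of_real_eq_iff by blast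
qed

text \<open>If E = F^2 and E' = E S, then 2 F' = F S after cancelling F. With S the signed
  generating series of the traces, these are Newton's identities; the 2 on the left is the reason
  for half traces.\<close>

lemma newton_identities_square:
  fixes M :: "real mat" and Q :: "real poly"
  assumes M: "M \<in> carrier_mat m m" and Q: "\<And>t. Determinant.det (1\<^sub>m m + t \<cdot>\<^sub>m M) = (poly Q t)\<^sup>2"
    and k: "k \<ge> 1"
  shows "2 * real k * coeff Q k = (\<Sum>i = 1..k. (- 1) ^ (i + 1) * coeff Q (k - i) * mat_trace (M ^\<^sub>m i))"
proof -
  obtain ls where tr: "\<And>k. complex_of_real (mat_trace (M ^\<^sub>m k)) = (\<Sum>l\<leftarrow>ls. l ^ k)"
    and ls: "\<And>t. complex_of_real (Determinant.det (1\<^sub>m m + t \<cdot>\<^sub>m M)) = poly (\<Prod>l\<leftarrow>ls. [:1, l:]) (of_real t)"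
    using real_eigenvalue_list[OF M] by blast
  let ?c = "map_poly complex_of_real"
  have "(?c Q)\<^sup>2 = (\<Prod>l\<leftarrow>ls. [:1, l:])"
    by (rule poly_eq_on_reals[of "{}"]) (simp_all add: ls[symmetric] Q poly_power of_real_hom.poly_map_poly)
  then have E: "fps_of_poly (\<Prod>l\<leftarrow>ls. [:1, l:]) = (fps_of_poly (?c Q))\<^sup>2"
    by (metis fps_of_poly_power)
  let ?F = "fps_of_poly (?c Q)" and ?S = "Abs_fps (\<lambda>k. (- 1) ^ k * (\<Sum>l\<leftarrow>ls. l ^ Suc k))"
  \<comment> \<open>Licenses the cancellation: each linear factor is nonzero, having constant term
    1.\<close>
  have "?F \<noteq> 0"
  proof
    assume "?F = 0"
    then have "?c Q = 0" by (metis fps_of_poly_0 fps_of_poly_eq_iff)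
    then have "(\<Prod>l\<leftarrow>ls. [:1, l:]) = 0" using \<open>(?c Q)\<^sup>2 = (\<Prod>l\<leftarrow>ls. [:1, l:])\<close> by simp
    then show False by (auto simp: prod_list_zero_iff)
  qed
  moreover have "?F * (2 * fps_deriv ?F) = ?F * (?F * ?S)"
    using fps_deriv_linear_factors[of ls] unfolding E by (simp add: power2_eq_square algebra_simps)
  ultimately have D: "2 * fps_deriv ?F = ?F * ?S" by simp
  \<comment> \<open>Differentiation lowers the index by one and supplies the factor
    \<open>k\<close>, so identity \<open>k\<close> sits at coefficient \<open>k - 1\<close>.\<close>
  obtain j where j: "k = Suc j" using k by (cases k) auto
  have "complex_of_real (2 * real k * coeff Q k) = fps_nth (2 * fps_deriv ?F) j"
    by (simp add: j fps_numeral_fps_const algebra_simps coeff_map_poly)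
  also have "\<dots> = (\<Sum>i = 0..j. fps_nth ?F i * fps_nth ?S (j - i))"
    unfolding D by (rule fps_mult_nth)
  also have "\<dots> = (\<Sum>i = 0..j. of_real (coeff Q i * (- 1) ^ (j - i) * mat_trace (M ^\<^sub>m Suc (j - i))))"
    by (intro sum.cong refl) (simp add: tr coeff_map_poly del: pow_mat.simps power_Suc)
  also have "\<dots> = (\<Sum>i = 1..k. of_real ((- 1) ^ (i + 1) * coeff Q (k - i) * mat_trace (M ^\<^sub>m i)))"
    by (rule sum.reindex_bij_witness[where i = "\<lambda>i. k - i" and j = "\<lambda>i. k - i"])
      (auto simp: j Suc_diff_le)
  finally have "complex_of_real (2 * real k * coeff Q k)
    = of_real (\<Sum>i = 1..k. (- 1) ^ (i + 1) * coeff Q (k - i) * mat_trace (M ^\<^sub>m i))"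
    by simp
  then show ?thesis using of_real_eq_iff by blast
qed

text \<open>The term i = k of the k-th identity has coefficient e 0 = 1, so the identity can be
  solved for \<open>tr k\<close>; this works for every k, the coefficients beyond \<open>n\<close>
  being 0. Solved for \<open>e j\<close> instead, it involves the first j traces only, which the
  list holds when j is at most \<open>n\<close>.\<close>

lemma newton_lists:
  fixes e tr :: "nat \<Rightarrow> real"
  assumes e0: "e 0 = 1" and en: "\<And>j. j > n \<Longrightarrow> e j = 0"
    and newton: "\<And>k. k \<ge> 1 \<Longrightarrow> 2 * real k * e k = (\<Sum>i = 1..k. (- 1) ^ (i + 1) * e (k - i) * tr i)"
  shows "k \<ge> 1 \<Longrightarrow> tr k = trace_from_coeffs (map e [1..<n + 1]) k"
    and "j \<le> n \<Longrightarrow> e j = coeff_from_traces (map tr [1..<n + 1]) j"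
proof -
  have c: "coeff_of_list (map e [1..<n + 1]) j = e j" for j
    using e0 en by (auto simp: coeff_of_list_def simp del: upt_Suc)
  show "tr k = trace_from_coeffs (map e [1..<n + 1]) k" if "k \<ge> 1"
    using that
  proof (induction k rule: less_induct)
    case (less k)
    have "{1..k} = insert k {1..<k}" using less.prems by auto
    then have "(- 1) ^ (k + 1) * tr k = 2 * real k * e k - (\<Sum>i = 1..<k. (- 1) ^ (i + 1) * e (k - i) * tr i)"
      using newton[OF less.prems] e0 by simp
    then have "tr k = (- 1) ^ (k + 1) * (2 * real k * e k - (\<Sum>i = 1..<k. (- 1) ^ (i + 1) * e (k - i) * tr i))"
      by (metis left_minus_one_mult_self)
    moreover have "(\<Sum>i = 1..<k. (- 1) ^ (i + 1) * e (k - i) * tr i)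
      = (\<Sum>i = 1..<k. (- 1) ^ (i + 1) * e (k - i) * trace_from_coeffs (map e [1..<n + 1]) i)"
      using less.IH by (intro sum.cong refl) auto
    ultimately show ?case
      by (subst trace_from_coeffs.simps) (simp only: c)
  qed
  show "e j = coeff_from_traces (map tr [1..<n + 1]) j" if "j \<le> n"
    using that
  proof (induction j rule: less_induct)
    case (less j)
    show ?case
    proof (cases "j = 0")
      case True
      then show ?thesis using e0 by (simp add: coeff_from_traces.simps)
    next
      case False
      have "(\<Sum>i = 1..j. (- 1) ^ (i + 1) * e (j - i) * tr i)
        = (\<Sum>i = 1..j. (- 1) ^ (i + 1) * coeff_from_traces (map tr [1..<n + 1]) (j - i) * map tr [1..<n + 1] ! (i - 1))"
        using less by (intro sum.cong refl) (auto simp del: upt_Suc)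
      then show ?thesis
        using False newton[of j] by (subst coeff_from_traces.simps) (simp add: field_simps del: upt_Suc)
    qed
  qed
qed

text \<open>Turns the determinant identity at one point into coefficients. Extending them by 1 at
  index 0 and by 0 beyond \<open>n\<close> gives the recursion for \<open>C\<close> and Newton's
  identities a uniform form.\<close>

lemma square_root_coefficients:
  fixes \<eta> :: "'e::euclidean_space \<Rightarrow> real" and C :: "nat \<Rightarrow> real"
  assumes lin: "linear \<eta>" "linear N" and N: "\<And>y. \<eta> (N y) = 0"
    and P: "\<And>t. t \<noteq> - 1 \<Longrightarrow> (1 + (\<Sum>j = 1..n + 1. C j * t ^ j))\<^sup>2
      = (1 + t)\<^sup>2 * det_on {v. \<eta> v = 0} (\<lambda>v. v + t *\<^sub>R N v)"
  shows "\<exists>q. q 0 = 1 \<and> (\<forall>j>n. q j = 0) \<and> (\<forall>j\<in>{1..n + 1}. C j = q j + q (j - 1)) \<and>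
    (\<forall>t. 1 + (\<Sum>j = 1..n + 1. C j * t ^ j) = (1 + t) * (1 + (\<Sum>j = 1..n. q j * t ^ j))) \<and>
    (\<forall>t. det_on {v. \<eta> v = 0} (\<lambda>v. v + t *\<^sub>R N v) = (1 + (\<Sum>j = 1..n. q j * t ^ j))\<^sup>2) \<and>
    (\<forall>k\<ge>1. 2 * real k * q k = (\<Sum>i = 1..k. (- 1) ^ (i + 1) * q (k - i) * trace_on UNIV (N ^^ i)))"
proof -
  let ?D = "{v. \<eta> v = 0}"
  define M where "M = matrix_on ?D N"
  define m where "m = dim ?D"
  have sub: "subspace ?D" by (rule linear_subspace_kernel[OF lin(1)])
  have ND: "N ` ?D \<subseteq> ?D" using N by auto
  have M: "M \<in> carrier_mat m m" unfolding M_def m_def by (rule matrix_on_carrier[OF sub])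
  have det: "det_on ?D (\<lambda>v. v + t *\<^sub>R N v) = Determinant.det (1\<^sub>m m + t \<cdot>\<^sub>m M)" for t
    unfolding det_on_def M_def m_def matrix_on_shift[OF sub ND] ..
  \<comment> \<open>For k = 0 the map is the identity and the two traces would be the dimensions of
    \<open>?D\<close> and of the whole space; from k = 1 on the range lies in
    \<open>?D\<close>.\<close>
  have tr: "trace_on UNIV (N ^^ k) = mat_trace (M ^\<^sub>m k)" if "k \<ge> 1" for k
  proof -
    have Nk: "linear (N ^^ k)"
      using lin(2) by (induction k) (auto simp: linear_compose[unfolded o_def] o_def linear_ident id_def)
    have "range (N ^^ k) \<subseteq> ?D"
      using that N by (cases k) auto
    then have "trace_on ?D (N ^^ k) = trace_on UNIV (N ^^ k)"
      using trace_on_subspace[OF sub Nk] trace_on_subspace[OF subspace_UNIV Nk] by simp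
    then show ?thesis
      by (simp add: M_def mat_trace_matrix_on flip: matrix_on_power[OF sub lin(2) ND])
  qed
  define P where "P = 1 + (\<Sum>j = 1..n + 1. monom (C j) j)"
  have polyP: "poly P t = 1 + (\<Sum>j = 1..n + 1. C j * t ^ j)" for t
    by (simp add: P_def poly_sum poly_monom)
  have coeffP: "coeff P j = C j" if "j \<in> {1..n + 1}" for j
    using that by (simp add: P_def coeff_sum coeff_1 sum.delta)
  have degP: "degree P \<le> n + 1"
    unfolding P_def
    by (intro degree_add_le degree_sum_le) (auto intro: order_trans[OF degree_monom_le])
  obtain Q where Q: "P = [:1, 1:] * Q" "\<And>t. Determinant.det (1\<^sub>m m + t \<cdot>\<^sub>m M) = (poly Q t)\<^sup>2"
    using square_root_polynomial[OF M, of P] P by (auto simp: polyP det)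
  \<comment> \<open>The value at 0 yields both the constant term of \<open>Q\<close> and
    \<open>Q\<close> \<noteq> 0; the latter makes degrees additive and bounds the degree of
    \<open>Q\<close> by \<open>n\<close>.\<close>
  have "poly P 0 = 1" by (simp add: polyP zero_power)
  then have Q0: "coeff Q 0 = 1" by (simp add: Q(1) flip: poly_0_coeff_0)
  then have "Q \<noteq> 0" by auto
  then have "degree P = Suc (degree Q)"
    unfolding Q(1) by (subst degree_mult_eq) auto
  then have degQ: "degree Q \<le> n" using degP by simp
  then have Qn: "coeff Q j = 0" if "j > n" for j
    using that by (simp add: coeff_eq_0)
  have polyQ: "poly Q t = 1 + (\<Sum>j = 1..n. coeff Q j * t ^ j)" for t
  proof -
    have "poly Q t = (\<Sum>j\<le>n. coeff Q j * t ^ j)"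
      unfolding poly_altdef using degQ Qn
      by (intro sum.mono_neutral_left) (auto simp: coeff_eq_0)
    also have "{..n} = insert 0 {1..n}" by auto
    finally show ?thesis using Q0 by simp
  qed
  have rec: "C j = coeff Q j + coeff Q (j - 1)" if j: "j \<in> {1..n + 1}" for j
  proof -
    obtain i where "j = Suc i" using j by (cases j) auto
    then show ?thesis
      using coeffP[OF j] by (simp add: Q(1))
  qed
  have newton: "2 * real k * coeff Q k
      = (\<Sum>i = 1..k. (- 1) ^ (i + 1) * coeff Q (k - i) * trace_on UNIV (N ^^ i))" if "k \<ge> 1" for k
    using newton_identities_square[OF M Q(2) that] tr by simp
  have factor: "1 + (\<Sum>j = 1..n + 1. C j * t ^ j) = (1 + t) * (1 + (\<Sum>j = 1..n. coeff Q j * t ^ j))" for t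
  proof -
    have "poly P t = (1 + t) * poly Q t" by (simp add: Q(1) algebra_simps)
    then show ?thesis by (simp only: polyP polyQ)
  qed
  show ?thesis
    using Q0 Qn rec factor newton Q(2) unfolding det polyQ
    by (intro exI[of _ "coeff Q"] conjI allI ballI impI) auto
qed

section \<open>The span of the differentials of the traces\<close>

text \<open>
  By Newton's identities every trace is a polynomial in the first \<open>n\<close> of them, so its derivative
  stays in the span of theirs.
\<close>

lemma newton_derivative_span:
  fixes f e :: "nat \<Rightarrow> 'e::real_normed_vector \<Rightarrow> real" and B :: "nat \<Rightarrow> 'e \<Rightarrow>\<^sub>L real"
  assumes U: "open U" "x \<in> U"
    and e0: "\<And>y. y \<in> U \<Longrightarrow> e 0 y = 1" and en: "\<And>j y. j > n \<Longrightarrow> y \<in> U \<Longrightarrow> e j y = 0"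
    and newton: "\<And>k y. k \<ge> 1 \<Longrightarrow> y \<in> U \<Longrightarrow>
      2 * real k * e k y = (\<Sum>i = 1..k. (- 1) ^ (i + 1) * e (k - i) y * f i y)"
    and B: "\<And>k. k \<in> {1..n} \<Longrightarrow> (f k has_derivative blinfun_apply (B k)) (at x)"
    and k: "k \<ge> 1"
  shows "\<exists>B'\<in>span (B ` {1..n}). (f k has_derivative blinfun_apply B') (at x)"
proof -
  \<comment> \<open>Functions whose derivative at \<open>x\<close> lies in the span form an algebra
    containing the constants, and membership depends only on the values near
    \<open>x\<close>.\<close>
  define good where "good g \<longleftrightarrow> (\<exists>B'\<in>span (B ` {1..n}). (g has_derivative blinfun_apply B') (at x))"
    for g :: "'e \<Rightarrow> real"
  have const: "good (\<lambda>_. c)" for c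
    unfolding good_def by (rule bexI[of _ 0]) (auto simp: span_zero blinfun.zero_left[abs_def])
  have local: "good g" if "good h" "\<And>y. y \<in> U \<Longrightarrow> h y = g y" for g h
    using that U unfolding good_def by (meson has_derivative_transform_within_open)
  have add: "good (\<lambda>y. g y + h y)" if gh: "good g" "good h" for g h
  proof -
    obtain G H where "G \<in> span (B ` {1..n})" "(g has_derivative blinfun_apply G) (at x)"
      "H \<in> span (B ` {1..n})" "(h has_derivative blinfun_apply H) (at x)"
      using gh by (auto simp: good_def)
    then show ?thesis
      unfolding good_def
      by (intro bexI[of _ "G + H"]) (auto simp: span_add plus_blinfun.rep_eq intro: has_derivative_add)
  qed
  have mult: "good (\<lambda>y. g y * h y)" if gh: "good g" "good h" for g h
  proof -
    obtain G H where "G \<in> span (B ` {1..n})" "(g has_derivative blinfun_apply G) (at x)"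
      "H \<in> span (B ` {1..n})" "(h has_derivative blinfun_apply H) (at x)"
      using gh by (auto simp: good_def)
    moreover from this have "((\<lambda>y. g y * h y) has_derivative blinfun_apply (g x *\<^sub>R H + h x *\<^sub>R G)) (at x)"
      by (auto intro!: derivative_eq_intros simp: fun_eq_iff plus_blinfun.rep_eq scaleR_blinfun.rep_eq)
    ultimately show ?thesis
      unfolding good_def
      by (intro bexI[of _ "g x *\<^sub>R H + h x *\<^sub>R G"]) (auto simp: span_add span_scale)
  qed
  have sum: "good (\<lambda>y. \<Sum>i\<in>I. g i y)" if "finite I" "\<And>i. i \<in> I \<Longrightarrow> good (g i)" for I :: "nat set" and g
    using that by (induction I) (auto intro: add const)
  have f: "good (f i)" if "i \<in> {1..n}" for i
    using that B unfolding good_def by (meson image_eqI span_base)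
  \<comment> \<open>Beyond \<open>n\<close> the coefficient vanishes near \<open>x\<close>. Up to
    \<open>n\<close> its Newton identity, divided by 2 j, involves lower coefficients and traces
    with index at most \<open>n\<close>, so differentiability of \<open>e j\<close> is a result and
    not an assumption.\<close>
  have e: "good (e j)" for j
  proof (induction j rule: less_induct)
    case (less j)
    consider "j = 0" | "j > n" | "1 \<le> j" "j \<le> n" by linarith
    then show ?case
    proof cases
      case 1
      then show ?thesis using e0 by (intro local[OF const[of 1]]) simp
    next
      case 2
      then show ?thesis using en by (intro local[OF const[of 0]]) simp
    next
      case 3
      have "good (\<lambda>y. 1 / (2 * real j) * (\<Sum>i = 1..j. (- 1) ^ (i + 1) * e (j - i) y * f i y))"
        using 3 by (intro mult const sum less.IH f) auto
      then show ?thesis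
      proof (rule local)
        fix y assume "y \<in> U"
        then show "1 / (2 * real j) * (\<Sum>i = 1..j. (- 1) ^ (i + 1) * e (j - i) y * f i y) = e j y"
          using 3 by (subst newton[symmetric]) auto
      qed
    qed
  qed
  have "good (f k)"
    using k
  proof (induction k rule: less_induct)
    case (less k)
    have "good (\<lambda>y. (- 1) ^ (k + 1) * (2 * real k * e k y + - 1 * (\<Sum>i = 1..<k. (- 1) ^ (i + 1) * e (k - i) y * f i y)))"
      using less by (intro mult const sum add e) auto
    then show ?case
    proof (rule local)
      fix y assume y: "y \<in> U"
      have "{1..k} = insert k {1..<k}" using less.prems by auto
      then have "(- 1) ^ (k + 1) * f k y = 2 * real k * e k y + - 1 * (\<Sum>i = 1..<k. (- 1) ^ (i + 1) * e (k - i) y * f i y)"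
        using newton[OF less.prems y] e0[OF y] by simp
      then show "(- 1) ^ (k + 1) * (2 * real k * e k y + - 1 * (\<Sum>i = 1..<k. (- 1) ^ (i + 1) * e (k - i) y * f i y)) = f k y"
        by (metis left_minus_one_mult_self)
    qed
  qed
  then show ?thesis by (simp add: good_def)
qed

section \<open>Exterior derivatives in a chart\<close>

lemma frechet_derivative_eq: "(f has_derivative D) (at x) \<Longrightarrow> frechet_derivative f (at x) = D"
  using frechet_derivative_at by metis

lemma has_frechet_derivative:
  "f differentiable (at x) \<Longrightarrow> (f has_derivative frechet_derivative f (at x)) (at x)"
  using frechet_derivative_works by blast

lemma differentiable_local:
  assumes "f differentiable (at x)" "open W" "x \<in> W" "\<And>y. y \<in> W \<Longrightarrow> f y = g y"
  shows "g differentiable (at x)" "frechet_derivative g (at x) = frechet_derivative f (at x)"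
proof -
  have "(g has_derivative frechet_derivative f (at x)) (at x)"
    using has_frechet_derivative[OF assms(1)] assms(2-4) by (rule has_derivative_transform_within_open)
  then show "g differentiable (at x)" "frechet_derivative g (at x) = frechet_derivative f (at x)"
    by (auto simp: differentiable_def intro: frechet_derivative_eq)
qed

lemma frechet_derivative_chain:
  assumes f: "f differentiable (at x)" and g: "g differentiable (at (f x))"
    and W: "open W" "x \<in> W" "\<And>y. y \<in> W \<Longrightarrow> h y = g (f y)"
  shows "frechet_derivative g (at (f x)) (frechet_derivative f (at x) v) = frechet_derivative h (at x) v"
proof -
  have "((\<lambda>y. g (f y)) has_derivative (\<lambda>v. frechet_derivative g (at (f x)) (frechet_derivative f (at x) v))) (at x)"
    using has_derivative_compose[OF has_frechet_derivative[OF f] has_frechet_derivative[OF g]] .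
  then have "(h has_derivative (\<lambda>v. frechet_derivative g (at (f x)) (frechet_derivative f (at x) v))) (at x)"
    using W(1,2) by (rule has_derivative_transform_within_open) (use W(3) in simp)
  then show ?thesis
    by (simp add: frechet_derivative_eq)
qed

lemma linear_expand:
  fixes a :: "'e::euclidean_space \<Rightarrow> 'b::real_vector"
  assumes "linear a"
  shows "a v = (\<Sum>i\<in>Basis. inner v i *\<^sub>R a i)"
proof -
  have "a v = a (\<Sum>i\<in>Basis. inner v i *\<^sub>R i)" by (simp add: euclidean_representation)
  then show ?thesis by (simp add: linear_sum[OF assms] linear_cmul[OF assms])
qed

text \<open>The exterior derivative in a fixed coordinate system, with point and vectors in the same
  Euclidean space. It detaches the calculus from the atlas.\<close>

definition extd :: "('e::euclidean_space \<Rightarrow> 'e \<Rightarrow> real) \<Rightarrow> 'e \<Rightarrow> 'e \<Rightarrow> 'e \<Rightarrow> real" where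
  "extd a x u v = frechet_derivative (\<lambda>y. a y v) (at x) u - frechet_derivative (\<lambda>y. a y u) (at x) v"

lemma ext_deriv_extd:
  "ext_deriv \<A> \<omega> p = extd (form_rep \<A> (chart_at \<A> p) \<omega>) (snd (chart_at \<A> p) p)"
  by (simp add: fun_eq_iff ext_deriv_def extd_def Let_def)

lemma extd_alternating:
  assumes diff: "\<And>v. (\<lambda>y. a y v) differentiable (at x)"
    and W: "open W" "x \<in> W" "\<And>y. y \<in> W \<Longrightarrow> linear (a y)"
  shows "alternating_bilinear (extd a x)"
  unfolding alternating_bilinear_def
proof (intro conjI allI)
  note D = has_frechet_derivative[OF diff]
  have add: "frechet_derivative (\<lambda>y. a y (v + w)) (at x) u
      = frechet_derivative (\<lambda>y. a y v) (at x) u + frechet_derivative (\<lambda>y. a y w) (at x) u" for u v w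
  proof -
    have "((\<lambda>y. a y (v + w)) has_derivative (\<lambda>u. frechet_derivative (\<lambda>y. a y v) (at x) u
        + frechet_derivative (\<lambda>y. a y w) (at x) u)) (at x)"
      by (rule has_derivative_transform_within_open[OF has_derivative_add[OF D D] W(1,2)])
        (use W(3) in \<open>simp add: linear_add\<close>)
    then show ?thesis by (simp add: frechet_derivative_eq)
  qed
  have cmul: "frechet_derivative (\<lambda>y. a y (r *\<^sub>R v)) (at x) u = r * frechet_derivative (\<lambda>y. a y v) (at x) u" for u v r
  proof -
    have "((\<lambda>y. a y (r *\<^sub>R v)) has_derivative (\<lambda>u. r * frechet_derivative (\<lambda>y. a y v) (at x) u)) (at x)"
      by (rule has_derivative_transform_within_open[OF has_derivative_mult_right[OF D] W(1,2)])
        (use W(3) in \<open>simp add: linear_cmul\<close>)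
    then show ?thesis by (simp add: frechet_derivative_eq)
  qed
  have lin: "linear (frechet_derivative (\<lambda>y. a y u) (at x))" for u
    using linear_frechet_derivative[OF diff] .
  show "linear (extd a x u)" for u
    by (rule linearI) (simp_all add: extd_def add cmul linear_add[OF lin] linear_cmul[OF lin] algebra_simps)
  show "extd a x u v = - extd a x v u" for u v
    by (simp add: extd_def)
qed

text \<open>The coefficients of \<open>a\<close> are known to be differentiable for fixed vectors
  only, so \<open>\<xi> y\<close> is expanded in the standard basis and the product rule is applied
  to each summand.\<close>

lemma derivative_pairing:
  fixes a :: "'e::euclidean_space \<Rightarrow> 'e \<Rightarrow> real" and \<xi> :: "'e \<Rightarrow> 'e"
  assumes diff: "\<And>v. (\<lambda>y. a y v) differentiable (at x)" and \<xi>: "\<xi> differentiable (at x)"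
    and W: "open W" "x \<in> W" "\<And>y. y \<in> W \<Longrightarrow> linear (a y)"
  shows "((\<lambda>y. a y (\<xi> y)) has_derivative
    (\<lambda>w. frechet_derivative (\<lambda>y. a y (\<xi> x)) (at x) w + a x (frechet_derivative \<xi> (at x) w))) (at x)"
proof -
  note D = has_frechet_derivative[OF diff] and D\<xi> = has_frechet_derivative[OF \<xi>]
  let ?da = "\<lambda>i. frechet_derivative (\<lambda>y. a y i) (at x)"
  have "((\<lambda>y. \<Sum>i\<in>Basis. inner (\<xi> x) i * a y i) has_derivative (\<lambda>w. \<Sum>i\<in>Basis. inner (\<xi> x) i * ?da i w)) (at x)"
    by (intro has_derivative_sum has_derivative_mult_right D)
  then have "((\<lambda>y. a y (\<xi> x)) has_derivative (\<lambda>w. \<Sum>i\<in>Basis. inner (\<xi> x) i * ?da i w)) (at x)"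
    using W(1,2) by (rule has_derivative_transform_within_open)
      (use W(3) in \<open>simp add: linear_expand[of "a _" "\<xi> x"]\<close>)
  then have 1: "frechet_derivative (\<lambda>y. a y (\<xi> x)) (at x) = (\<lambda>w. \<Sum>i\<in>Basis. inner (\<xi> x) i * ?da i w)"
    by (rule frechet_derivative_eq)
  have "((\<lambda>y. \<Sum>i\<in>Basis. inner (\<xi> y) i * a y i) has_derivative
    (\<lambda>w. \<Sum>i\<in>Basis. inner (\<xi> x) i * ?da i w + inner (frechet_derivative \<xi> (at x) w) i * a x i)) (at x)"
    by (intro has_derivative_sum has_derivative_mult D has_derivative_inner_left D\<xi>)
  then have "((\<lambda>y. a y (\<xi> y)) has_derivative
    (\<lambda>w. \<Sum>i\<in>Basis. inner (\<xi> x) i * ?da i w + inner (frechet_derivative \<xi> (at x) w) i * a x i)) (at x)"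
    using W(1,2) by (rule has_derivative_transform_within_open)
      (use W(3) in \<open>simp add: linear_expand[of "a _" "\<xi> _"]\<close>)
  moreover have "a x (frechet_derivative \<xi> (at x) w) = (\<Sum>i\<in>Basis. inner (frechet_derivative \<xi> (at x) w) i * a x i)" for w
    using linear_expand[OF W(3)[OF W(2)], of "frechet_derivative \<xi> (at x) w"] by simp
  ultimately show ?thesis
    unfolding 1 by (simp add: sum.distrib)
qed

text \<open>
  With \<open>L\<^sub>\<xi> a = - b a\<close> and \<open>k = - a(\<xi>)\<close> the quotient \<open>\<sigma> = - a / k\<close> is invariant and \<open>\<sigma>(\<xi>) = 1\<close>, so
  Cartan's formula gives \<open>d\<sigma>(\<xi>, v) = 0\<close>.
\<close>

lemma extd_normalised:
  fixes a :: "'e::euclidean_space \<Rightarrow> 'e \<Rightarrow> real" and \<xi> :: "'e \<Rightarrow> 'e"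
  assumes diff: "\<And>v. (\<lambda>y. a y v) differentiable (at x)" and \<xi>: "\<xi> differentiable (at x)"
    and W: "open W" "x \<in> W" "\<And>y. y \<in> W \<Longrightarrow> linear (a y)"
    and k: "\<And>y. y \<in> W \<Longrightarrow> k y = - a y (\<xi> y)" "k x \<noteq> 0"
    and inv: "\<And>v. frechet_derivative (\<lambda>y. a y v) (at x) (\<xi> x) + a x (frechet_derivative \<xi> (at x) v) = - b * a x v"
    and \<sigma>: "\<And>y v. \<sigma> y v = - a y v / k y"
  shows "(\<lambda>y. \<sigma> y v) differentiable (at x)" and "extd \<sigma> x (\<xi> x) v = 0"
proof -
  let ?da = "\<lambda>v. frechet_derivative (\<lambda>y. a y v) (at x)" and ?d\<xi> = "frechet_derivative \<xi> (at x)"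
  define dk where "dk w = - (?da (\<xi> x) w + a x (?d\<xi> w))" for w
  have "((\<lambda>y. - a y (\<xi> y)) has_derivative dk) (at x)"
    unfolding dk_def by (intro has_derivative_minus derivative_pairing[OF diff \<xi> W])
  then have dk: "(k has_derivative dk) (at x)"
    by (rule has_derivative_transform_within_open[OF _ W(1,2)]) (simp add: k)
  have d\<sigma>: "((\<lambda>y. \<sigma> y v) has_derivative (\<lambda>u. - ?da v u / k x + a x v * dk u / (k x)\<^sup>2)) (at x)" for v
    unfolding \<sigma>
    by (rule derivative_eq_intros has_frechet_derivative[OF diff] dk k(2) refl ext)+
      (simp add: k(2) field_simps power2_eq_square)
  then show "(\<lambda>y. \<sigma> y v) differentiable (at x)" by (auto simp: differentiable_def)
  have ax: "a x (\<xi> x) = - k x" using k(1)[OF W(2)] by simp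
  have da: "?da v (\<xi> x) = - b * a x v - a x (?d\<xi> v)" for v
    using inv[of v] by simp
  \<comment> \<open>Along \<xi> the function \<open>k\<close> scales at the same rate as
    \<open>a\<close>, so \<open>b\<close> drops out of their quotient. Both halves of
    d\<sigma>(\<xi>, v) then reduce to a(D\<xi> v) / k.\<close>
  have dkx: "dk (\<xi> x) = - b * k x"
    by (simp add: dk_def da ax)
  have dkv: "?da (\<xi> x) v = - dk v - a x (?d\<xi> v)"
    by (simp add: dk_def)
  show "extd \<sigma> x (\<xi> x) v = 0"
    unfolding extd_def frechet_derivative_eq[OF d\<sigma>] da dkx dkv ax
    using k(2) by (simp add: field_simps power2_eq_square)
qed

lemma extd_scaled:
  fixes \<sigma> :: "'e::euclidean_space \<Rightarrow> 'e \<Rightarrow> real"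
  assumes \<sigma>: "\<And>v. (\<lambda>y. \<sigma> y v) differentiable (at x)" and h: "h differentiable (at x)"
    and \<beta>: "\<And>y v. y \<in> W \<Longrightarrow> \<beta> y v = - (h y * \<sigma> y v)" and W: "open W" "x \<in> W"
  shows "extd \<beta> x u v = - (frechet_derivative h (at x) u * \<sigma> x v - frechet_derivative h (at x) v * \<sigma> x u)
    - h x * extd \<sigma> x u v"
proof -
  have "((\<lambda>y. \<beta> y v) has_derivative (\<lambda>u. - (h x * frechet_derivative (\<lambda>y. \<sigma> y v) (at x) u
    + frechet_derivative h (at x) u * \<sigma> x v))) (at x)" for v
    by (rule has_derivative_transform_within_open[OF has_derivative_minus[OF has_derivative_mult[OF
            has_frechet_derivative[OF h] has_frechet_derivative[OF \<sigma>]]] W]) (simp add: \<beta>)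
  from frechet_derivative_eq[OF this] show ?thesis
    by (simp add: extd_def algebra_simps)
qed

section \<open>Changes of chart\<close>

lemma smooth_on_differentiable: "smooth_on S f \<Longrightarrow> x \<in> S \<Longrightarrow> f differentiable (at x)"
  using Ck_on.simps(2)[of 0 S f] unfolding smooth_on_def by blast

lemma smooth_on_derivative_differentiable:
  "smooth_on S f \<Longrightarrow> x \<in> S \<Longrightarrow> (\<lambda>y. frechet_derivative f (at y) v) differentiable (at x)"
  using Ck_on.simps(2)[of "Suc 0" S f] Ck_on.simps(2)[of 0 S "\<lambda>y. frechet_derivative f (at y) v"]
  unfolding smooth_on_def by blast

context
  fixes \<A> :: "('m::{second_countable_topology, t2_space}, 'e::euclidean_space) chart set"
  assumes atlas: "smooth_atlas \<A>"
begin

lemma chart_facts: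
  assumes "c \<in> \<A>"
  shows "open (fst c)" "open (snd c ` fst c)" "continuous_on (fst c) (snd c)"
    "p \<in> fst c \<Longrightarrow> chart_inv c (snd c p) = p"
    "open S \<Longrightarrow> open (snd c ` (fst c \<inter> S))"
proof -
  have o: "open (fst c)" "open (snd c ` fst c)"
    and h: "homeomorphism (fst c) (snd c ` fst c) (snd c) (chart_inv c)"
    using atlas assms unfolding smooth_atlas_def by blast+
  show "open (fst c)" "open (snd c ` fst c)" by fact+
  show "continuous_on (fst c) (snd c)" "p \<in> fst c \<Longrightarrow> chart_inv c (snd c p) = p"
    using h by (auto simp: homeomorphism_def)
  show "open (snd c ` (fst c \<inter> S))" if "open S"
    using homeomorphism_imp_open_map[OF h, of "fst c \<inter> S"] that o
    by (simp add: openin_open_eq open_Int)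
qed

lemma chart_at_mem: "chart_at \<A> p \<in> \<A>" "p \<in> fst (chart_at \<A> p)"
proof -
  have "\<exists>c. c \<in> \<A> \<and> p \<in> fst c"
    using atlas unfolding smooth_atlas_def by blast
  from someI_ex[OF this] show "chart_at \<A> p \<in> \<A>" "p \<in> fst (chart_at \<A> p)"
    unfolding chart_at_def by blast+
qed

lemma transition_differentiable:
  assumes "c \<in> \<A>" "c' \<in> \<A>" "p \<in> fst c" "p \<in> fst c'"
  shows "(snd c' \<circ> chart_inv c) differentiable (at (snd c p))"
  using atlas assms unfolding smooth_atlas_def
  by (intro smooth_on_differentiable[of "snd c ` (fst c \<inter> fst c')"]) auto

lemma coord_change_linear:
  assumes "c \<in> \<A>" "c' \<in> \<A>" "p \<in> fst c" "p \<in> fst c'"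
  shows "linear (coord_change c c' p)"
  unfolding coord_change_def by (intro linear_frechet_derivative transition_differentiable assms)

text \<open>The chain rule for transition maps; together with \<open>coord_change_self\<close> it
  makes coordinate changes at a point mutually inverse.\<close>

lemma coord_change_trans:
  assumes c: "c \<in> \<A>" "c' \<in> \<A>" "c'' \<in> \<A>" and p: "p \<in> fst c" "p \<in> fst c'" "p \<in> fst c''"
  shows "coord_change c' c'' p (coord_change c c' p v) = coord_change c c'' p v"
proof -
  let ?f = "snd c' \<circ> chart_inv c" and ?g = "snd c'' \<circ> chart_inv c'"
  have fx: "?f (snd c p) = snd c' p"
    using chart_facts(4)[OF c(1) p(1)] by simp
  have "frechet_derivative ?g (at (?f (snd c p))) (frechet_derivative ?f (at (snd c p)) v)
      = frechet_derivative (snd c'' \<circ> chart_inv c) (at (snd c p)) v"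
  proof (rule frechet_derivative_chain)
    show "?f differentiable (at (snd c p))" by (rule transition_differentiable) fact+
    show "?g differentiable (at (?f (snd c p)))"
      unfolding fx by (rule transition_differentiable) fact+
    show "open (snd c ` (fst c \<inter> fst c'))"
      using chart_facts(5)[OF c(1) chart_facts(1)[OF c(2)]] .
    show "snd c p \<in> snd c ` (fst c \<inter> fst c')" using p by auto
    show "(snd c'' \<circ> chart_inv c) y = ?g (?f y)" if "y \<in> snd c ` (fst c \<inter> fst c')" for y
      using that chart_facts(4)[OF c(1)] chart_facts(4)[OF c(2)] by auto
  qed
  then show ?thesis unfolding coord_change_def fx .
qed

lemma coord_change_self:
  assumes c: "c \<in> \<A>" "p \<in> fst c"
  shows "coord_change c c p v = v"
proof -
  have "frechet_derivative (snd c \<circ> chart_inv c) (at (snd c p)) = frechet_derivative (\<lambda>y. y) (at (snd c p))"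
    by (rule differentiable_local(2)[of _ _ "snd c ` fst c"])
      (use c chart_facts(2,4)[OF c(1)] in auto)
  then show ?thesis
    by (simp add: coord_change_def frechet_derivative_eq[OF has_derivative_ident])
qed

lemma form_rep_eq:
  assumes "c \<in> \<A>" "p \<in> fst c"
  shows "form_rep \<A> c \<omega> (snd c p) v = \<omega> p (coord_change c (chart_at \<A> p) p v)"
  using chart_facts(4)[OF assms] by (simp add: form_rep_def)

text \<open>This holds at the base point of the preferred chart. At neighbouring points another
  chart may be preferred, and a coordinate change intervenes.\<close>

lemma form_rep_chart_at [simp]:
  "form_rep \<A> (chart_at \<A> p) \<omega> (snd (chart_at \<A> p) p) v = \<omega> p v"
  by (simp add: form_rep_eq[OF chart_at_mem] coord_change_self[OF chart_at_mem])

lemma vector_rep_eq: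
  assumes "c \<in> \<A>" "p \<in> fst c"
  shows "vector_rep \<A> c X (snd c p) = coord_change (chart_at \<A> p) c p (X p)"
  using chart_facts(4)[OF assms] by (simp add: vector_rep_def)

lemma vector_rep_chart_at [simp]:
  "vector_rep \<A> (chart_at \<A> p) X (snd (chart_at \<A> p) p) = X p"
  by (simp add: vector_rep_eq[OF chart_at_mem] coord_change_self[OF chart_at_mem])

lemma form_vector_pairing:
  assumes "c \<in> \<A>" "p \<in> fst c"
  shows "form_rep \<A> c \<omega> (snd c p) (vector_rep \<A> c X (snd c p)) = \<omega> p (X p)"
  using assms
  by (simp add: form_rep_eq vector_rep_eq coord_change_trans coord_change_self chart_at_mem)

lemma form_rep_linear:
  assumes "c \<in> \<A>" "p \<in> fst c" "linear (\<omega> p)"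
  shows "linear (form_rep \<A> c \<omega> (snd c p))"
proof -
  have "form_rep \<A> c \<omega> (snd c p) = \<omega> p \<circ> coord_change c (chart_at \<A> p) p"
    by (simp add: fun_eq_iff form_rep_eq assms)
  then show ?thesis
    using linear_compose[OF coord_change_linear assms(3)] assms chart_at_mem by metis
qed

section \<open>Pull-back along a smooth map in fixed charts\<close>

context
  fixes \<Phi> :: "'m \<Rightarrow> 'm"
  assumes \<Phi>: "smooth_map \<A> \<Phi>"
begin

lemma map_smooth:
  assumes "c \<in> \<A>" "c' \<in> \<A>"
  shows "smooth_on (snd c ` (fst c \<inter> \<Phi> -` fst c')) (snd c' \<circ> \<Phi> \<circ> chart_inv c)"
    "open (snd c ` (fst c \<inter> \<Phi> -` fst c'))"
proof -
  show "smooth_on (snd c ` (fst c \<inter> \<Phi> -` fst c')) (snd c' \<circ> \<Phi> \<circ> chart_inv c)"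
    using \<Phi> assms unfolding smooth_map_def by blast
  have "open (\<Phi> -` fst c')"
    using \<Phi> chart_facts(1)[OF assms(2)] open_vimage unfolding smooth_map_def by blast
  then show "open (snd c ` (fst c \<inter> \<Phi> -` fst c'))"
    by (rule chart_facts(5)[OF assms(1)])
qed

lemma map_differentiable:
  assumes "c \<in> \<A>" "c' \<in> \<A>" "p \<in> fst c" "\<Phi> p \<in> fst c'"
  shows "(snd c' \<circ> \<Phi> \<circ> chart_inv c) differentiable (at (snd c p))"
  using smooth_on_differentiable[OF map_smooth(1)[OF assms(1,2)]] assms(3,4) by auto

text \<open>Replaces the preferred charts at \<open>p\<close> and at its image by fixed ones. Both
  sides are the derivative of the mixed composite \<open>?h\<close>, factored through the source
  chart in one case and through the target chart in the other.\<close>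

lemma tangent_map_coords:
  assumes c: "c \<in> \<A>" "c' \<in> \<A>" and p: "p \<in> fst c" "\<Phi> p \<in> fst c'"
  shows "tangent_map \<A> \<Phi> p (coord_change c (chart_at \<A> p) p v)
    = coord_change c' (chart_at \<A> (\<Phi> p)) (\<Phi> p) (frechet_derivative (snd c' \<circ> \<Phi> \<circ> chart_inv c) (at (snd c p)) v)"
proof -
  let ?a = "chart_at \<A> p" and ?a' = "chart_at \<A> (\<Phi> p)"
  note a = chart_at_mem[of p] and a' = chart_at_mem[of "\<Phi> p"]
  let ?f = "snd ?a \<circ> chart_inv c" and ?g = "snd ?a' \<circ> \<Phi> \<circ> chart_inv ?a"
  let ?f' = "snd c' \<circ> \<Phi> \<circ> chart_inv c" and ?g' = "snd ?a' \<circ> chart_inv c'"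
  let ?h = "snd ?a' \<circ> \<Phi> \<circ> chart_inv c"
  have fx: "?f (snd c p) = snd ?a p" "?f' (snd c p) = snd c' (\<Phi> p)"
    using chart_facts(4)[OF c(1) p(1)] by simp_all
  have 1: "frechet_derivative ?g (at (?f (snd c p))) (frechet_derivative ?f (at (snd c p)) v)
      = frechet_derivative ?h (at (snd c p)) v"
  proof (rule frechet_derivative_chain)
    show "?f differentiable (at (snd c p))" by (intro transition_differentiable c p a)
    show "?g differentiable (at (?f (snd c p)))"
      unfolding fx by (intro map_differentiable a a')
    show "open (snd c ` (fst c \<inter> fst ?a))"
      using chart_facts(5)[OF c(1) chart_facts(1)[OF a(1)]] .
    show "snd c p \<in> snd c ` (fst c \<inter> fst ?a)" using p a by auto
    show "?h y = ?g (?f y)" if "y \<in> snd c ` (fst c \<inter> fst ?a)" for y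
      using that chart_facts(4)[OF c(1)] chart_facts(4)[OF a(1)] by auto
  qed
  have 2: "frechet_derivative ?g' (at (?f' (snd c p))) (frechet_derivative ?f' (at (snd c p)) v)
      = frechet_derivative ?h (at (snd c p)) v"
  proof (rule frechet_derivative_chain)
    show "?f' differentiable (at (snd c p))" by (intro map_differentiable c p)
    show "?g' differentiable (at (?f' (snd c p)))"
      unfolding fx by (intro transition_differentiable c p a')
    show "open (snd c ` (fst c \<inter> \<Phi> -` fst c'))" by (rule map_smooth(2)[OF c])
    show "snd c p \<in> snd c ` (fst c \<inter> \<Phi> -` fst c')" using p by auto
    show "?h y = ?g' (?f' y)" if "y \<in> snd c ` (fst c \<inter> \<Phi> -` fst c')" for y
      using that chart_facts(4)[OF c(1)] chart_facts(4)[OF c(2)] by auto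
  qed
  show ?thesis
    using 1 2 unfolding fx tangent_map_def coord_change_def by simp
qed

lemma pullback_rep:
  assumes c: "c \<in> \<A>" "c' \<in> \<A>" and p: "p \<in> fst c" "\<Phi> p \<in> fst c'"
  shows "form_rep \<A> c (pullback \<A> \<Phi> \<eta>) (snd c p) v
    = form_rep \<A> c' \<eta> (snd c' (\<Phi> p)) (frechet_derivative (snd c' \<circ> \<Phi> \<circ> chart_inv c) (at (snd c p)) v)"
  by (simp add: form_rep_eq[OF c(1) p(1)] form_rep_eq[OF c(2) p(2)] pullback_def tangent_map_coords[OF c p])

context
  fixes \<eta> :: "'m \<Rightarrow> 'e \<Rightarrow> real"
  assumes \<eta>: "smooth_one_form \<A> \<eta>"
begin

lemma pullback_linear: "linear (pullback \<A> \<Phi> \<eta> p)"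
proof -
  have "linear (tangent_map \<A> \<Phi> p)"
    unfolding tangent_map_def by (intro linear_frechet_derivative map_differentiable chart_at_mem)
  moreover have "linear (\<eta> (\<Phi> p))" using \<eta> by (simp add: smooth_one_form_def)
  ultimately show ?thesis
    using linear_compose by (force simp: pullback_def[abs_def] o_def)
qed

text \<open>The coefficients of a pull-back contain first derivatives of the map, so second order
  smoothness is used. The transported vector is expanded in the basis, since the coefficients of
  \<eta> are smooth for fixed vectors.\<close>

lemma pullback_differentiable:
  assumes c: "c \<in> \<A>" and p: "p \<in> fst c"
  shows "(\<lambda>y. form_rep \<A> c (pullback \<A> \<Phi> \<eta>) y v) differentiable (at (snd c p))"
proof -
  define c' where "c' = chart_at \<A> (\<Phi> p)"
  have c': "c' \<in> \<A>" "\<Phi> p \<in> fst c'" by (simp_all add: c'_def chart_at_mem)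
  let ?F = "snd c' \<circ> \<Phi> \<circ> chart_inv c" and ?W = "snd c ` (fst c \<inter> \<Phi> -` fst c')"
  let ?x = "snd c p"
  have W: "open ?W" "?x \<in> ?W" using map_smooth(2)[OF c c'(1)] p c'(2) by auto
  have Fx: "?F ?x = snd c' (\<Phi> p)" using chart_facts(4)[OF c p] by simp
  have "(\<lambda>y. form_rep \<A> c' \<eta> y i) differentiable (at (snd c' (\<Phi> p)))" for i
    using \<eta> c' by (intro smooth_on_differentiable[of "snd c' ` fst c'"]) (auto simp: smooth_one_form_def)
  then have g: "(\<lambda>y. form_rep \<A> c' \<eta> (?F y) i) differentiable (at ?x)" for i
    using differentiable_chain_at[OF map_differentiable[OF c c'(1) p c'(2)],
        of "\<lambda>y. form_rep \<A> c' \<eta> y i"] unfolding Fx by (simp add: o_def)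
  have d: "(\<lambda>y. frechet_derivative ?F (at y) v) differentiable (at ?x)"
    by (rule smooth_on_derivative_differentiable[OF map_smooth(1)[OF c c'(1)] W(2)])
  have "((\<lambda>y. \<Sum>i\<in>Basis. inner (frechet_derivative ?F (at y) v) i * form_rep \<A> c' \<eta> (?F y) i)
      has_derivative (\<lambda>w. \<Sum>i\<in>Basis. inner (frechet_derivative ?F (at ?x) v) i *
        frechet_derivative (\<lambda>y. form_rep \<A> c' \<eta> (?F y) i) (at ?x) w
        + inner (frechet_derivative (\<lambda>y. frechet_derivative ?F (at y) v) (at ?x) w) i * form_rep \<A> c' \<eta> (?F ?x) i)) (at ?x)"
    by (intro has_derivative_sum has_derivative_mult has_derivative_inner_left has_frechet_derivative g d)
  then have "(\<lambda>y. \<Sum>i\<in>Basis. inner (frechet_derivative ?F (at y) v) i * form_rep \<A> c' \<eta> (?F y) i) differentiable (at ?x)"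
    unfolding differentiable_def by blast
  then show ?thesis
  proof (rule differentiable_local(1)[OF _ W])
    fix y assume "y \<in> ?W"
    then obtain q where q: "y = snd c q" "q \<in> fst c" "\<Phi> q \<in> fst c'" by auto
    have Fy: "?F y = snd c' (\<Phi> q)" using chart_facts(4)[OF c q(2)] q(1) by simp
    have "linear (form_rep \<A> c' \<eta> (snd c' (\<Phi> q)))"
      using \<eta> by (intro form_rep_linear[OF c'(1) q(3)]) (simp add: smooth_one_form_def)
    from linear_expand[OF this, of "frechet_derivative ?F (at y) v"]
    show "(\<Sum>i\<in>Basis. inner (frechet_derivative ?F (at y) v) i * form_rep \<A> c' \<eta> (?F y) i)
      = form_rep \<A> c (pullback \<A> \<Phi> \<eta>) y v"
      unfolding Fy using pullback_rep[OF c c'(1) q(2,3)] q(1) by simp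
  qed
qed

lemma pairing_differentiable:
  assumes c: "c \<in> \<A>" "p \<in> fst c" and X: "smooth_vector_field \<A> X"
  shows "(\<lambda>y. form_rep \<A> c (pullback \<A> \<Phi> \<eta>) y (vector_rep \<A> c X y)) differentiable (at (snd c p))"
proof -
  have X': "vector_rep \<A> c X differentiable (at (snd c p))"
    using X c unfolding smooth_vector_field_def by (auto intro: smooth_on_differentiable)
  have "linear (form_rep \<A> c (pullback \<A> \<Phi> \<eta>) y)" if "y \<in> snd c ` fst c" for y
    using that form_rep_linear[OF c(1) _ pullback_linear] by auto
  from derivative_pairing[OF pullback_differentiable[OF c] X' chart_facts(2)[OF c(1)] _ this]
  show ?thesis
    unfolding differentiable_def using c by blast
qed

text \<open>Makes \<open>V\<close> open, so that identities on \<open>V\<close> hold near each of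
  its points and can be differentiated. Continuity is checked in a chart, where the coordinate
  changes of form and vector cancel in the pairing.\<close>

lemma open_nonvanishing:
  assumes X: "smooth_vector_field \<A> X"
  shows "open {p. - pullback \<A> \<Phi> \<eta> p (X p) \<noteq> 0}"
proof -
  let ?K = "\<lambda>p. pullback \<A> \<Phi> \<eta> p (X p)"
  have "isCont ?K p" for p
  proof -
    let ?c = "chart_at \<A> p"
    let ?k = "\<lambda>y. form_rep \<A> ?c (pullback \<A> \<Phi> \<eta>) y (vector_rep \<A> ?c X y)"
    note c = chart_at_mem[of p]
    have "isCont ?k (snd ?c p)"
      by (rule differentiable_imp_continuous_within) (rule pairing_differentiable[OF c X])
    moreover have "isCont (snd ?c) p"
      using chart_facts(1,3)[OF c(1)] c(2) by (simp add: continuous_on_eq_continuous_at)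
    ultimately have "isCont (\<lambda>q. ?k (snd ?c q)) p"
      by (rule isCont_o2[rotated])
    moreover have "\<forall>\<^sub>F q in nhds p. ?k (snd ?c q) = ?K q"
      using eventually_nhds_in_open[OF chart_facts(1)[OF c(1)] c(2)]
      by eventually_elim (rule form_vector_pairing[OF c(1)])
    ultimately show ?thesis
      by (rule isCont_cong[THEN iffD1, rotated])
  qed
  then have "continuous_on UNIV ?K"
    by (simp add: continuous_at_imp_continuous_on)
  then have "open {p. ?K p \<noteq> 0}"
    by (intro open_Collect_neq) auto
  then show ?thesis by simp
qed

end

end

text \<open>In a fixed chart the representatives of N depend differentiably on the point, and they
  are conjugate to N itself, so the traces of their powers agree.\<close>

lemma trace_differentiable:
  assumes N: "smooth_endomorphism_on \<A> V N" and V: "open V" "p \<in> V" and c: "c \<in> \<A>" "p \<in> fst c"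
  shows "((\<lambda>q. trace_on UNIV (N q ^^ k)) \<circ> chart_inv c) differentiable (at (snd c p))"
proof -
  let ?x = "snd c p" and ?W = "snd c ` (fst c \<inter> V)"
  let ?E = "endo_rep \<A> c N"
  \<comment> \<open>Equal to \<open>?E y\<close> wherever that is linear, but written so that
    iterates can be differentiated from the derivatives of \<open>?E\<close> at fixed basis
    vectors.\<close>
  define G where "G y v = (\<Sum>i\<in>Basis. inner v i *\<^sub>R ?E y i)" for y v
  have W: "open ?W" "?x \<in> ?W" using chart_facts(5)[OF c(1) V(1)] V c by auto
  have E: "(\<lambda>y. ?E y v) differentiable (at ?x)" for v
    using N c W(2) unfolding smooth_endomorphism_on_def by (auto intro: smooth_on_differentiable)
  have "\<exists>D. ((\<lambda>y. (G y ^^ k) v) has_derivative D) (at ?x)" for v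
  proof (induction k)
    case 0
    show ?case by (auto intro: has_derivative_const)
  next
    case (Suc k)
    then obtain D where D: "((\<lambda>y. (G y ^^ k) v) has_derivative D) (at ?x)" by blast
    have "((\<lambda>y. \<Sum>i\<in>Basis. inner ((G y ^^ k) v) i *\<^sub>R ?E y i) has_derivative
      (\<lambda>h. \<Sum>i\<in>Basis. inner ((G ?x ^^ k) v) i *\<^sub>R frechet_derivative (\<lambda>y. ?E y i) (at ?x) h
        + inner (D h) i *\<^sub>R ?E ?x i)) (at ?x)"
      by (intro has_derivative_sum has_derivative_scaleR has_derivative_inner_left has_frechet_derivative E D)
    moreover have "(G y ^^ Suc k) v = (\<Sum>i\<in>Basis. inner ((G y ^^ k) v) i *\<^sub>R ?E y i)" for y
      by (simp add: G_def[of y "(G y ^^ k) v"])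
    ultimately show ?case by (simp only:) blast
  qed
  then obtain D where D: "\<And>v. ((\<lambda>y. (G y ^^ k) v) has_derivative D v) (at ?x)" by metis
  have "((\<lambda>y. \<Sum>b\<in>Basis. inner ((G y ^^ k) b) b) has_derivative (\<lambda>h. \<Sum>b\<in>Basis. inner (D b h) b)) (at ?x)"
    by (intro has_derivative_sum has_derivative_inner_left D)
  then have "(\<lambda>y. \<Sum>b\<in>Basis. inner ((G y ^^ k) b) b) differentiable (at ?x)"
    by (auto simp: differentiable_def)
  then show ?thesis
  proof (rule differentiable_local(1)[OF _ W])
    fix y assume "y \<in> ?W"
    then obtain q where q: "y = snd c q" "q \<in> fst c" "q \<in> V" by auto
    define J where "J = coord_change (chart_at \<A> q) c q"
    define J' where "J' = coord_change c (chart_at \<A> q) q"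
    note a = chart_at_mem[of q]
    have J: "linear J" "linear J'" "\<And>v. J' (J v) = v" "\<And>v. J (J' v) = v"
      unfolding J_def J'_def
      by (simp_all add: coord_change_linear coord_change_trans coord_change_self a c(1) q(2))
    have Nq: "linear (N q)" using N q(3) by (simp add: smooth_endomorphism_on_def)
    have Ey: "?E y v = J (N q (J' v))" for v
      using chart_facts(4)[OF c(1) q(2)] by (simp add: endo_rep_def q(1) J_def J'_def)
    have "linear (?E y)"
      using linear_compose[OF linear_compose[OF J(2) Nq] J(1)] by (simp add: Ey[abs_def] o_def)
    then have "G y v = J (N q (J' v))" for v
      unfolding G_def Ey[symmetric] by (rule linear_expand[symmetric])
    then have Gk: "(G y ^^ k) v = J ((N q ^^ k) (J' v))" for v
      by (induction k) (simp_all add: J)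
    have Nk: "linear (N q ^^ k)"
      using Nq by (induction k) (auto simp: linear_compose[unfolded o_def] o_def linear_ident id_def)
    \<comment> \<open>Conjugation by \<open>J\<close> is a change of frame: the vectors
      \<open>J' b\<close> form a basis whose coordinates are those of \<open>J x\<close>.\<close>
    have "(\<Sum>b\<in>Basis. inner (J ((N q ^^ k) (J' b))) b) = (\<Sum>b\<in>Basis. inner ((N q ^^ k) b) b)"
    proof (rule trace_frames[where S = UNIV and f = "N q ^^ k" and c = J' and b = "\<lambda>i. i"
          and \<phi> = "\<lambda>i x. inner x i" and \<psi> = "\<lambda>j x. inner (J x) j"])
      show "x = (\<Sum>i\<in>Basis. inner x i *\<^sub>R i)" for x :: 'e by (simp add: euclidean_representation)
      show "x = (\<Sum>j\<in>Basis. inner (J x) j *\<^sub>R J' j)" for x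
        using linear_expand[OF J(2), of "J x"] by (simp add: J)
      show "linear (\<lambda>x. inner ((N q ^^ k) x) i)" for i
        using Nk by (auto simp: linear_iff inner_add_left)
      show "linear (\<lambda>x. inner (J x) j)" for j
        using J(1) by (auto simp: linear_iff inner_add_left)
    qed auto
    moreover have "chart_inv c y = q"
      using chart_facts(4)[OF c(1) q(2)] q(1) by simp
    ultimately show "(\<Sum>b\<in>Basis. inner ((G y ^^ k) b) b) = ((\<lambda>q. trace_on UNIV (N q ^^ k)) \<circ> chart_inv c) y"
      using trace_on_subspace[OF subspace_UNIV Nk] by (simp add: Gk)
  qed
qed

end

section \<open>The pencil of a canonoid map at a point\<close>

text \<open>Collects what \<open>pencil_square\<close> requires at one point of \<open>V\<close>.
  All derivatives are taken in the preferred chart of that point, where representatives and tensors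
  coincide.\<close>

lemma canonoid_pencil:
  fixes \<A> :: "('m::{second_countable_topology, t2_space}, 'e::euclidean_space) chart set"
  assumes sys: "contact_hamiltonian_system \<A> n \<eta> H"
    and X: "contact_hamiltonian_field \<A> \<eta> H R X"
    and can: "contact_canonoid \<A> \<eta> X \<Phi>"
    and \<alpha>: "\<alpha> = pullback \<A> \<Phi> \<eta>" and K: "K = (\<lambda>p. - \<alpha> p (X p))"
    and \<beta>: "\<beta> = (\<lambda>p v. H p / K p * \<alpha> p v)" and \<sigma>: "\<sigma> = (\<lambda>p v. - \<alpha> p v / K p)"
    and p: "K p \<noteq> 0"
  shows "linear (\<eta> p)" "linear (\<sigma> p)" "linear (differential \<A> H p)"
    "alternating_bilinear (ext_deriv \<A> \<eta> p)" "alternating_bilinear (ext_deriv \<A> \<sigma> p)"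
    "\<sigma> p (X p) = 1" "ext_deriv \<A> \<sigma> p (X p) w = 0"
    "ext_deriv \<A> \<beta> p u w = - (differential \<A> H p u * \<sigma> p w - differential \<A> H p w * \<sigma> p u)
      - H p * ext_deriv \<A> \<sigma> p u w"
proof -
  have atlas: "smooth_atlas \<A>" and \<eta>: "smooth_one_form \<A> \<eta>" and H: "smooth_fun \<A> H"
    using sys by (auto simp: contact_hamiltonian_system_def contact_form_def)
  have \<Phi>: "smooth_map \<A> \<Phi>" using can by (simp add: contact_canonoid_def)
  have sX: "smooth_vector_field \<A> X" using X by (simp add: contact_hamiltonian_field_def)
  define c where "c = chart_at \<A> p"
  define x where "x = snd c p"
  let ?a = "form_rep \<A> c \<alpha>" and ?\<sigma> = "form_rep \<A> c \<sigma>" and ?\<xi> = "vector_rep \<A> c X"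
  let ?W = "snd c ` fst c"
  have c: "c \<in> \<A>" "p \<in> fst c" unfolding c_def by (rule chart_at_mem[OF atlas])+
  have W: "open ?W" "x \<in> ?W" using chart_facts(2)[OF atlas c(1)] c(2) by (auto simp: x_def)
  have inv: "chart_inv c x = p" using chart_facts(4)[OF atlas c] by (simp add: x_def)
  have \<eta>lin: "linear (\<eta> q)" for q using \<eta> by (simp add: smooth_one_form_def)
  have \<alpha>lin: "linear (\<alpha> q)" for q unfolding \<alpha> by (rule pullback_linear[OF atlas \<Phi> \<eta>])
  have \<sigma>lin: "linear (\<sigma> q)" for q
    by (rule linearI) (simp_all add: \<sigma> linear_add[OF \<alpha>lin] linear_cmul[OF \<alpha>lin] add_divide_distrib diff_divide_distrib)
  have at: "form_rep \<A> c \<omega> x v = \<omega> p v" for \<omega> v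
    unfolding x_def c_def by (rule form_rep_chart_at[OF atlas])
  have \<xi>x: "?\<xi> x = X p" unfolding x_def c_def by (rule vector_rep_chart_at[OF atlas])
  have replin: "linear (form_rep \<A> c \<omega> y)" if "y \<in> ?W" "\<And>q. linear (\<omega> q)" for y \<omega>
    using that form_rep_linear[OF atlas c(1)] by auto
  have d\<alpha>: "(\<lambda>y. ?a y v) differentiable (at x)" for v
    unfolding \<alpha> x_def by (rule pullback_differentiable[OF atlas \<Phi> \<eta> c])
  have d\<xi>: "?\<xi> differentiable (at x)"
    using sX c W unfolding smooth_vector_field_def by (auto intro: smooth_on_differentiable)
  have dH: "(H \<circ> chart_inv c) differentiable (at x)"
    using H c W unfolding smooth_fun_def by (auto intro: smooth_on_differentiable)
  have d\<eta>: "(\<lambda>y. form_rep \<A> c \<eta> y v) differentiable (at x)" for v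
    using \<eta> c W unfolding smooth_one_form_def by (auto intro: smooth_on_differentiable)
  have k: "(K \<circ> chart_inv c) y = - ?a y (?\<xi> y)" if y: "y \<in> ?W" for y
  proof -
    obtain q where q: "y = snd c q" "q \<in> fst c" using y by auto
    then show ?thesis
      using form_vector_pairing[OF atlas c(1) q(2), of \<alpha> X] chart_facts(4)[OF atlas c(1) q(2)]
      by (simp add: K)
  qed
  obtain b where b: "\<And>p v. lie_derivative \<A> X \<alpha> p v = - b p * \<alpha> p v"
    using can unfolding contact_canonoid_def \<alpha> by blast
  \<comment> \<open>The canonoid condition in coordinates, in the form of the invariance hypothesis
    of \<open>extd_normalised\<close>.\<close>
  have lie: "frechet_derivative (\<lambda>y. ?a y v) (at x) (?\<xi> x) + ?a x (frechet_derivative ?\<xi> (at x) v) = - b p * ?a x v" for v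
    using b[of p v] unfolding at by (simp add: lie_derivative_def Let_def at flip: c_def x_def)
  have \<sigma>rep: "?\<sigma> y v = - ?a y v / (K \<circ> chart_inv c) y" for y v
    by (simp add: form_rep_def Let_def \<sigma>)
  have kx: "(K \<circ> chart_inv c) x \<noteq> 0" using p inv by simp
  have \<alpha>rep: "linear (?a y)" if "y \<in> ?W" for y by (rule replin[OF that \<alpha>lin])
  note norm = extd_normalised[where a = "?a" and \<xi> = "?\<xi>" and W = "?W" and k = "K \<circ> chart_inv c"
      and \<sigma> = "?\<sigma>", OF d\<alpha> d\<xi> W \<alpha>rep k kx lie \<sigma>rep]
  show "linear (\<eta> p)" "linear (\<sigma> p)" by (rule \<eta>lin \<sigma>lin)+
  show "linear (differential \<A> H p)"
    unfolding differential_def using linear_frechet_derivative[OF dH] by (simp add: c_def x_def)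
  show "alternating_bilinear (ext_deriv \<A> \<eta> p)"
    unfolding ext_deriv_extd using extd_alternating[OF d\<eta> W replin[OF _ \<eta>lin]] by (simp add: c_def x_def)
  show "alternating_bilinear (ext_deriv \<A> \<sigma> p)"
    unfolding ext_deriv_extd using extd_alternating[OF norm(1) W replin[OF _ \<sigma>lin]] by (simp add: c_def x_def)
  show "\<sigma> p (X p) = 1"
    using p by (simp add: \<sigma> K)
  show "ext_deriv \<A> \<sigma> p (X p) w = 0"
    unfolding ext_deriv_extd using norm(2)[of w] \<xi>x by (simp add: c_def x_def)
  have \<beta>rep: "form_rep \<A> c \<beta> y v = - ((H \<circ> chart_inv c) y * ?\<sigma> y v)" for y v
    by (simp add: form_rep_def Let_def \<sigma> \<beta>)
  note scaled = extd_scaled[where \<sigma> = "?\<sigma>" and \<beta> = "form_rep \<A> c \<beta>" and h = "H \<circ> chart_inv c" and W = "?W",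
      OF norm(1) dH \<beta>rep W]
  show "ext_deriv \<A> \<beta> p u w = - (differential \<A> H p u * \<sigma> p w - differential \<A> H p w * \<sigma> p u)
      - H p * ext_deriv \<A> \<sigma> p u w"
    using scaled[of u w] inv unfolding ext_deriv_extd differential_def at by (simp add: c_def x_def)
qed

text \<open>The coefficients \<open>q\<close> are chosen point by point. No regularity is imposed on
  the choice: Newton's identities make them polynomials in the traces, which are
  differentiable.\<close>

theorem proposition6:
  fixes \<A> :: "('m::{second_countable_topology, t2_space}, 'e::euclidean_space) chart set"
    and n :: nat
    and \<eta> \<alpha> \<beta> \<sigma> :: "'m \<Rightarrow> 'e \<Rightarrow> real"
    and H K :: "'m \<Rightarrow> real"
    and R X :: "'m \<Rightarrow> 'e"
    and \<Phi> :: "'m \<Rightarrow> 'm"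
    and V :: "'m set"
    and C :: "nat \<Rightarrow> 'm \<Rightarrow> real"
    and \<D> :: "'m \<Rightarrow> 'e set"
    and N :: "'m \<Rightarrow> 'e \<Rightarrow> 'e"
    and tr :: "nat \<Rightarrow> 'm \<Rightarrow> real"
  assumes "n \<ge> 1"
    and "contact_hamiltonian_system \<A> n \<eta> H"
    and "reeb_field \<A> \<eta> R"
    and "contact_hamiltonian_field \<A> \<eta> H R X"
    and "contact_canonoid \<A> \<eta> X \<Phi>"
    and "\<alpha> = pullback \<A> \<Phi> \<eta>"
    and "K = (\<lambda>p. - \<alpha> p (X p))"
    and "V = {p. K p \<noteq> 0}"
    and "\<beta> = (\<lambda>p v. H p / K p * \<alpha> p v)"
    and "\<sigma> = (\<lambda>p v. - \<alpha> p v / K p)"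
    and "\<And>p t v. p \<in> V \<Longrightarrow>
      wedge_top n (\<lambda>u. \<eta> p u + t * \<beta> p u)
        (\<lambda>u w. ext_deriv \<A> \<eta> p u w + t * ext_deriv \<A> \<beta> p u w) v
      = (1 + (\<Sum>j = 1..n + 1. C j p * t ^ j)) * wedge_top n (\<eta> p) (ext_deriv \<A> \<eta> p) v"
    and "\<D> = (\<lambda>p. {v. \<eta> p v = 0})"
    and "invariant_endomorphism \<A> V \<eta> H \<sigma> N"
    and "tr = (\<lambda>k p. trace_on UNIV (N p ^^ k))"
  shows "\<exists>q :: nat \<Rightarrow> 'm \<Rightarrow> real. \<forall>p\<in>V.
      (\<forall>t. 1 + (\<Sum>j = 1..n + 1. C j p * t ^ j) = (1 + t) * (1 + (\<Sum>j = 1..n. q j p * t ^ j))) \<and>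
      (\<forall>t. det_on (\<D> p) (\<lambda>v. v + t *\<^sub>R N p v) = (1 + (\<Sum>j = 1..n. q j p * t ^ j))\<^sup>2) \<and>
      (\<forall>j\<in>{1..n}. q j p = coeff_from_traces (map (\<lambda>k. tr k p) [1..<n + 1]) j) \<and>
      (\<forall>k\<in>{1..n}. tr k p = trace_from_coeffs (map (\<lambda>j. q j p) [1..<n + 1]) k) \<and>
      tr 1 p = 2 * (C 1 p - 1) \<and>
      tr 2 p = 2 * (C 1 p - 1)\<^sup>2 - 4 * (C 2 p - C 1 p + 1) \<and>
      (\<forall>k>n. tr k p = trace_from_coeffs (map (\<lambda>j. q j p) [1..<n + 1]) k) \<and>
      dim (span {Blinfun (differential \<A> (tr k) p) | k. k \<ge> 1}) \<le> n"
proof -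
  have atlas: "smooth_atlas \<A>" and dim: "DIM('e) = 2 * n + 1" and \<eta>: "smooth_one_form \<A> \<eta>"
    and contact: "\<And>p. \<exists>v. wedge_top n (\<eta> p) (ext_deriv \<A> \<eta> p) v \<noteq> 0"
    using assms(2) by (auto simp: contact_hamiltonian_system_def contact_form_def)
  have N: "smooth_endomorphism_on \<A> V N"
    "\<And>p y. p \<in> V \<Longrightarrow> \<eta> p (N p y) = 0"
    "\<And>p y z. p \<in> V \<Longrightarrow> \<eta> p z = 0 \<Longrightarrow> ext_deriv \<A> \<eta> p (N p y) z = - H p * ext_deriv \<A> \<sigma> p y z"
    using assms(13) by (auto simp: invariant_endomorphism_def)
  have K: "K p \<noteq> 0" if "p \<in> V" for p using that assms(8) by simp
  note pencil = canonoid_pencil[OF assms(2,4,5,6,7,9,10) K]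
  define good where "good p e \<longleftrightarrow> e 0 = 1 \<and> (\<forall>j>n. e j = 0) \<and> (\<forall>j\<in>{1..n + 1}. C j p = e j + e (j - 1)) \<and>
    (\<forall>t. 1 + (\<Sum>j = 1..n + 1. C j p * t ^ j) = (1 + t) * (1 + (\<Sum>j = 1..n. e j * t ^ j))) \<and>
    (\<forall>t. det_on {v. \<eta> p v = 0} (\<lambda>v. v + t *\<^sub>R N p v) = (1 + (\<Sum>j = 1..n. e j * t ^ j))\<^sup>2) \<and>
    (\<forall>k\<ge>1. 2 * real k * e k = (\<Sum>i = 1..k. (- 1) ^ (i + 1) * e (k - i) * trace_on UNIV (N p ^^ i)))" for p e
  have "\<exists>e. good p e" if p: "p \<in> V" for p
    unfolding good_def
  proof (rule square_root_coefficients)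
    show \<eta>p: "linear (\<eta> p)" by (rule pencil(1)[OF p])
    show Np: "linear (N p)" using N(1) p by (simp add: smooth_endomorphism_on_def)
    show "\<eta> p (N p y) = 0" for y by (rule N(2)[OF p])
    fix t :: real assume t: "t \<noteq> - 1"
    obtain v0 where v0: "wedge_top n (\<eta> p) (ext_deriv \<A> \<eta> p) v0 \<noteq> 0" using contact by blast
    have R: "\<eta> p (R p) = 1" using assms(3) by (simp add: reeb_field_def)
    have X: "\<eta> p (X p) = - H p"
      "\<And>w. ext_deriv \<A> \<eta> p (X p) w = differential \<A> H p w - differential \<A> H p (R p) * \<eta> p w"
      using assms(4) by (auto simp: contact_hamiltonian_field_def)
    have \<beta>: "\<beta> p u = - (H p * \<sigma> p u)" for u by (simp add: assms(9,10))
    show "(1 + (\<Sum>j = 1..n + 1. C j p * t ^ j))\<^sup>2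
      = (1 + t)\<^sup>2 * det_on {v. \<eta> p v = 0} (\<lambda>v. v + t *\<^sub>R N p v)"
      by (rule pencil_square[where \<omega> = "ext_deriv \<A> \<eta> p" and \<tau> = "ext_deriv \<A> \<sigma> p" and \<beta> = "\<beta> p"
            and d\<beta> = "ext_deriv \<A> \<beta> p", OF dim \<eta>p pencil(2,3)[OF p] Np pencil(4,5)[OF p] X(1)
            pencil(6,7)[OF p] X(2) \<beta> pencil(8)[OF p] v0 R N(2,3)[OF p] assms(11)[OF p] t])
  qed
  \<comment> \<open>A single choice on all of \<open>V\<close>, so that Newton's identities hold on
    a neighbourhood of each point and not only at the point.\<close>
  then obtain e where "\<And>p. p \<in> V \<Longrightarrow> good p (e p)" by metis
  then have e: "\<And>p. p \<in> V \<Longrightarrow> e p 0 = 1" "\<And>p j. p \<in> V \<Longrightarrow> j > n \<Longrightarrow> e p j = 0"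
    "\<And>p j. p \<in> V \<Longrightarrow> j \<in> {1..n + 1} \<Longrightarrow> C j p = e p j + e p (j - 1)"
    "\<And>p t. p \<in> V \<Longrightarrow> 1 + (\<Sum>j = 1..n + 1. C j p * t ^ j) = (1 + t) * (1 + (\<Sum>j = 1..n. e p j * t ^ j))"
    "\<And>p t. p \<in> V \<Longrightarrow> det_on {v. \<eta> p v = 0} (\<lambda>v. v + t *\<^sub>R N p v) = (1 + (\<Sum>j = 1..n. e p j * t ^ j))\<^sup>2"
    "\<And>p k. p \<in> V \<Longrightarrow> k \<ge> 1 \<Longrightarrow>
      2 * real k * e p k = (\<Sum>i = 1..k. (- 1) ^ (i + 1) * e p (k - i) * trace_on UNIV (N p ^^ i))"
    unfolding good_def by blast+
  have newton: "2 * real k * e p k = (\<Sum>i = 1..k. (- 1) ^ (i + 1) * e p (k - i) * tr i p)"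
    if "p \<in> V" "k \<ge> 1" for p k
    using e(6)[OF that] by (simp add: assms(14))
  have openV: "open V"
    using open_nonvanishing[OF atlas _ \<eta>, of \<Phi> X] assms(4,5)
    by (simp add: assms(6-8) contact_canonoid_def contact_hamiltonian_field_def)
  have dim_le: "dim (span {Blinfun (differential \<A> (tr k) p) | k. k \<ge> 1}) \<le> n" if p: "p \<in> V" for p
  proof -
    define c where "c = chart_at \<A> p"
    have c: "c \<in> \<A>" "p \<in> fst c" unfolding c_def by (rule chart_at_mem[OF atlas])+
    define x where "x = snd c p"
    let ?U = "snd c ` (fst c \<inter> V)"
    have U: "open ?U" "x \<in> ?U"
      using chart_facts(5)[OF atlas c(1) openV] c p by (auto simp: x_def)
    have inV: "chart_inv c y \<in> V" if y: "y \<in> ?U" for y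
      using y chart_facts(4)[OF atlas c(1)] by auto
    define B where "B k = Blinfun (frechet_derivative (tr k \<circ> chart_inv c) (at x))" for k
    have diff: "(tr k \<circ> chart_inv c has_derivative blinfun_apply (B k)) (at x)" for k
    proof -
      have "(tr k \<circ> chart_inv c) differentiable (at x)"
        unfolding assms(14) x_def by (rule trace_differentiable[OF atlas N(1) openV p c])
      then have D: "(tr k \<circ> chart_inv c has_derivative frechet_derivative (tr k \<circ> chart_inv c) (at x)) (at x)"
        by (rule has_frechet_derivative)
      then show ?thesis
        by (simp add: B_def bounded_linear_Blinfun_apply has_derivative_bounded_linear)
    qed
    have "B k \<in> span (B ` {1..n})" if k: "k \<ge> 1" for k
    proof -
      obtain B' where B': "B' \<in> span (B ` {1..n})" "(tr k \<circ> chart_inv c has_derivative blinfun_apply B') (at x)"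
        using newton_derivative_span[where e = "\<lambda>j y. e (chart_inv c y) j" and f = "\<lambda>k. tr k \<circ> chart_inv c"
            and B = B and n = n, OF U e(1)[OF inV] e(2)[OF inV] _ diff k] newton[OF inV] by auto
      \<comment> \<open>Uniqueness of the derivative carries membership in the span over to the
        differential of the trace itself.\<close>
      have "blinfun_apply B' = blinfun_apply (B k)"
        using has_derivative_unique[OF B'(2) diff] .
      then show ?thesis using B'(1) by (simp add: blinfun_apply_inject)
    qed
    moreover have "differential \<A> (tr k) p = frechet_derivative (tr k \<circ> chart_inv c) (at x)" for k
      by (simp add: differential_def c_def x_def)
    ultimately have "{Blinfun (differential \<A> (tr k) p) | k. k \<ge> 1} \<subseteq> span (B ` {1..n})"
      by (auto simp: B_def)
    then have "dim {Blinfun (differential \<A> (tr k) p) | k. k \<ge> 1} \<le> card (B ` {1..n})"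
      by (rule dim_le_card) simp
    also have "\<dots> \<le> n"
      using card_image_le[of "{1..n}" B] by simp
    finally show ?thesis by simp
  qed
  show ?thesis
  proof (intro exI[of _ "\<lambda>j p. e p j"] ballI)
    fix p assume p: "p \<in> V"
    note lists = newton_lists[of "e p" n "\<lambda>k. tr k p", OF e(1)[OF p] e(2)[OF p] newton[OF p]]
    have tr1: "tr 1 p = 2 * e p 1"
      using newton[OF p, of 1] e(1)[OF p] by simp
    have "{1..2::nat} = {1, 2}" by auto
    then have tr2: "tr 2 p = 2 * (e p 1)\<^sup>2 - 4 * e p 2"
      using newton[OF p, of 2] e(1)[OF p] tr1 by (simp add: power2_eq_square)
    have C1: "C 1 p = e p 1 + 1" using e(3)[OF p, of 1] e(1)[OF p] by simp
    \<comment> \<open>Index 2 lies in the range 1 to n + 1 because \<open>n\<close> \<ge> 1. For n =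
      1 the coefficient \<open>e p 2\<close> is the default 0.\<close>
    have C2: "C 2 p = e p 2 + e p 1" using e(3)[OF p, of 2] \<open>n \<ge> 1\<close> by simp
    show "(\<forall>t. 1 + (\<Sum>j = 1..n + 1. C j p * t ^ j) = (1 + t) * (1 + (\<Sum>j = 1..n. e p j * t ^ j))) \<and>
      (\<forall>t. det_on (\<D> p) (\<lambda>v. v + t *\<^sub>R N p v) = (1 + (\<Sum>j = 1..n. e p j * t ^ j))\<^sup>2) \<and>
      (\<forall>j\<in>{1..n}. e p j = coeff_from_traces (map (\<lambda>k. tr k p) [1..<n + 1]) j) \<and>
      (\<forall>k\<in>{1..n}. tr k p = trace_from_coeffs (map (\<lambda>j. e p j) [1..<n + 1]) k) \<and>
      tr 1 p = 2 * (C 1 p - 1) \<and>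
      tr 2 p = 2 * (C 1 p - 1)\<^sup>2 - 4 * (C 2 p - C 1 p + 1) \<and>
      (\<forall>k>n. tr k p = trace_from_coeffs (map (\<lambda>j. e p j) [1..<n + 1]) k) \<and>
      dim (span {Blinfun (differential \<A> (tr k) p) | k. k \<ge> 1}) \<le> n"
    proof (intro conjI allI ballI impI)
      show "tr k p = trace_from_coeffs (map (\<lambda>j. e p j) [1..<n + 1]) k" if "k > n" for k
        by (rule lists(1)) (use that in auto)
      show "tr k p = trace_from_coeffs (map (\<lambda>j. e p j) [1..<n + 1]) k" if "k \<in> {1..n}" for k
        by (rule lists(1)) (use that in auto)
      show "e p j = coeff_from_traces (map (\<lambda>k. tr k p) [1..<n + 1]) j" if "j \<in> {1..n}" for j
        by (rule lists(2)) (use that in auto)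
      show "det_on (\<D> p) (\<lambda>v. v + t *\<^sub>R N p v) = (1 + (\<Sum>j = 1..n. e p j * t ^ j))\<^sup>2" for t
        unfolding assms(12) by (rule e(5)[OF p])
      show "tr 2 p = 2 * (C 1 p - 1)\<^sup>2 - 4 * (C 2 p - C 1 p + 1)"
        unfolding C1 C2 tr2 by simp
    qed (use e(4)[OF p] tr1 C1 dim_le[OF p] in simp_all)
  qed
qed

end
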